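(* Let $\sigma>0$ and $\varpi\in\mathbb{R}$, and set $\nu=2\sigma^{-2}\varpi-1$. Let $a>0$. Let $z$ be any complex number with positive real part $z_0$ such that $z_0>2(\nu+1)$ if $\nu\ge 0$ and $z_0>4$ if $\nu<0$. Then $$\int_0^\infty e^{-zx}\,E^Q\big[(A_x^{(\nu)}-a)^+\big]\,dx=\frac{D_\nu(a,z)}{z\,(z-2(\nu+1))},$$ where, on setting $\mu(z)=\sqrt{2z+\nu^2}$, $$D_\nu(a,z)=\frac{\Gamma\left(\frac{\nu+4+\mu(z)}{2}\right)}{\Gamma(\mu(z)+1)}\cdot\Phi\left(\frac{\nu+4+\mu(z)}{2},\,\mu(z)+1;\,\frac{1}{2a}\right)\cdot\frac{(2a)^{\frac{\nu+2-\mu(z)}{2}}}{e^{\frac{1}{2a}}}.$$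
   Context: $B$ is a standard Brownian motion (started at $0$) under the probability measure $Q$, and $E^Q$ denotes expectation under $Q$. For $\nu\in\mathbb{R}$ and $x\ge 0$, Yor's accumulation process is $A_x^{(\nu)}=\int_0^x e^{2(B_w+\nu w)}\,dw$. For real $y$, $y^+=\max\{0,y\}$. The square root is the one associated with the principal branch of the logarithm on $\mathbb{C}\setminus\mathbb{R}_{\le 0}$ (arguments in $(-\pi,\pi)$, so that the square root has positive real part). $\Phi$ is the (Kummer) confluent hypergeometric function $\Phi(\alpha,\gamma;w)=\sum_{n=0}^\infty\frac{(\alpha)_n}{(\gamma)_n}\frac{w^n}{n!}$ with $(\alpha)_n=\alpha(\alpha+1)\cdots(\alpha+n-1)$. *)

theory Defs
  imports "HOL-Probability.Probability"
begin

(* Every path is continuous, so the path integrals below are measurable in the sample point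
   without assuming that Q is complete.  The second argument of normal_density is the standard
   deviation.  Nothing is assumed about B at negative times. *)
locale standard_brownian_motion = prob_space Q for Q :: "'a measure" +
  fixes B :: "real \<Rightarrow> 'a \<Rightarrow> real"
  assumes measurable_B: "\<And>t. 0 \<le> t \<Longrightarrow> B t \<in> borel_measurable Q"
    and start: "AE \<omega> in Q. B 0 \<omega> = 0"
    and indep_increments: "\<And>(n::nat) (t::nat \<Rightarrow> real).
      0 \<le> t 0 \<Longrightarrow> (\<And>i. i < n \<Longrightarrow> t i < t (Suc i)) \<Longrightarrow>
      indep_vars (\<lambda>_. borel) (\<lambda>i \<omega>. B (t (Suc i)) \<omega> - B (t i) \<omega>) {..<n}"
    and normal_increments: "\<And>s t. 0 \<le> s \<Longrightarrow> s < t \<Longrightarrow>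
      distributed Q lborel (\<lambda>\<omega>. B t \<omega> - B s \<omega>) (\<lambda>x. ennreal (normal_density 0 (sqrt (t - s)) x))"
    and continuous_paths: "\<And>\<omega>. \<omega> \<in> space Q \<Longrightarrow> continuous_on {0..} (\<lambda>t. B t \<omega>)"

definition yor_accumulation ::
    "(real \<Rightarrow> 'a \<Rightarrow> real) \<Rightarrow> real \<Rightarrow> real \<Rightarrow> 'a \<Rightarrow> real" where
  "yor_accumulation B \<nu> x \<omega> = (LBINT w:{0..x}. exp (2 * (B w \<omega> + \<nu> * w)))"

definition kummer_Phi :: "complex \<Rightarrow> complex \<Rightarrow> complex \<Rightarrow> complex" where
  "kummer_Phi \<alpha> \<gamma> w = (\<Sum>n. pochhammer \<alpha> n / pochhammer \<gamma> n * (w ^ n / fact n))"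

definition yor_mu :: "real \<Rightarrow> complex \<Rightarrow> complex" where
  "yor_mu \<nu> z = csqrt (2 * z + (complex_of_real \<nu>)\<^sup>2)"

definition yor_D :: "real \<Rightarrow> real \<Rightarrow> complex \<Rightarrow> complex" where
  "yor_D \<nu> a z =
     Gamma ((of_real \<nu> + 4 + yor_mu \<nu> z) / 2) / Gamma (yor_mu \<nu> z + 1)
     * kummer_Phi ((of_real \<nu> + 4 + yor_mu \<nu> z) / 2) (yor_mu \<nu> z + 1) (of_real (1 / (2 * a)))
     * (of_real (2 * a) powr ((of_real \<nu> + 2 - yor_mu \<nu> z) / 2) / of_real (exp (1 / (2 * a))))"

end

theory Submission
  imports Defs "HOL-Real_Asymp.Real_Asymp"
begin

text \<open>
  Put \<open>S t = exp (2 (B t + \<nu> t))\<close> and \<open>K t = (a - A t) / S t\<close>, where \<open>A\<close> is the accumulation process.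
  For a function \<open>G\<close> that solves
  \<open>2 k\<^sup>2 G'' - (2 (\<nu> + 1) k + 1) G' + 2 (\<nu> + 1) G = z G - max 0 (- k)\<close>,
  the derivative of \<open>m t = E (S t G (K t))\<close> is \<open>z m t - E (max 0 (A t - a))\<close>. Hence
  \<open>exp (- z t) m t\<close> is a primitive of minus the integrand of the Laplace transform, it tends to \<open>0\<close>,
  and the transform equals \<open>m 0 = G a\<close>. The derivative is obtained without stochastic calculus: one
  expands to first order in time, using only the independence and normality of increments,
  with an error \<open>O(h\<^sup>3\<^sup>/\<^sup>2)\<close> per step of length \<open>h\<close>, and sums over a grid.

  The solution \<open>G\<close> is, for \<open>k \<ge> 0\<close>, a multiple of the Weyl fractional integral of
  \<open>r \<mapsto> exp (- 1 / (2 r)) r powr - (\<mu> + 1)\<close> of order \<open>(\<mu> + \<nu> + 4) / 2\<close>, and linear for \<open>k \<le> 0\<close>.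
  Expanding \<open>exp (1 / (2 k) - 1 / (2 (v + k)))\<close> under the integral in powers of \<open>v / (v + k)\<close> yields
  Kummer's series.
\<close>

section \<open>Riemann sums and path integrals\<close>

text \<open>Why one variable suffices: after time \<open>t\<close> the accumulation grows by
  \<open>S t\<close> times an independent copy of itself, so given the past the payoff at strike
  \<open>a\<close> becomes \<open>S t\<close> times the payoff at strike \<open>K t\<close>. Hence
  \<open>G k\<close> must be the transform at strike \<open>k\<close>; for \<open>k \<le> 0\<close>
  it is explicit, which fixes the value \<open>1 / (z (z - 2 (\<nu> + 1)))\<close> and the slope
  \<open>- 1 / z\<close> at 0. Where \<mu> comes from: at infinity the equation admits the powers
  \<open>k powr (- s)\<close> with \<open>2 s^2 + 2 (\<nu> + 2) s + 2 (\<nu> + 1) - z = 0\<close>,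
  whose discriminant is \<open>4 \<mu>^2\<close>; decay selects
  \<open>s = (\<mu> - \<nu> - 2) / 2\<close>. The obstacle is \<open>k = 0\<close>: there the second
  derivative of \<open>G\<close> may jump, so an ordinary second order expansion fails. The Brownian
  increment \<open>n\<close>, however, acts on \<open>K\<close> by the factor
  \<open>exp (- 2 n)\<close>, which preserves the sign; only the shift by \<open>- h\<close> can
  cross 0, and for that shift a Lipschitz first derivative is enough. As \<open>n\<close> has size
  \<open>sqrt h\<close>, pointwise errors are measured by
  \<open>h sqrt h exp (3 |n| / sqrt h)\<close>, whose exponential factor has moments bounded
  uniformly in \<open>h\<close>.\<close>

lemma riemann_sum_error:
  fixes f :: "real \<Rightarrow> 'b::banach"
  assumes d: "0 \<le> d" and "continuous_on {s..s + real n * d} f"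
    and "\<And>x y. x \<in> {s..s + real n * d} \<Longrightarrow> y \<in> {s..s + real n * d} \<Longrightarrow> \<bar>x - y\<bar> \<le> d
      \<Longrightarrow> norm (f x - f y) \<le> e"
  shows "norm (integral {s..s + real n * d} f - d *\<^sub>R (\<Sum>i<n. f (s + real i * d))) \<le> real n * d * e"
  using assms(2,3)
proof (induction n)
  case 0
  then show ?case by simp
next
  case (Suc n)
  let ?m = "s + real n * d" and ?r = "s + real (Suc n) * d"
  have mr: "?r = ?m + d" by (simp add: algebra_simps)
  have le: "s \<le> ?m" "?m \<le> ?r" using d by (auto simp: algebra_simps)
  have int: "f integrable_on {s..?r}" using Suc.prems(1) by (rule integrable_continuous_interval)
  have comb: "integral {s..?r} f = integral {s..?m} f + integral {?m..?r} f"
    using Henstock_Kurzweil_Integration.integral_combine[OF le int] by simp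
  have IH: "norm (integral {s..?m} f - d *\<^sub>R (\<Sum>i<n. f (s + real i * d))) \<le> real n * d * e"
    using le by (intro Suc.IH continuous_on_subset[OF Suc.prems(1)] Suc.prems(2)) auto
  have int2: "f integrable_on {?m..?r}"
    using le by (intro integrable_continuous_interval continuous_on_subset[OF Suc.prems(1)]) auto
  have "norm (integral {?m..?r} f - d *\<^sub>R f ?m) = norm (integral {?m..?r} (\<lambda>x. f x - f ?m))"
  proof -
    have "integral {?m..?r} (\<lambda>x. f x - f ?m) = integral {?m..?r} f - (?r - ?m) *\<^sub>R f ?m"
      using int2 le by (subst Henstock_Kurzweil_Integration.integral_diff) auto
    then show ?thesis unfolding mr by simp
  qed
  also have "\<dots> \<le> e * (?r - ?m)"
  proof (intro integral_bound)
    show "continuous_on {?m..?r} (\<lambda>x. f x - f ?m)"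
      using le by (intro continuous_intros continuous_on_subset[OF Suc.prems(1)]) auto
    show "norm (f x - f ?m) \<le> e" if "x \<in> {?m..?r}" for x
    proof (intro Suc.prems(2))
      have x: "?m \<le> x" "x \<le> ?r" using that by auto
      show "x \<in> {s..?r}" "?m \<in> {s..?r}" using x le unfolding atLeastAtMost_iff by linarith+
      show "\<bar>x - ?m\<bar> \<le> d" using x mr by linarith
    qed
  qed (rule le)
  also have "\<dots> = d * e" unfolding mr by (simp add: mult.commute)
  finally have "norm (integral {?m..?r} f - d *\<^sub>R f ?m) \<le> d * e" .
  with IH have "norm ((integral {s..?m} f - d *\<^sub>R (\<Sum>i<n. f (s + real i * d))) +
      (integral {?m..?r} f - d *\<^sub>R f ?m)) \<le> real n * d * e + d * e"
    by (intro order_trans[OF norm_triangle_ineq] add_mono)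
  then show ?case unfolding comb by (simp add: algebra_simps)
qed

text \<open>Equidistant Riemann sums of a path functional involve finitely many increments;
  measurability, expectation bounds and independence of path integrals are all obtained as limits of
  such sums.\<close>

lemma riemann_sums_tendsto:
  fixes f :: "real \<Rightarrow> 'b::banach"
  assumes "s \<le> t" and cont: "continuous_on {s..t} f"
  shows "(\<lambda>n. ((t - s) / real (Suc n)) *\<^sub>R (\<Sum>i<Suc n. f (s + real i * ((t - s) / real (Suc n)))))
    \<longlonglongrightarrow> integral {s..t} f"
proof (rule LIMSEQ_I)
  fix e :: real assume e: "e > 0"
  \<comment> \<open>The \<open>+ 1\<close> keeps the denominator positive when
    \<open>s = t\<close>.\<close>
  define e' where "e' = e / (2 * (t - s + 1))"
  have e': "e' > 0" using e assms(1) by (simp add: e'_def)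
  have "uniformly_continuous_on {s..t} f" by (rule compact_uniformly_continuous[OF cont]) simp
  then obtain d where d: "d > 0"
    "\<And>x y. x \<in> {s..t} \<Longrightarrow> y \<in> {s..t} \<Longrightarrow> dist y x < d \<Longrightarrow> dist (f y) (f x) < e'"
    unfolding uniformly_continuous_on_def using e' by metis
  obtain N where N: "(t - s) / d < real N" using reals_Archimedean2 by blast
  show "\<exists>no. \<forall>n\<ge>no. norm (((t - s) / real (Suc n)) *\<^sub>R (\<Sum>i<Suc n. f (s + real i * ((t - s) / real (Suc n))))
      - integral {s..t} f) < e"
  proof (intro exI allI impI)
    fix n assume n: "N \<le> n"
    let ?h = "(t - s) / real (Suc n)"
    have h0: "0 \<le> ?h" using assms by simp
    have "(t - s) / d < real (Suc n)" using N n by simp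
    then have hd: "?h < d" using d(1) by (simp add: field_simps)
    have end_eq: "s + real (Suc n) * ?h = t" by simp
    have "norm (integral {s..s + real (Suc n) * ?h} f - ?h *\<^sub>R (\<Sum>i<Suc n. f (s + real i * ?h))) \<le> real (Suc n) * ?h * e'"
    proof (rule riemann_sum_error[OF h0])
      show "continuous_on {s..s + real (Suc n) * ?h} f" unfolding end_eq by (rule cont)
      fix x y assume "x \<in> {s..s + real (Suc n) * ?h}" "y \<in> {s..s + real (Suc n) * ?h}" "\<bar>x - y\<bar> \<le> ?h"
      then show "norm (f x - f y) \<le> e'"
        using d(2)[of y x] hd unfolding end_eq by (simp add: dist_norm less_imp_le)
    qed
    also have "real (Suc n) * ?h * e' = (t - s) * e'" by simp
    also have "\<dots> = e * ((t - s) / (2 * (t - s + 1)))" by (simp add: e'_def)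
    also have "\<dots> < e * 1"
      using e assms(1) by (intro mult_strict_left_mono) (auto simp: field_simps)
    also have "\<dots> = e" by simp
    finally show "norm (?h *\<^sub>R (\<Sum>i<Suc n. f (s + real i * ?h)) - integral {s..t} f) < e"
      unfolding end_eq by (simp add: norm_minus_commute)
  qed
qed

text \<open>Fubini would ask for joint measurability of \<open>X\<close>. Continuity of the paths
  replaces it: the Riemann sums converge pointwise, their expectations are at most
  \<open>(t - s) * K\<close>, and Fatou's lemma carries the bound over to the limit.\<close>

lemma path_integral_bound:
  fixes X :: "real \<Rightarrow> 'a \<Rightarrow> real"
  assumes st: "s \<le> t"
    and meas: "\<And>w. w \<in> {s..t} \<Longrightarrow> X w \<in> borel_measurable M"
    and nonneg: "\<And>w \<omega>. w \<in> {s..t} \<Longrightarrow> \<omega> \<in> space M \<Longrightarrow> 0 \<le> X w \<omega>"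
    and int: "\<And>w. w \<in> {s..t} \<Longrightarrow> integrable M (X w)"
    and bd: "\<And>w. w \<in> {s..t} \<Longrightarrow> (\<integral>\<omega>. X w \<omega> \<partial>M) \<le> K"
    and cont: "\<And>\<omega>. \<omega> \<in> space M \<Longrightarrow> continuous_on {s..t} (\<lambda>w. X w \<omega>)"
  shows path_integral_integrable: "integrable M (\<lambda>\<omega>. integral {s..t} (\<lambda>w. X w \<omega>))"
    and path_integral_expectation_le: "(\<integral>\<omega>. integral {s..t} (\<lambda>w. X w \<omega>) \<partial>M) \<le> (t - s) * K"
proof -
  define R where "R n \<omega> = ((t - s) / real (Suc n)) * (\<Sum>i<Suc n. X (s + real i * ((t - s) / real (Suc n))) \<omega>)" for n \<omega>
  have in_st: "s + real i * ((t - s) / real (Suc n)) \<in> {s..t}" if "i < Suc n" for i n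
  proof -
    have "real i * ((t - s) / real (Suc n)) \<le> real (Suc n) * ((t - s) / real (Suc n))"
      using that st by (intro mult_right_mono) auto
    also have "\<dots> = t - s" by simp
    finally show ?thesis using st by simp
  qed
  have lim: "(\<lambda>n. R n \<omega>) \<longlonglongrightarrow> integral {s..t} (\<lambda>w. X w \<omega>)" if "\<omega> \<in> space M" for \<omega>
    using riemann_sums_tendsto[OF st cont[OF that]] by (simp add: R_def)
  have Rint: "integrable M (R n)" for n
    unfolding R_def using in_st int by (intro integrable_mult_right Bochner_Integration.integrable_sum) auto
  have Rnn: "0 \<le> R n \<omega>" if "\<omega> \<in> space M" for n \<omega>
    unfolding R_def using st in_st nonneg that by (intro mult_nonneg_nonneg sum_nonneg) auto
  have meas_int: "(\<lambda>\<omega>. integral {s..t} (\<lambda>w. X w \<omega>)) \<in> borel_measurable M"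
    by (rule borel_measurable_LIMSEQ_real[OF lim borel_measurable_integrable[OF Rint]])
  have RK: "(\<integral>\<omega>. R n \<omega> \<partial>M) \<le> (t - s) * K" for n
  proof -
    have "(\<integral>\<omega>. R n \<omega> \<partial>M) = ((t - s) / real (Suc n)) * (\<Sum>i<Suc n. \<integral>\<omega>. X (s + real i * ((t - s) / real (Suc n))) \<omega> \<partial>M)"
      unfolding R_def
      by (subst integral_mult_right_zero, subst Bochner_Integration.integral_sum) (use in_st int in auto)
    also have "\<dots> \<le> ((t - s) / real (Suc n)) * (\<Sum>i<Suc n. K)"
      using st in_st bd by (intro mult_left_mono sum_mono) auto
    also have "\<dots> = (t - s) * K" by simp
    finally show ?thesis .
  qed
  have K0: "0 \<le> (t - s) * K"
    by (rule order_trans[OF integral_nonneg_AE RK[of 0]]) (use Rnn in auto)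
  have "(\<integral>\<^sup>+\<omega>. ennreal (integral {s..t} (\<lambda>w. X w \<omega>)) \<partial>M) = (\<integral>\<^sup>+\<omega>. liminf (\<lambda>n. ennreal (R n \<omega>)) \<partial>M)"
    by (intro nn_integral_cong sym[OF lim_imp_Liminf] tendsto_ennrealI lim) auto
  also have "\<dots> \<le> liminf (\<lambda>n. \<integral>\<^sup>+\<omega>. ennreal (R n \<omega>) \<partial>M)"
    using borel_measurable_integrable[OF Rint] by (intro nn_integral_liminf) measurable
  also have "\<dots> \<le> liminf (\<lambda>n. ennreal ((t - s) * K))"
    by (intro Liminf_mono always_eventually allI)
       (subst nn_integral_eq_integral[OF Rint]; use Rnn RK in \<open>auto intro!: ennreal_leI AE_I2\<close>)
  also have "\<dots> = ennreal ((t - s) * K)" by (simp add: Liminf_const)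
  finally have le: "(\<integral>\<^sup>+\<omega>. ennreal (integral {s..t} (\<lambda>w. X w \<omega>)) \<partial>M) \<le> ennreal ((t - s) * K)" .
  have nn: "0 \<le> integral {s..t} (\<lambda>w. X w \<omega>)" if "\<omega> \<in> space M" for \<omega>
    by (rule LIMSEQ_le_const[OF lim[OF that]]) (use Rnn[OF that] in auto)
  show i: "integrable M (\<lambda>\<omega>. integral {s..t} (\<lambda>w. X w \<omega>))"
  proof (rule integrableI_bounded)
    have "(\<integral>\<^sup>+\<omega>. ennreal (norm (integral {s..t} (\<lambda>w. X w \<omega>))) \<partial>M) = (\<integral>\<^sup>+\<omega>. ennreal (integral {s..t} (\<lambda>w. X w \<omega>)) \<partial>M)"
      by (intro nn_integral_cong) (use nn in auto)
    also have "\<dots> < \<infinity>" using le by (rule order.strict_trans1) simp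
    finally show "(\<integral>\<^sup>+\<omega>. ennreal (norm (integral {s..t} (\<lambda>w. X w \<omega>))) \<partial>M) < \<infinity>" .
  qed (rule meas_int)
  show "(\<integral>\<omega>. integral {s..t} (\<lambda>w. X w \<omega>) \<partial>M) \<le> (t - s) * K"
    using le nn K0 by (subst (asm) nn_integral_eq_integral[OF i]) (auto intro: AE_I2)
qed

section \<open>Brownian motion and its accumulation process\<close>

text \<open>Completing the square: exponential tilting only moves the mean, so exponential moments
  are read off from the total mass 1 of the shifted density.\<close>

lemma exp_mult_normal_density:
  assumes "s > 0"
  shows "exp (l * x) * normal_density 0 s x = exp (l\<^sup>2 * s\<^sup>2 / 2) * normal_density (l * s\<^sup>2) s x"
proof -
  have "l * x + (- (x - 0)\<^sup>2 / (2 * s\<^sup>2)) = l\<^sup>2 * s\<^sup>2 / 2 + (- (x - l * s\<^sup>2)\<^sup>2 / (2 * s\<^sup>2))"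
    using assms by (simp add: field_simps power2_eq_square)
  then have "exp (l * x) * exp (- (x - 0)\<^sup>2 / (2 * s\<^sup>2)) =
      exp (l\<^sup>2 * s\<^sup>2 / 2) * exp (- (x - l * s\<^sup>2)\<^sup>2 / (2 * s\<^sup>2))"
    by (simp add: exp_add [symmetric])
  then show ?thesis by (simp add: normal_density_def mult.left_commute)
qed

context standard_brownian_motion
begin

lemma increment_exp:
  assumes "0 \<le> s" "s \<le> t"
  shows integrable_exp_increment: "integrable Q (\<lambda>\<omega>. exp (l * (B t \<omega> - B s \<omega>)))"
    and expectation_exp_increment: "expectation (\<lambda>\<omega>. exp (l * (B t \<omega> - B s \<omega>))) = exp (l\<^sup>2 * (t - s) / 2)"
proof -
  have "integrable Q (\<lambda>\<omega>. exp (l * (B t \<omega> - B s \<omega>))) \<and>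
      expectation (\<lambda>\<omega>. exp (l * (B t \<omega> - B s \<omega>))) = exp (l\<^sup>2 * (t - s) / 2)"
  proof (cases "s = t")
    case True
    then show ?thesis by (simp add: prob_space)
  next
    case False
    then have st: "s < t" "0 < sqrt (t - s)" using assms by auto
    note d = normal_increments[OF assms(1) st(1)]
    have eq: "normal_density 0 (sqrt (t - s)) x * exp (l * x) =
        exp (l\<^sup>2 * (t - s) / 2) * normal_density (l * (t - s)) (sqrt (t - s)) x" for x
      using exp_mult_normal_density[OF st(2), of l x] st by (simp add: mult.commute)
    have "integrable lborel (\<lambda>x. normal_density 0 (sqrt (t - s)) x * exp (l * x))"
      unfolding eq using st by simp
    then have 1: "integrable Q (\<lambda>\<omega>. exp (l * (B t \<omega> - B s \<omega>)))"
      by (subst (asm) distributed_integrable[OF d, of "\<lambda>x. exp (l * x)"]) auto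
    have "expectation (\<lambda>\<omega>. exp (l * (B t \<omega> - B s \<omega>))) = (\<integral>x. normal_density 0 (sqrt (t - s)) x * exp (l * x) \<partial>lborel)"
      by (subst distributed_integral[OF d, of "\<lambda>x. exp (l * x)"]) auto
    also have "\<dots> = exp (l\<^sup>2 * (t - s) / 2)"
      unfolding eq using st by simp
    finally show ?thesis using 1 by simp
  qed
  then show "integrable Q (\<lambda>\<omega>. exp (l * (B t \<omega> - B s \<omega>)))"
    "expectation (\<lambda>\<omega>. exp (l * (B t \<omega> - B s \<omega>))) = exp (l\<^sup>2 * (t - s) / 2)" by auto
qed

lemma B_exp:
  assumes "0 \<le> t"
  shows integrable_exp_B: "integrable Q (\<lambda>\<omega>. exp (l * B t \<omega>))"
    and expectation_exp_B: "expectation (\<lambda>\<omega>. exp (l * B t \<omega>)) = exp (l\<^sup>2 * t / 2)"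
proof -
  have [measurable]: "B 0 \<in> borel_measurable Q" "B t \<in> borel_measurable Q"
    using measurable_B assms by auto
  have ae: "AE \<omega> in Q. exp (l * (B t \<omega> - B 0 \<omega>)) = exp (l * B t \<omega>)"
    using start by eventually_elim simp
  show "integrable Q (\<lambda>\<omega>. exp (l * B t \<omega>))"
    by (rule integrable_cong_AE_imp[OF integrable_exp_increment[OF order_refl assms, of l]])
      (use ae in \<open>auto elim: eventually_mono\<close>)
  show "expectation (\<lambda>\<omega>. exp (l * B t \<omega>)) = exp (l\<^sup>2 * t / 2)"
    using integral_cong_AE[OF _ _ ae] expectation_exp_increment[OF order_refl assms, of l] by simp
qed

text \<open>\<open>exp (l |x|)\<close> is at most \<open>exp (l x) + exp (- l x)\<close>, and both
  terms have the same expectation; hence the factor 2.\<close>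

lemma exp_abs_increment:
  assumes "0 \<le> s" "s \<le> t"
  shows integrable_exp_abs_increment: "integrable Q (\<lambda>\<omega>. exp (l * \<bar>B t \<omega> - B s \<omega>\<bar>))"
    and expectation_exp_abs_increment: "expectation (\<lambda>\<omega>. exp (l * \<bar>B t \<omega> - B s \<omega>\<bar>)) \<le> 2 * exp (l\<^sup>2 * (t - s) / 2)"
proof -
  have [measurable]: "B s \<in> borel_measurable Q" "B t \<in> borel_measurable Q"
    using measurable_B assms by auto
  let ?g = "\<lambda>\<omega>. exp (l * (B t \<omega> - B s \<omega>)) + exp ((- l) * (B t \<omega> - B s \<omega>))"
  have g: "integrable Q ?g" by (intro Bochner_Integration.integrable_add integrable_exp_increment assms)
  have le: "exp (l * \<bar>B t \<omega> - B s \<omega>\<bar>) \<le> ?g \<omega>" for \<omega>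
    by (cases "B t \<omega> - B s \<omega> \<ge> 0") (auto simp: abs_if add_increasing add_increasing2 algebra_simps)
  show i: "integrable Q (\<lambda>\<omega>. exp (l * \<bar>B t \<omega> - B s \<omega>\<bar>))"
    by (rule Bochner_Integration.integrable_bound[OF g])
      (use le in \<open>auto intro!: AE_I2 simp: abs_of_nonneg add_nonneg_nonneg\<close>)
  have "expectation (\<lambda>\<omega>. exp (l * \<bar>B t \<omega> - B s \<omega>\<bar>)) \<le> expectation ?g"
    by (intro integral_mono i g le)
  also have "\<dots> = 2 * exp (l\<^sup>2 * (t - s) / 2)"
    by (subst Bochner_Integration.integral_add) (use assms integrable_exp_increment[of s t l] integrable_exp_increment[of s t "-l"] expectation_exp_increment[of s t l]
      expectation_exp_increment[of s t "-l"] in auto)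
  finally show "expectation (\<lambda>\<omega>. exp (l * \<bar>B t \<omega> - B s \<omega>\<bar>)) \<le> 2 * exp (l\<^sup>2 * (t - s) / 2)" .
qed

lemma increment_moments:
  assumes "0 \<le> s" "s < t"
  shows integrable_increment: "integrable Q (\<lambda>\<omega>. B t \<omega> - B s \<omega>)"
    and expectation_increment: "expectation (\<lambda>\<omega>. B t \<omega> - B s \<omega>) = 0"
    and integrable_increment_square: "integrable Q (\<lambda>\<omega>. (B t \<omega> - B s \<omega>)\<^sup>2)"
    and expectation_increment_square: "expectation (\<lambda>\<omega>. (B t \<omega> - B s \<omega>)\<^sup>2) = t - s"
proof -
  note d = normal_increments[OF assms]
  have s: "0 < sqrt (t - s)" using assms by simp
  show "integrable Q (\<lambda>\<omega>. B t \<omega> - B s \<omega>)"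
    using integrable_normal_moment[OF s, of 0 1] distributed_integrable[OF d, of "\<lambda>x. x"] by auto
  show "expectation (\<lambda>\<omega>. B t \<omega> - B s \<omega>) = 0"
    using integral_normal_moment_odd[OF s, of 0 0] distributed_integral[OF d, of "\<lambda>x. x"] by auto
  show "integrable Q (\<lambda>\<omega>. (B t \<omega> - B s \<omega>)\<^sup>2)"
    using integrable_normal_moment[OF s, of 0 2] distributed_integrable[OF d, of "\<lambda>x. x\<^sup>2"] by auto
  show "expectation (\<lambda>\<omega>. (B t \<omega> - B s \<omega>)\<^sup>2) = t - s"
    using integral_normal_moment_even[OF s, of 0 1] distributed_integral[OF d, of "\<lambda>x. x\<^sup>2"] assms
    by (auto simp: fact_2)
qed

lemma continuous_path_exp:
  assumes "\<omega> \<in> space Q" "T \<subseteq> {0..}"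
  shows "continuous_on T (\<lambda>w. exp (2 * (B w \<omega> + \<nu> * w)))"
  by (intro continuous_intros continuous_on_subset[OF continuous_paths[OF assms(1)] assms(2)])

lemma yor_accumulation_eq_integral:
  assumes "\<omega> \<in> space Q"
  shows "yor_accumulation B \<nu> x \<omega> = integral {0..x} (\<lambda>w. exp (2 * (B w \<omega> + \<nu> * w)))"
  unfolding yor_accumulation_def
  by (intro set_borel_integral_eq_integral borel_integrable_atLeastAtMost' continuous_path_exp assms) auto

lemma exp_drifted_B:
  assumes "0 \<le> t"
  shows integrable_exp_drifted_B: "integrable Q (\<lambda>\<omega>. exp (l * (B t \<omega> + \<nu> * t)))"
    and expectation_exp_drifted_B: "expectation (\<lambda>\<omega>. exp (l * (B t \<omega> + \<nu> * t))) = exp ((l\<^sup>2 / 2 + l * \<nu>) * t)"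
  using integrable_exp_B[OF assms, of l] expectation_exp_B[OF assms, of l]
  by (simp_all add: distrib_left exp_add mult.assoc distrib_right mult.commute)

text \<open>The integrand at time \<open>w\<close> has mean \<open>exp (2 (\<nu> + 1) w)\<close>.
  Truncating the rate at 0 makes the bound nondecreasing in time, so that its value at
  \<open>t\<close> serves for all earlier \<open>w\<close>, whatever the sign of
  \<open>\<nu> + 1\<close>.\<close>

lemma yor_accumulation_increment:
  assumes "0 \<le> s" "s \<le> t"
  shows integrable_yor_accumulation_increment:
      "integrable Q (\<lambda>\<omega>. integral {s..t} (\<lambda>w. exp (2 * (B w \<omega> + \<nu> * w))))"
    and expectation_yor_accumulation_increment:
      "expectation (\<lambda>\<omega>. integral {s..t} (\<lambda>w. exp (2 * (B w \<omega> + \<nu> * w)))) \<le> (t - s) * exp (max 0 (2 * (\<nu> + 1)) * t)"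
proof -
  have bd: "expectation (\<lambda>\<omega>. exp (2 * (B w \<omega> + \<nu> * w))) \<le> exp (max 0 (2 * (\<nu> + 1)) * t)" if "w \<in> {s..t}" for w
  proof -
    have "2 * (\<nu> + 1) * w \<le> max 0 (2 * (\<nu> + 1)) * w" using that assms by (intro mult_right_mono) auto
    also have "\<dots> \<le> max 0 (2 * (\<nu> + 1)) * t" using that assms by (intro mult_left_mono) auto
    finally show ?thesis
      using that assms by (subst expectation_exp_drifted_B) (auto simp: algebra_simps)
  qed
  have c: "continuous_on {s..t} (\<lambda>w. exp (2 * (B w \<omega> + \<nu> * w)))" if "\<omega> \<in> space Q" for \<omega>
    using that assms by (intro continuous_path_exp) auto
  have m: "(\<lambda>\<omega>. exp (2 * (B w \<omega> + \<nu> * w))) \<in> borel_measurable Q" if "w \<in> {s..t}" for w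
    using measurable_B[of w] that assms by auto
  have i: "integrable Q (\<lambda>\<omega>. exp (2 * (B w \<omega> + \<nu> * w)))" if "w \<in> {s..t}" for w
    using that assms by (intro integrable_exp_drifted_B) auto
  show "integrable Q (\<lambda>\<omega>. integral {s..t} (\<lambda>w. exp (2 * (B w \<omega> + \<nu> * w))))"
    by (rule path_integral_integrable[OF assms(2) m _ i bd c]) auto
  show "expectation (\<lambda>\<omega>. integral {s..t} (\<lambda>w. exp (2 * (B w \<omega> + \<nu> * w)))) \<le> (t - s) * exp (max 0 (2 * (\<nu> + 1)) * t)"
    by (rule path_integral_expectation_le[OF assms(2) m _ i bd c]) auto
qed

lemma integrable_yor_accumulation:
  assumes "0 \<le> t"
  shows "integrable Q (yor_accumulation B \<nu> t)"
  using integrable_yor_accumulation_increment[OF order_refl assms, of \<nu>]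
  by (subst Bochner_Integration.integrable_cong[OF refl yor_accumulation_eq_integral]) auto

lemma measurable_yor_accumulation:
  "0 \<le> t \<Longrightarrow> yor_accumulation B \<nu> t \<in> borel_measurable Q"
  using integrable_yor_accumulation by (rule borel_measurable_integrable)

text \<open>The increments over a grid of \<open>[0, t]\<close> and the one from \<open>t\<close> to
  \<open>t + h\<close> form a single independent family; splitting its index set separates past from
  future.\<close>

lemma indep_var_past_increment:
  assumes t: "0 < t" and h: "0 < h" and n: "0 < n"
    and g: "g \<in> borel_measurable (PiM {..<n} (\<lambda>_. borel))" and \<phi>: "\<phi> \<in> borel_measurable borel"
  shows "indep_var
      borel (\<lambda>\<omega>. g (\<lambda>i\<in>{..<n}. B (real (Suc i) * (t / real n)) \<omega> - B (real i * (t / real n)) \<omega>))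
      borel (\<lambda>\<omega>. \<phi> (B (t + h) \<omega> - B t \<omega>))"
proof -
  \<comment> \<open>The indices up to \<open>n\<close> run through the grid of
    \<open>[0, t]\<close>; index \<open>Suc n\<close> is sent to \<open>t + h\<close>, so its
    predecessor is \<open>t\<close> itself.\<close>
  define \<tau> where "\<tau> i = (if i \<le> n then real i * (t / real n) else t + h)" for i
  have "\<tau> i < \<tau> (Suc i)" if "i < Suc n" for i
  proof (cases "i = n")
    case True
    then show ?thesis using n h by (simp add: \<tau>_def)
  next
    case False
    then show ?thesis using that t n by (simp add: \<tau>_def field_simps)
  qed
  then have iv: "indep_vars (\<lambda>_. borel) (\<lambda>i \<omega>. B (\<tau> (Suc i)) \<omega> - B (\<tau> i) \<omega>) {..<Suc n}"
    by (intro indep_increments) (auto simp: \<tau>_def)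
  have "indep_var (PiM {..<n} (\<lambda>_. borel)) (\<lambda>\<omega>. restrict (\<lambda>i. B (\<tau> (Suc i)) \<omega> - B (\<tau> i) \<omega>) {..<n})
     (PiM {n} (\<lambda>_. borel)) (\<lambda>\<omega>. restrict (\<lambda>i. B (\<tau> (Suc i)) \<omega> - B (\<tau> i) \<omega>) {n})"
    by (rule indep_var_restrict[OF iv]) auto
  from indep_var_compose[OF this g, of "\<lambda>f. \<phi> (f n)" borel]
  have "indep_var borel (\<lambda>\<omega>. g (restrict (\<lambda>i. B (\<tau> (Suc i)) \<omega> - B (\<tau> i) \<omega>) {..<n}))
     borel (\<lambda>\<omega>. \<phi> (B (\<tau> (Suc n)) \<omega> - B (\<tau> n) \<omega>))"
    using measurable_compose[OF _ \<phi>, of "\<lambda>f. f n" "PiM {n} (\<lambda>_. borel)"] by (simp add: o_def measurable_component_singleton)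
  moreover have "restrict (\<lambda>i. B (\<tau> (Suc i)) \<omega> - B (\<tau> i) \<omega>) {..<n} =
    (\<lambda>i\<in>{..<n}. B (real (Suc i) * (t / real n)) \<omega> - B (real i * (t / real n)) \<omega>)" for \<omega>
    by (intro restrict_ext) (auto simp: \<tau>_def)
  moreover have "\<tau> (Suc n) = t + h" "\<tau> n = t" using n by (auto simp: \<tau>_def)
  ultimately show ?thesis by (simp only:)
qed

text \<open>
  Independence of the pair formed by \<open>B t\<close> and the accumulated integral from later increments:
  Riemann sums of the integral are functions of finitely many earlier increments.
\<close>

lemma past_functional_times_increment:
  fixes F :: "real \<Rightarrow> real \<Rightarrow> complex" and \<phi> :: "real \<Rightarrow> real"
  assumes t: "0 \<le> t" and h: "0 < h"
    and F: "continuous_on UNIV (\<lambda>p. F (fst p) (snd p))"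
    and F_le: "\<And>x y. norm (F x y) \<le> K * exp (2 * x)"
    and [measurable]: "\<phi> \<in> borel_measurable borel"
    and \<phi>: "integrable Q (\<lambda>\<omega>. \<phi> (B (t + h) \<omega> - B t \<omega>))"
  shows integrable_past_functional: "integrable Q (\<lambda>\<omega>. F (B t \<omega>) (yor_accumulation B \<nu> t \<omega>))"
    and integrable_past_functional_times_increment:
      "integrable Q (\<lambda>\<omega>. F (B t \<omega>) (yor_accumulation B \<nu> t \<omega>) * of_real (\<phi> (B (t + h) \<omega> - B t \<omega>)))"
    and expectation_past_functional_times_increment:
      "expectation (\<lambda>\<omega>. F (B t \<omega>) (yor_accumulation B \<nu> t \<omega>) * of_real (\<phi> (B (t + h) \<omega> - B t \<omega>))) =
       expectation (\<lambda>\<omega>. F (B t \<omega>) (yor_accumulation B \<nu> t \<omega>)) * of_real (expectation (\<lambda>\<omega>. \<phi> (B (t + h) \<omega> - B t \<omega>)))"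
proof -
  let ?A = "yor_accumulation B \<nu> t" and ?D = "\<lambda>\<omega>. B (t + h) \<omega> - B t \<omega>"
  note [measurable] = measurable_yor_accumulation[OF t, of \<nu>]
  have [measurable]: "B t \<in> borel_measurable Q" "B (t + h) \<in> borel_measurable Q" "B 0 \<in> borel_measurable Q"
    using t h by (auto intro: measurable_B)
  have Fm: "(\<lambda>p. F (fst p) (snd p)) \<in> borel_measurable borel"
    using F by (rule borel_measurable_continuous_onI)
  have Fm2: "(\<lambda>x. F (f x) (g x)) \<in> borel_measurable M"
    if "f \<in> borel_measurable M" "g \<in> borel_measurable M" for f g and M :: "'m measure"
    using measurable_compose[OF borel_measurable_Pair[OF that] Fm] by simp
  have K: "0 \<le> K" using order_trans[OF norm_ge_zero F_le[of 0 0]] by simp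
  have dom: "integrable Q (\<lambda>\<omega>. K * exp (2 * B t \<omega>))"
    using integrable_exp_B[OF t, of 2] by simp
  show iF: "integrable Q (\<lambda>\<omega>. F (B t \<omega>) (?A \<omega>))"
    by (rule Bochner_Integration.integrable_bound[OF dom])
      (use F_le K in \<open>auto intro!: AE_I2 Fm2 simp: abs_mult\<close>)
  have "integrable Q (\<lambda>\<omega>. F (B t \<omega>) (?A \<omega>) * of_real (\<phi> (?D \<omega>))) \<and>
      expectation (\<lambda>\<omega>. F (B t \<omega>) (?A \<omega>) * of_real (\<phi> (?D \<omega>))) =
      expectation (\<lambda>\<omega>. F (B t \<omega>) (?A \<omega>)) * of_real (expectation (\<lambda>\<omega>. \<phi> (?D \<omega>)))"
  \<comment> \<open>At \<open>t = 0\<close> the grid points coincide and are not strictly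
    increasing; there the past functional is almost surely the constant
    \<open>F 0 0\<close>.\<close>
  proof (cases "t = 0")
    case True
    have c: "AE \<omega> in Q. F (B t \<omega>) (?A \<omega>) = F 0 0"
      using start AE_space by eventually_elim (simp add: True yor_accumulation_eq_integral)
    have c2: "AE \<omega> in Q. F (B t \<omega>) (?A \<omega>) * of_real (\<phi> (?D \<omega>)) = F 0 0 * of_real (\<phi> (?D \<omega>))"
      using c by eventually_elim simp
    have [measurable]: "(\<lambda>\<omega>. F (B t \<omega>) (?A \<omega>)) \<in> borel_measurable Q" by (intro Fm2) auto
    have i0: "integrable Q (\<lambda>\<omega>. F 0 0 * of_real (\<phi> (?D \<omega>)))"
      using \<phi> by (intro integrable_mult_right integrable_of_real)
    have "integrable Q (\<lambda>\<omega>. F (B t \<omega>) (?A \<omega>) * of_real (\<phi> (?D \<omega>)))"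
      by (rule integrable_cong_AE_imp[OF i0]) (use c2 in \<open>auto elim: eventually_mono\<close>)
    moreover have "expectation (\<lambda>\<omega>. F (B t \<omega>) (?A \<omega>)) = F 0 0"
      by (subst integral_cong_AE[OF _ _ c]) (auto simp: prob_space)
    moreover have "expectation (\<lambda>\<omega>. F (B t \<omega>) (?A \<omega>) * of_real (\<phi> (?D \<omega>))) = F 0 0 * of_real (expectation (\<lambda>\<omega>. \<phi> (?D \<omega>)))"
      by (subst integral_cong_AE[OF _ _ c2]) auto
    ultimately show ?thesis by simp
  next
    case False
    then have t0: "0 < t" using t by simp
    \<comment> \<open>\<open>Y n\<close> collects the increments over \<open>Suc n\<close> cells,
      \<open>R n\<close> is the Riemann sum of the accumulation written in terms of increments, and
      \<open>g n (Y n \<omega>)\<close> approximates the past functional. The partial sums of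
      \<open>Y n\<close> recover \<open>B\<close> only almost surely, because \<open>B 0 = 0\<close>
      holds only almost surely.\<close>
    define Y where "Y n \<omega> = (\<lambda>i\<in>{..<Suc n}. B (real (Suc i) * (t / real (Suc n))) \<omega> - B (real i * (t / real (Suc n))) \<omega>)" for n \<omega>
    define R where "R n v = (t / real (Suc n)) * (\<Sum>j<Suc n. exp (2 * ((\<Sum>i<j. v i) + \<nu> * (real j * (t / real (Suc n))))))"
      for n and v :: "nat \<Rightarrow> real"
    define g where "g n v = F (\<Sum>i<Suc n. v i) (R n v)" for n v
    have ind: "indep_var borel (\<lambda>\<omega>. G (Y n \<omega>)) borel (\<lambda>\<omega>. \<psi> (?D \<omega>))"
      if "G \<in> borel_measurable (PiM {..<Suc n} (\<lambda>_. borel))" "\<psi> \<in> borel_measurable borel"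
      for n and G :: "_ \<Rightarrow> 'c::topological_space" and \<psi>
      using indep_var_past_increment[OF t0 h _ that] unfolding Y_def by simp
    have comp: "(\<lambda>v. v i) \<in> borel_measurable (PiM {..<Suc n} (\<lambda>_. borel))" if "i < Suc n" for i n
      using that by (intro measurable_component_singleton) auto
    have gm: "g n \<in> borel_measurable (PiM {..<Suc n} (\<lambda>_. borel))" for n
      unfolding g_def R_def
      by (intro Fm2 borel_measurable_times borel_measurable_sum borel_measurable_const borel_measurable_add
            measurable_compose[OF _ borel_measurable_exp] comp) auto
    have tel: "AE \<omega> in Q. \<forall>n. \<forall>j\<le>Suc n. (\<Sum>i<j. Y n \<omega> i) = B (real j * (t / real (Suc n))) \<omega>"
      using start
    proof eventually_elim
      case (elim \<omega>)
      show ?case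
      proof (intro allI impI)
        fix n j assume j: "j \<le> Suc n"
        have "(\<Sum>i<j. Y n \<omega> i) = (\<Sum>i<j. B (real (Suc i) * (t / real (Suc n))) \<omega> - B (real i * (t / real (Suc n))) \<omega>)"
          using j by (intro sum.cong) (auto simp: Y_def)
        also have "\<dots> = B (real j * (t / real (Suc n))) \<omega> - B (real 0 * (t / real (Suc n))) \<omega>"
          by (rule sum_lessThan_telescope)
        finally show "(\<Sum>i<j. Y n \<omega> i) = B (real j * (t / real (Suc n))) \<omega>" using elim by simp
      qed
    qed
    have Yend: "AE \<omega> in Q. \<forall>n. (\<Sum>i<Suc n. Y n \<omega> i) = B t \<omega>"
      using tel
    proof eventually_elim
      case (elim \<omega>)
      have "real (Suc n) * (t / real (Suc n)) = t" for n by simp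
      then show ?case using elim by (metis order_refl)
    qed
    have lim: "AE \<omega> in Q. (\<lambda>n. g n (Y n \<omega>)) \<longlonglongrightarrow> F (B t \<omega>) (?A \<omega>)"
      using tel Yend AE_space
    proof eventually_elim
      case (elim \<omega>)
      have "R n (Y n \<omega>) = ((t - 0) / real (Suc n)) *\<^sub>R (\<Sum>j<Suc n. exp (2 * (B (0 + real j * ((t - 0) / real (Suc n))) \<omega>
          + \<nu> * (0 + real j * ((t - 0) / real (Suc n))))))" for n
        unfolding R_def using elim(1) by (simp del: sum.lessThan_Suc)
      then have "(\<lambda>n. R n (Y n \<omega>)) \<longlonglongrightarrow> ?A \<omega>"
        using riemann_sums_tendsto[OF t continuous_path_exp[OF elim(3), of "{0..t}" \<nu>]] yor_accumulation_eq_integral[OF elim(3), of \<nu> t]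
        by simp
      then have "(\<lambda>n. (B t \<omega>, R n (Y n \<omega>))) \<longlonglongrightarrow> (B t \<omega>, ?A \<omega>)"
        by (intro tendsto_Pair tendsto_const)
      from continuous_on_tendsto_compose[OF F this]
      show ?case unfolding g_def using elim(2) by (simp del: sum.lessThan_Suc)
    qed
    have bd: "AE \<omega> in Q. norm (g n (Y n \<omega>)) \<le> K * exp (2 * B t \<omega>)" for n
      using Yend
    proof eventually_elim
      case (elim \<omega>)
      then show ?case unfolding g_def using F_le by metis
    qed
    have gYm: "(\<lambda>\<omega>. g n (Y n \<omega>)) \<in> borel_measurable Q" for n
      using indep_var_rv1[OF ind[OF gm measurable_const[of 0]]] by simp
    have gint: "integrable Q (\<lambda>\<omega>. g n (Y n \<omega>))" for n
      by (rule Bochner_Integration.integrable_bound[OF dom gYm]) (use bd K in \<open>auto simp: abs_mult\<close>)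
    have \<phi>c: "integrable Q (\<lambda>\<omega>. of_real (\<phi> (?D \<omega>)) :: complex)" using \<phi> by (rule integrable_of_real)
    have ind2: "indep_var borel (\<lambda>\<omega>. g n (Y n \<omega>)) borel (\<lambda>\<omega>. of_real (\<phi> (?D \<omega>)) :: complex)" for n
      by (intro ind gm) measurable
    \<comment> \<open>With one cell, \<open>Y 0 \<omega> 0\<close> is the increment over all of
      \<open>[0, t]\<close>. Its independence from the later increment makes the dominating function
      of the product integrable.\<close>
    have "indep_var borel (\<lambda>\<omega>. exp (2 * Y 0 \<omega> 0)) borel (\<lambda>\<omega>. norm (\<phi> (?D \<omega>)))"
      using ind[of "\<lambda>v. exp (2 * v 0)" 0 "\<lambda>x. norm (\<phi> x)"] comp[of 0 0] by simp
    moreover have "AE \<omega> in Q. Y 0 \<omega> 0 = B t \<omega>" using Yend by eventually_elim (drule spec[of _ 0], simp)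
    moreover have "Y 0 \<omega> 0 = B t \<omega> - B 0 \<omega>" for \<omega> by (simp add: Y_def)
    ultimately have i1: "integrable Q (\<lambda>\<omega>. exp (2 * (B t \<omega> - B 0 \<omega>)) * norm (\<phi> (?D \<omega>)))"
      using integrable_exp_increment[OF order_refl t, of 2] \<phi> by (intro indep_var_integrable) auto
    have i2: "integrable Q (\<lambda>\<omega>. K * exp (2 * B t \<omega>) * norm (\<phi> (?D \<omega>)))"
    proof (rule integrable_cong_AE_imp[OF integrable_mult_right[OF i1, of K]])
      show "AE \<omega> in Q. K * (exp (2 * (B t \<omega> - B 0 \<omega>)) * norm (\<phi> (?D \<omega>))) = K * exp (2 * B t \<omega>) * norm (\<phi> (?D \<omega>))"
        using start by eventually_elim simp
    qed measurable
    have lim2: "AE \<omega> in Q. (\<lambda>n. g n (Y n \<omega>) * of_real (\<phi> (?D \<omega>))) \<longlonglongrightarrow> F (B t \<omega>) (?A \<omega>) * of_real (\<phi> (?D \<omega>))"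
      using lim by eventually_elim (intro tendsto_intros)
    have bd2: "AE \<omega> in Q. norm (g n (Y n \<omega>) * of_real (\<phi> (?D \<omega>))) \<le> K * exp (2 * B t \<omega>) * norm (\<phi> (?D \<omega>))" for n
      using bd[of n] by eventually_elim (auto simp: norm_mult intro!: mult_right_mono)
    have Fm3: "(\<lambda>\<omega>. F (B t \<omega>) (?A \<omega>)) \<in> borel_measurable Q" by (intro Fm2) auto
    have Dm: "(\<lambda>\<omega>. of_real (\<phi> (?D \<omega>)) :: complex) \<in> borel_measurable Q" by measurable
    note dc = integrable_dominated_convergence[OF borel_measurable_times[OF Fm3 Dm] borel_measurable_times[OF gYm Dm] i2 lim2 bd2]
      integral_dominated_convergence[OF borel_measurable_times[OF Fm3 Dm] borel_measurable_times[OF gYm Dm] i2 lim2 bd2]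
    have "expectation (\<lambda>\<omega>. g n (Y n \<omega>) * of_real (\<phi> (?D \<omega>))) = expectation (\<lambda>\<omega>. g n (Y n \<omega>)) * of_real (expectation (\<lambda>\<omega>. \<phi> (?D \<omega>)))" for n
      using indep_var_lebesgue_integral[OF ind2 gint \<phi>c] by simp
    moreover have "(\<lambda>n. expectation (\<lambda>\<omega>. g n (Y n \<omega>)) * of_real (expectation (\<lambda>\<omega>. \<phi> (?D \<omega>))))
      \<longlonglongrightarrow> expectation (\<lambda>\<omega>. F (B t \<omega>) (?A \<omega>)) * of_real (expectation (\<lambda>\<omega>. \<phi> (?D \<omega>)))"
      by (intro tendsto_intros integral_dominated_convergence[OF Fm3 gYm dom lim bd])
    ultimately show ?thesis using dc LIMSEQ_unique by auto
  qed
  then show "integrable Q (\<lambda>\<omega>. F (B t \<omega>) (?A \<omega>) * of_real (\<phi> (?D \<omega>)))"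
      "expectation (\<lambda>\<omega>. F (B t \<omega>) (?A \<omega>) * of_real (\<phi> (?D \<omega>))) =
      expectation (\<lambda>\<omega>. F (B t \<omega>) (?A \<omega>)) * of_real (expectation (\<lambda>\<omega>. \<phi> (?D \<omega>)))" by auto
qed

end

section \<open>The resolvent of the payoff\<close>

lemma abs_exp_minus_one_le: "\<bar>exp x - 1\<bar> \<le> \<bar>x\<bar> * exp \<bar>x\<bar>" for x :: real
proof (cases "x \<ge> 0")
  case True
  have "1 - x \<le> exp (- x)" using exp_ge_add_one_self[of "-x"] by simp
  then have "(1 - x) * exp x \<le> exp (- x) * exp x" by (intro mult_right_mono) auto
  then have "exp x - 1 \<le> x * exp x" by (simp add: exp_add[symmetric] algebra_simps)
  then show ?thesis using True by simp
next
  case False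
  have 1: "1 + x \<le> exp x" by (rule exp_ge_add_one_self)
  have 2: "- x * 1 \<le> - x * exp (- x)" using False by (intro mult_left_mono) auto
  have 3: "\<bar>x\<bar> = - x" "\<bar>exp x - 1\<bar> = 1 - exp x" using False by auto
  show ?thesis unfolding 3 using 1 2 by linarith
qed

text \<open>
  \<open>G1\<close> is the derivative of \<open>G\<close>, and \<open>2 U1 k\<close>, \<open>4 U2 k\<close> are the first two derivatives of
  \<open>n \<mapsto> exp (2 n) G (k exp (- 2 n))\<close> at \<open>n = 0\<close>; the first derivative of \<open>G\<close> may have a kink at \<open>0\<close>.
\<close>

locale yor_resolvent = standard_brownian_motion +
  fixes \<nu> :: real and z :: complex and C a :: real and G G1 U1 U2 :: "real \<Rightarrow> complex"
  assumes cont_G: "continuous_on UNIV G" and cont_G1: "continuous_on UNIV G1"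
    and cont_U1: "continuous_on UNIV U1" and cont_U2: "continuous_on UNIV U2"
    and G_le: "\<And>k. norm (G k) \<le> C * (1 + max 0 (- k))"
    and G_lipschitz: "\<And>k l. norm (G k - G l) \<le> C * \<bar>k - l\<bar>"
    and G1_le: "\<And>k. norm (G1 k) \<le> C" and U1_le: "\<And>k. norm (U1 k) \<le> C" and U2_le: "\<And>k. norm (U2 k) \<le> C"
    and generator: "\<And>k. of_real (2 * \<nu>) * U1 k + 2 * U2 k - G1 k = z * G k - of_real (max 0 (- k))"
    and taylor: "\<And>k n h. 0 < h \<Longrightarrow> h \<le> 1 \<Longrightarrow>
      norm (of_real (exp (2 * n)) * G ((k - h) * exp (- 2 * n)) - G k - of_real (2 * n) * U1 k - of_real (2 * n\<^sup>2) * U2 k + of_real h * G1 k)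
        \<le> C * h * sqrt h * exp (3 * \<bar>n\<bar> / sqrt h)"
    and a_pos: "a > 0"
begin

definition "S t \<omega> = exp (2 * (B t \<omega> + \<nu> * t))"
definition "K t \<omega> = (a - yor_accumulation B \<nu> t \<omega>) / S t \<omega>"
definition "m t = expectation (\<lambda>\<omega>. of_real (S t \<omega>) * G (K t \<omega>))"
definition "u t = expectation (\<lambda>\<omega>. max 0 (yor_accumulation B \<nu> t \<omega> - a))"
text \<open>The growth rate of the mean of \<open>S t\<close>, truncated at 0 so that
  \<open>exp (c * t)\<close> is nondecreasing. The two conditions \<open>Re z > 0\<close> and
  \<open>Re z > 2 * (\<nu> + 1)\<close> together say \<open>Re z > c\<close>.\<close>

definition "c = max 0 (2 * (\<nu> + 1))"

lemma S_pos [simp]: "0 < S t \<omega>" "0 \<le> S t \<omega>" "S t \<omega> \<noteq> 0"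
  by (simp_all add: S_def)

lemma C_nonneg: "0 \<le> C"
  using order_trans[OF norm_ge_zero G1_le] .

lemma measurable_S: "0 \<le> t \<Longrightarrow> S t \<in> borel_measurable Q"
  unfolding S_def using measurable_B by measurable

lemma measurable_K: "0 \<le> t \<Longrightarrow> K t \<in> borel_measurable Q"
  unfolding K_def using measurable_S measurable_yor_accumulation by measurable

lemma integrable_S: "0 \<le> t \<Longrightarrow> integrable Q (S t)"
  unfolding S_def by (rule integrable_exp_drifted_B)

lemma expectation_S_le:
  assumes "0 \<le> t" shows "expectation (S t) \<le> exp (c * t)"
proof -
  have "2 * (\<nu> + 1) * t \<le> c * t" using assms by (intro mult_right_mono) (auto simp: c_def)
  then show ?thesis unfolding S_def using assms by (subst expectation_exp_drifted_B) (auto simp: algebra_simps)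
qed

lemma accumulation_nonneg: "0 \<le> yor_accumulation B \<nu> t \<omega>"
  unfolding yor_accumulation_def set_lebesgue_integral_def
  by (intro integral_nonneg_AE) auto

lemma expectation_accumulation_le:
  assumes "0 \<le> t" shows "expectation (yor_accumulation B \<nu> t) \<le> t * exp (c * t)"
  using expectation_yor_accumulation_increment[OF order_refl assms, of \<nu>]
  by (subst Bochner_Integration.integral_cong[OF refl yor_accumulation_eq_integral]) (auto simp: c_def)

lemma max_pos_accumulation_le: "max 0 (yor_accumulation B \<nu> t \<omega> - a) \<le> yor_accumulation B \<nu> t \<omega>"
  using accumulation_nonneg a_pos by auto

lemma integrable_payoff:
  assumes "0 \<le> t" shows "integrable Q (\<lambda>\<omega>. max 0 (yor_accumulation B \<nu> t \<omega> - a))"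
  using integrable_yor_accumulation[OF assms, of \<nu>] by (intro integrable_max) auto

text \<open>This turns the source term \<open>max 0 (- k)\<close> of the equation for
  \<open>G\<close> into the payoff, and it absorbs the linear growth of \<open>G\<close> at negative
  arguments into the accumulation.\<close>

lemma S_times_negative_part_K: "S t \<omega> * max 0 (- K t \<omega>) = max 0 (yor_accumulation B \<nu> t \<omega> - a)"
proof -
  have "S t \<omega> * max 0 (- K t \<omega>) = max (S t \<omega> * 0) (S t \<omega> * (- K t \<omega>))"
    by (simp add: max_mult_distrib_left)
  also have "S t \<omega> * (- K t \<omega>) = yor_accumulation B \<nu> t \<omega> - a"
    by (simp add: K_def)
  finally show ?thesis by simp
qed

lemma norm_SG_le: "norm (of_real (S t \<omega>) * G (K t \<omega>)) \<le> C * (S t \<omega> + yor_accumulation B \<nu> t \<omega>)"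
proof -
  have "norm (of_real (S t \<omega>) * G (K t \<omega>)) \<le> S t \<omega> * (C * (1 + max 0 (- K t \<omega>)))"
    by (simp add: norm_mult mult_left_mono[OF G_le])
  also have "\<dots> = C * (S t \<omega> + S t \<omega> * max 0 (- K t \<omega>))" by (simp add: algebra_simps)
  also have "\<dots> \<le> C * (S t \<omega> + yor_accumulation B \<nu> t \<omega>)"
    unfolding S_times_negative_part_K by (intro mult_left_mono add_left_mono max_pos_accumulation_le C_nonneg)
  finally show ?thesis .
qed

lemma integrable_SG:
  assumes "0 \<le> t" shows "integrable Q (\<lambda>\<omega>. of_real (S t \<omega>) * G (K t \<omega>))"
proof (rule Bochner_Integration.integrable_bound)
  show "integrable Q (\<lambda>\<omega>. C * (S t \<omega> + yor_accumulation B \<nu> t \<omega>))"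
    using integrable_S[OF assms] integrable_yor_accumulation[OF assms, of \<nu>] by auto
  show "(\<lambda>\<omega>. of_real (S t \<omega>) * G (K t \<omega>)) \<in> borel_measurable Q"
    using measurable_S[OF assms] measurable_compose[OF measurable_K[OF assms] borel_measurable_continuous_onI[OF cont_G]]
    by measurable
  show "AE \<omega> in Q. norm (of_real (S t \<omega>) * G (K t \<omega>)) \<le> norm (C * (S t \<omega> + yor_accumulation B \<nu> t \<omega>))"
    using norm_SG_le[of t] by (auto intro: order_trans[OF _ abs_ge_self])
qed

lemma norm_m_le:
  assumes "0 \<le> t" shows "norm (m t) \<le> C * (1 + t) * exp (c * t)"
proof -
  have i: "integrable Q (\<lambda>\<omega>. C * (S t \<omega> + yor_accumulation B \<nu> t \<omega>))"
    using integrable_S[OF assms] integrable_yor_accumulation[OF assms, of \<nu>] by auto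
  have "norm (m t) \<le> expectation (\<lambda>\<omega>. C * (S t \<omega> + yor_accumulation B \<nu> t \<omega>))"
    unfolding m_def
    by (rule order_trans[OF integral_norm_bound]) (intro integral_mono integrable_norm integrable_SG assms i norm_SG_le)
  also have "\<dots> = C * (expectation (S t) + expectation (yor_accumulation B \<nu> t))"
    using integrable_S[OF assms] integrable_yor_accumulation[OF assms, of \<nu>] by simp
  also have "\<dots> \<le> C * (exp (c * t) + t * exp (c * t))"
    by (intro mult_left_mono add_mono expectation_S_le expectation_accumulation_le assms C_nonneg)
  finally show ?thesis by (simp add: algebra_simps)
qed

lemma u_bounds:
  assumes "0 \<le> t" shows "0 \<le> u t" "u t \<le> t * exp (c * t)"
proof -
  show "0 \<le> u t" unfolding u_def by (intro integral_nonneg_AE) auto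
  have "u t \<le> expectation (yor_accumulation B \<nu> t)"
    unfolding u_def by (intro integral_mono integrable_payoff integrable_yor_accumulation assms max_pos_accumulation_le)
  then show "u t \<le> t * exp (c * t)" using expectation_accumulation_le[OF assms] by simp
qed

lemma accumulation_diff:
  assumes "0 \<le> s" "s \<le> t" "\<omega> \<in> space Q"
  shows "yor_accumulation B \<nu> t \<omega> - yor_accumulation B \<nu> s \<omega> = integral {s..t} (\<lambda>w. S w \<omega>)"
proof -
  have "(\<lambda>w. S w \<omega>) integrable_on {0..t}"
    unfolding S_def using assms by (intro integrable_continuous_interval continuous_path_exp) auto
  from Henstock_Kurzweil_Integration.integral_combine[OF assms(1,2) this]
  show ?thesis by (simp add: yor_accumulation_eq_integral[OF assms(3)] S_def algebra_simps)
qed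

text \<open>The payoff is 1-Lipschitz in the accumulation, so the accumulated increment dominates.
  The continuity of \<open>u\<close> that follows makes Riemann sums of the discounted payoff
  converge.\<close>

lemma u_lipschitz:
  assumes "0 \<le> s" "s \<le> t" shows "\<bar>u t - u s\<bar> \<le> (t - s) * exp (c * t)"
proof -
  have t: "0 \<le> t" using assms by simp
  have "\<bar>u t - u s\<bar> = \<bar>expectation (\<lambda>\<omega>. max 0 (yor_accumulation B \<nu> t \<omega> - a) - max 0 (yor_accumulation B \<nu> s \<omega> - a))\<bar>"
    unfolding u_def by (subst Bochner_Integration.integral_diff) (use integrable_payoff assms in auto)
  also have "\<dots> \<le> expectation (\<lambda>\<omega>. integral {s..t} (\<lambda>w. exp (2 * (B w \<omega> + \<nu> * w))))"
  proof (rule order_trans[OF integral_abs_bound], rule integral_mono)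
    show "integrable Q (\<lambda>\<omega>. \<bar>max 0 (yor_accumulation B \<nu> t \<omega> - a) - max 0 (yor_accumulation B \<nu> s \<omega> - a)\<bar>)"
      using integrable_payoff assms by auto
    show "integrable Q (\<lambda>\<omega>. integral {s..t} (\<lambda>w. exp (2 * (B w \<omega> + \<nu> * w))))"
      by (rule integrable_yor_accumulation_increment[OF assms])
    fix \<omega> assume \<omega>: "\<omega> \<in> space Q"
    have "0 \<le> integral {s..t} (\<lambda>w. S w \<omega>)"
    proof (intro Henstock_Kurzweil_Integration.integral_nonneg)
      show "(\<lambda>w. S w \<omega>) integrable_on {s..t}"
        unfolding S_def using assms by (intro integrable_continuous_interval continuous_path_exp \<omega>) auto
    qed simp
    then show "\<bar>max 0 (yor_accumulation B \<nu> t \<omega> - a) - max 0 (yor_accumulation B \<nu> s \<omega> - a)\<bar> \<le> integral {s..t} (\<lambda>w. exp (2 * (B w \<omega> + \<nu> * w)))"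
      using accumulation_diff[OF assms \<omega>] unfolding S_def by linarith
  qed
  also have "\<dots> \<le> (t - s) * exp (c * t)"
    unfolding c_def by (rule expectation_yor_accumulation_increment[OF assms])
  finally show ?thesis .
qed

text \<open>The first term bounds the second moment of \<open>S t\<close>, namely
  \<open>exp ((8 + 4 \<nu>) t)\<close>. The second bounds the mean of
  \<open>exp (6 |n| / sqrt h)\<close>: the drift part of \<open>n\<close> costs
  \<open>exp (6 |\<nu>|)\<close>, the Brownian part \<open>2 exp (6^2 / 2)\<close>.\<close>

definition "moment_bound T = exp ((8 + 4 * \<bar>\<nu>\<bar>) * T) + exp (6 * \<bar>\<nu>\<bar>) * 2 * exp 18"

text \<open>Over a time of length at most \<open>h\<close> the log-increment has size
  \<open>sqrt h\<close>, so after division by \<open>sqrt h\<close> its exponential moments are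
  bounded independently of \<open>h\<close>.\<close>

lemma moment:
  assumes "0 \<le> t" "t \<le> w" "w \<le> t + h" "0 < h" "h \<le> 1" "t \<le> T"
  shows integrable_moment: "integrable Q (\<lambda>\<omega>. S t \<omega> * exp (3 * \<bar>B w \<omega> + \<nu> * w - (B t \<omega> + \<nu> * t)\<bar> / sqrt h))" (is "integrable Q ?f")
    and expectation_moment_le: "expectation (\<lambda>\<omega>. S t \<omega> * exp (3 * \<bar>B w \<omega> + \<nu> * w - (B t \<omega> + \<nu> * t)\<bar> / sqrt h)) \<le> moment_bound T"
proof -
  have w: "0 \<le> w" using assms by simp
  have sh: "0 < sqrt h" "sqrt h \<le> 1" using assms by auto
  let ?g = "\<lambda>\<omega>. exp (4 * (B t \<omega> + \<nu> * t)) + exp (6 * \<bar>\<nu>\<bar>) * exp ((6 / sqrt h) * \<bar>B w \<omega> - B t \<omega>\<bar>)"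
  have ig: "integrable Q ?g"
    by (intro Bochner_Integration.integrable_add integrable_mult_right integrable_exp_drifted_B
      integrable_exp_abs_increment assms)
  have le: "?f \<omega> \<le> ?g \<omega>" for \<omega>
  proof -
    let ?n = "B w \<omega> + \<nu> * w - (B t \<omega> + \<nu> * t)"
    have "\<bar>?n\<bar> \<le> \<bar>B w \<omega> - B t \<omega>\<bar> + \<bar>\<nu> * (w - t)\<bar>" by (simp add: algebra_simps)
    moreover have "\<bar>\<nu> * (w - t)\<bar> \<le> \<bar>\<nu>\<bar> * h" using assms by (auto simp: abs_mult intro!: mult_left_mono)
    ultimately have "6 * \<bar>?n\<bar> / sqrt h \<le> 6 * (\<bar>B w \<omega> - B t \<omega>\<bar> + \<bar>\<nu>\<bar> * h) / sqrt h"
      using sh by (intro divide_right_mono) auto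
    also have "\<dots> = (6 / sqrt h) * \<bar>B w \<omega> - B t \<omega>\<bar> + 6 * \<bar>\<nu>\<bar> * (h / sqrt h)"
      by (simp add: algebra_simps add_divide_distrib)
    also have "h / sqrt h = sqrt h" using assms by (simp add: real_div_sqrt)
    also have "6 * \<bar>\<nu>\<bar> * sqrt h \<le> 6 * \<bar>\<nu>\<bar> * 1" using sh by (intro mult_left_mono) auto
    finally have "6 * \<bar>?n\<bar> / sqrt h \<le> 6 * \<bar>\<nu>\<bar> + (6 / sqrt h) * \<bar>B w \<omega> - B t \<omega>\<bar>" by simp
    then have e: "exp (6 * \<bar>?n\<bar> / sqrt h) \<le> exp (6 * \<bar>\<nu>\<bar>) * exp ((6 / sqrt h) * \<bar>B w \<omega> - B t \<omega>\<bar>)"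
      by (simp add: exp_add[symmetric])
    \<comment> \<open>Splitting the product into squares lets each factor be integrated on its own;
      squaring doubles the exponent 3 to 6.\<close>
    have "x * y \<le> x\<^sup>2 + y\<^sup>2" for x y :: real
      using sum_squares_bound[of x y] sum_power2_ge_zero[of x y] by linarith
    from this[of "S t \<omega>" "exp (3 * \<bar>?n\<bar> / sqrt h)"]
    have "?f \<omega> \<le> (S t \<omega>)\<^sup>2 + (exp (3 * \<bar>?n\<bar> / sqrt h))\<^sup>2" .
    also have "(S t \<omega>)\<^sup>2 = exp (4 * (B t \<omega> + \<nu> * t))" by (simp add: S_def exp_double[symmetric])
    also have "(exp (3 * \<bar>?n\<bar> / sqrt h))\<^sup>2 = exp (6 * \<bar>?n\<bar> / sqrt h)" by (simp add: exp_double[symmetric])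
    finally show ?thesis using e by linarith
  qed
  have [measurable]: "S t \<in> borel_measurable Q" "B t \<in> borel_measurable Q" "B w \<in> borel_measurable Q"
    using assms w by (auto intro: measurable_S measurable_B)
  show i: "integrable Q ?f"
    by (rule Bochner_Integration.integrable_bound[OF ig])
      (use le in \<open>auto intro!: AE_I2 order_trans[OF _ abs_ge_self] simp: abs_mult\<close>)
  have "expectation ?f \<le> expectation ?g" by (intro integral_mono i ig le)
  also have "\<dots> = exp ((8 + 4 * \<nu>) * t) + exp (6 * \<bar>\<nu>\<bar>) * expectation (\<lambda>\<omega>. exp ((6 / sqrt h) * \<bar>B w \<omega> - B t \<omega>\<bar>))"
    using integrable_exp_drifted_B[OF assms(1), of 4 \<nu>] integrable_exp_abs_increment[OF assms(1,2), of "6 / sqrt h"]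
      expectation_exp_drifted_B[OF assms(1), of 4 \<nu>]
    by (subst Bochner_Integration.integral_add) auto
  also have "\<dots> \<le> exp ((8 + 4 * \<bar>\<nu>\<bar>) * T) + exp (6 * \<bar>\<nu>\<bar>) * (2 * exp 18)"
  proof (intro add_mono mult_left_mono)
    have "(8 + 4 * \<nu>) * t \<le> (8 + 4 * \<bar>\<nu>\<bar>) * t" using assms by (intro mult_right_mono) auto
    also have "\<dots> \<le> (8 + 4 * \<bar>\<nu>\<bar>) * T" using assms by (intro mult_left_mono) auto
    finally show "exp ((8 + 4 * \<nu>) * t) \<le> exp ((8 + 4 * \<bar>\<nu>\<bar>) * T)" by simp
    have "(6 / sqrt h)\<^sup>2 * (w - t) / 2 = 18 * ((w - t) / h)" using assms by (simp add: power_divide field_simps)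
    also have "\<dots> \<le> 18 * 1" using assms by (intro mult_left_mono) auto
    finally have "exp ((6 / sqrt h)\<^sup>2 * (w - t) / 2) \<le> exp 18" by simp
    then show "expectation (\<lambda>\<omega>. exp ((6 / sqrt h) * \<bar>B w \<omega> - B t \<omega>\<bar>)) \<le> 2 * exp 18"
      using expectation_exp_abs_increment[OF assms(1,2), of "6 / sqrt h"] by linarith
  qed simp
  finally show "expectation ?f \<le> moment_bound T" by (simp add: moment_bound_def)
qed

text \<open>Freezing the integrand at its left endpoint costs
  \<open>|S w - S t| = S t |exp (2 n) - 1|\<close>, which is of size \<open>sqrt h\<close>;
  integration over a time \<open>h\<close> gives the order \<open>h sqrt h\<close>.\<close>

lemma accumulation_step:
  assumes "0 \<le> t" "0 < h" "h \<le> 1" "t \<le> T"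
  shows integrable_accumulation_step:
      "integrable Q (\<lambda>\<omega>. \<bar>yor_accumulation B \<nu> (t + h) \<omega> - yor_accumulation B \<nu> t \<omega> - h * S t \<omega>\<bar>)" (is "integrable Q ?f")
    and expectation_accumulation_step_le:
      "expectation (\<lambda>\<omega>. \<bar>yor_accumulation B \<nu> (t + h) \<omega> - yor_accumulation B \<nu> t \<omega> - h * S t \<omega>\<bar>) \<le> 2 * h * sqrt h * moment_bound T"
proof -
  let ?X = "\<lambda>w \<omega>. \<bar>S w \<omega> - S t \<omega>\<bar>"
  have sh: "0 < sqrt h" "sqrt h \<le> 1" using assms by auto
  have iX: "integrable Q (?X w)" if "w \<in> {t..t + h}" for w
    using that assms by (intro integrable_abs Bochner_Integration.integrable_diff integrable_S) auto
  have eX: "expectation (?X w) \<le> 2 * sqrt h * moment_bound T" if w: "w \<in> {t..t + h}" for w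
  proof -
    let ?n = "\<lambda>\<omega>. B w \<omega> + \<nu> * w - (B t \<omega> + \<nu> * t)"
    have m: "integrable Q (\<lambda>\<omega>. S t \<omega> * exp (3 * \<bar>?n \<omega>\<bar> / sqrt h))"
      "expectation (\<lambda>\<omega>. S t \<omega> * exp (3 * \<bar>?n \<omega>\<bar> / sqrt h)) \<le> moment_bound T"
      using moment[of t w h T] w assms by auto
    have "expectation (?X w) \<le> expectation (\<lambda>\<omega>. 2 * sqrt h * (S t \<omega> * exp (3 * \<bar>?n \<omega>\<bar> / sqrt h)))"
    proof (intro integral_mono iX w integrable_mult_right m)
      fix \<omega>
      have n2: "\<bar>2 * ?n \<omega>\<bar> = 2 * \<bar>?n \<omega>\<bar>" by (simp only: abs_mult abs_numeral)
      have "S w \<omega> = S t \<omega> * exp (2 * ?n \<omega>)" by (simp add: S_def exp_add[symmetric])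
      then have "?X w \<omega> = S t \<omega> * \<bar>exp (2 * ?n \<omega>) - 1\<bar>"
        by (simp add: abs_mult[of "S t \<omega>", simplified, symmetric] algebra_simps)
      also have "\<dots> \<le> S t \<omega> * (\<bar>2 * ?n \<omega>\<bar> * exp \<bar>2 * ?n \<omega>\<bar>)"
        by (intro mult_left_mono abs_exp_minus_one_le) auto
      \<comment> \<open>One factor \<open>exp (|n| / sqrt h)\<close> pays for
        \<open>|n| \<le> sqrt h exp (|n| / sqrt h)\<close>, two more for \<open>exp (2 |n|)\<close>
        because \<open>sqrt h \<le> 1\<close>. This accounts for the 3 in the exponent of
        \<open>moment\<close>.\<close>
      also have "\<bar>2 * ?n \<omega>\<bar> * exp \<bar>2 * ?n \<omega>\<bar> \<le> (2 * sqrt h * exp (\<bar>?n \<omega>\<bar> / sqrt h)) * exp (2 * \<bar>?n \<omega>\<bar> / sqrt h)"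
      proof (intro mult_mono)
        have "\<bar>?n \<omega>\<bar> / sqrt h \<le> exp (\<bar>?n \<omega>\<bar> / sqrt h)"
          using exp_ge_add_one_self[of "\<bar>?n \<omega>\<bar> / sqrt h"] by linarith
        then have "\<bar>?n \<omega>\<bar> \<le> exp (\<bar>?n \<omega>\<bar> / sqrt h) * sqrt h"
          using sh unfolding pos_divide_le_eq[OF sh(1)] by simp
        then show "\<bar>2 * ?n \<omega>\<bar> \<le> 2 * sqrt h * exp (\<bar>?n \<omega>\<bar> / sqrt h)"
          unfolding n2 by (simp add: mult.assoc mult.commute[of "sqrt h"])
        have "\<bar>?n \<omega>\<bar> * sqrt h \<le> \<bar>?n \<omega>\<bar> * 1" using sh by (intro mult_left_mono) auto
        then have "2 * \<bar>?n \<omega>\<bar> \<le> 2 * \<bar>?n \<omega>\<bar> / sqrt h"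
          unfolding pos_le_divide_eq[OF sh(1)] by linarith
        then show "exp \<bar>2 * ?n \<omega>\<bar> \<le> exp (2 * \<bar>?n \<omega>\<bar> / sqrt h)"
          unfolding n2 exp_le_cancel_iff .
      qed (use sh in auto)
      also have "\<dots> = 2 * sqrt h * exp (3 * \<bar>?n \<omega>\<bar> / sqrt h)"
        by (simp add: mult.assoc exp_add[symmetric] add_divide_distrib[symmetric])
      finally show "?X w \<omega> \<le> 2 * sqrt h * (S t \<omega> * exp (3 * \<bar>?n \<omega>\<bar> / sqrt h))"
        by (simp add: algebra_simps)
    qed
    also have "\<dots> \<le> 2 * sqrt h * moment_bound T"
      using m sh by (simp add: mult_left_mono)
    finally show ?thesis .
  qed
  have cX: "continuous_on {t..t + h} (\<lambda>w. ?X w \<omega>)" if "\<omega> \<in> space Q" for \<omega>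
    unfolding S_def using assms that by (intro continuous_intros continuous_path_exp) auto
  have mX: "?X w \<in> borel_measurable Q" if "w \<in> {t..t + h}" for w
    using iX[OF that] by (rule borel_measurable_integrable)
  have th: "t \<le> t + h" using assms by simp
  have iP: "integrable Q (\<lambda>\<omega>. integral {t..t + h} (\<lambda>w. ?X w \<omega>))"
    by (rule path_integral_integrable[OF th mX _ iX eX cX]) auto
  have eP: "expectation (\<lambda>\<omega>. integral {t..t + h} (\<lambda>w. ?X w \<omega>)) \<le> (t + h - t) * (2 * sqrt h * moment_bound T)"
    by (rule path_integral_expectation_le[OF th mX _ iX eX cX]) auto
  have le: "?f \<omega> \<le> integral {t..t + h} (\<lambda>w. ?X w \<omega>)" if \<omega>: "\<omega> \<in> space Q" for \<omega>
  proof -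
    have cS: "continuous_on {t..t + h} (\<lambda>w. S w \<omega>)"
      unfolding S_def using assms \<omega> by (intro continuous_path_exp) auto
    have "yor_accumulation B \<nu> (t + h) \<omega> - yor_accumulation B \<nu> t \<omega> - h * S t \<omega> = integral {t..t + h} (\<lambda>w. S w \<omega> - S t \<omega>)"
      using assms accumulation_diff[OF _ th \<omega>] integrable_continuous_interval[OF cS]
      by (subst Henstock_Kurzweil_Integration.integral_diff) auto
    also have "norm \<dots> \<le> integral {t..t + h} (\<lambda>w. ?X w \<omega>)"
    proof (rule Henstock_Kurzweil_Integration.integral_norm_bound_integral)
      show "(\<lambda>w. S w \<omega> - S t \<omega>) integrable_on {t..t + h}"
        using cS by (intro integrable_continuous_interval continuous_intros)
      show "(\<lambda>w. ?X w \<omega>) integrable_on {t..t + h}"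
        using cX[OF \<omega>] by (rule integrable_continuous_interval)
    qed simp
    finally show ?thesis by simp
  qed
  show i: "integrable Q ?f"
    using assms by (intro integrable_abs Bochner_Integration.integrable_diff integrable_mult_right integrable_S integrable_yor_accumulation) auto
  have "expectation ?f \<le> expectation (\<lambda>\<omega>. integral {t..t + h} (\<lambda>w. ?X w \<omega>))"
    by (intro integral_mono i iP le)
  then show "expectation ?f \<le> 2 * h * sqrt h * moment_bound T" using eP by (simp add: mult.commute mult.left_commute)
qed

end

text \<open>About \<open>T / h\<close> steps with error \<open>L h sqrt h\<close> accumulate to
  \<open>L T sqrt h\<close>, which vanishes as the grid is refined, while the sum of the main terms
  is a Riemann sum of \<open>g\<close>.\<close>

lemma increments_imp_integral:
  fixes V g :: "real \<Rightarrow> complex"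
  assumes T: "0 < T" and g: "continuous_on {0..T} g"
    and step: "\<And>t h. 0 \<le> t \<Longrightarrow> 0 < h \<Longrightarrow> h \<le> 1 \<Longrightarrow> t + h \<le> T \<Longrightarrow> norm (V (t + h) - V t - h *\<^sub>R g t) \<le> L * h * sqrt h"
  shows "V T - V 0 = integral {0..T} g"
proof -
  define h where "h n = T / real (Suc n)" for n
  define R where "R n = h n *\<^sub>R (\<Sum>i<Suc n. g (real i * h n))" for n
  have hn: "0 < h n" "real (Suc n) * h n = T" for n using T by (auto simp: h_def)
  have h_lim: "h \<longlonglongrightarrow> 0"
    unfolding h_def using LIMSEQ_inverse_real_of_nat tendsto_mult_right_zero by (auto simp: divide_inverse)
  have R_lim: "R \<longlonglongrightarrow> integral {0..T} g"
    using riemann_sums_tendsto[of 0 T g] T g unfolding R_def[abs_def] h_def by simp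
  have bd: "norm (V T - V 0 - R n) \<le> L * T * sqrt (h n)" if "h n \<le> 1" for n
  proof -
    have "V T - V 0 = (\<Sum>i<Suc n. V (real (Suc i) * h n) - V (real i * h n))"
      by (subst sum_lessThan_telescope) (simp only: hn, simp)
    then have "V T - V 0 - R n = (\<Sum>i<Suc n. V (real i * h n + h n) - V (real i * h n) - h n *\<^sub>R g (real i * h n))"
      unfolding R_def scaleR_sum_right by (simp only: sum_subtractf[symmetric] of_nat_Suc ring_distribs mult_1_left add.commute)
    also have "norm \<dots> \<le> (\<Sum>i<Suc n. L * h n * sqrt (h n))"
    proof (intro sum_norm_le step)
      fix i assume "i \<in> {..<Suc n}"
      then have "real (Suc i) * h n \<le> real (Suc n) * h n" using hn(1)[of n] by (intro mult_right_mono) auto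
      also have "\<dots> = T" by (rule hn)
      finally show "real i * h n + h n \<le> T" by (simp add: algebra_simps)
    qed (use hn(1)[of n] that in auto)
    also have "\<dots> = L * (real (Suc n) * h n) * sqrt (h n)" by simp
    finally show ?thesis unfolding hn .
  qed
  have "eventually (\<lambda>n. h n < 1) sequentially" using h_lim by (rule order_tendstoD) simp
  then have ev: "eventually (\<lambda>n. norm (V T - V 0 - R n) \<le> L * T * sqrt (h n)) sequentially"
    by eventually_elim (rule bd, simp)
  have "(\<lambda>n. L * T * sqrt (h n)) \<longlonglongrightarrow> L * T * sqrt 0" by (intro tendsto_intros h_lim)
  moreover have "(\<lambda>n. norm (V T - V 0 - R n)) \<longlonglongrightarrow> norm (V T - V 0 - integral {0..T} g)"
    by (intro tendsto_intros R_lim)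
  ultimately have "norm (V T - V 0 - integral {0..T} g) \<le> L * T * sqrt 0"
    using ev by (intro tendsto_le[OF _ _ _ ev]) auto
  then show ?thesis by simp
qed

lemma integrable_polynomial_exp_decay:
  assumes "0 < (e::real)"
  shows "set_integrable lborel {0..} (\<lambda>x. x * exp (- e * x))"
proof -
  have "(\<lambda>x. exp (- (e / 2) * x)) absolutely_integrable_on {0..}"
    using integrable_on_exp_minus_to_infinity[of "e / 2" 0] assms
    by (subst absolutely_integrable_on_iff_nonneg) auto
  then have i: "set_integrable lborel {0..} (\<lambda>x. exp (- (e / 2) * x))"
    unfolding set_integrable_def by (subst (asm) integrable_completion) auto
  have "set_integrable lborel {0..} (\<lambda>x. (2 / e) * exp (- (e / 2) * x))"
    using i by (intro set_integrable_mult_right) auto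
  then show ?thesis
    unfolding set_integrable_def
  proof (rule Bochner_Integration.integrable_bound)
    show "AE x in lborel. norm (indicat_real {0..} x *\<^sub>R (x * exp (- e * x))) \<le> norm (indicat_real {0..} x *\<^sub>R (2 / e * exp (- (e / 2) * x)))"
    proof (intro AE_I2)
      fix x :: real
      have "(e / 2) * x \<le> exp ((e / 2) * x)" using exp_ge_add_one_self[of "(e/2) * x"] by linarith
      then have "x \<le> (2 / e) * exp ((e / 2) * x)" using assms by (simp add: field_simps)
      then have "x * exp (- e * x) \<le> (2 / e) * exp ((e / 2) * x) * exp (- e * x)" by (intro mult_right_mono) auto
      also have "\<dots> = (2 / e) * exp (- (e / 2) * x)" by (simp add: exp_add[symmetric] field_simps)
      finally show "norm (indicat_real {0..} x *\<^sub>R (x * exp (- e * x))) \<le> norm (indicat_real {0..} x *\<^sub>R (2 / e * exp (- (e / 2) * x)))"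
        using assms by (auto simp: indicator_def abs_mult)
    qed
  qed simp
qed

section \<open>The one-step expansion of the expectation and its discounted sum\<close>

context yor_resolvent
begin

text \<open>Applied with \<open>\<phi>\<close> constant, the identity and the square, this yields
  the expectations of the Taylor terms of orders 0, 1 and 2 in the Brownian increment.\<close>

lemma past_functional:
  fixes U :: "real \<Rightarrow> complex" and \<phi> :: "real \<Rightarrow> real"
  assumes t: "0 \<le> t" "0 < h" and U: "continuous_on UNIV U" "\<And>k. norm (U k) \<le> C"
    and \<phi>: "\<phi> \<in> borel_measurable borel" "integrable Q (\<lambda>\<omega>. \<phi> (B (t + h) \<omega> - B t \<omega>))"
  shows "integrable Q (\<lambda>\<omega>. S t \<omega> * U (K t \<omega>))"
    and "has_bochner_integral Q (\<lambda>\<omega>. S t \<omega> * U (K t \<omega>) * of_real (\<phi> (B (t + h) \<omega> - B t \<omega>)))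
      (expectation (\<lambda>\<omega>. S t \<omega> * U (K t \<omega>)) * of_real (expectation (\<lambda>\<omega>. \<phi> (B (t + h) \<omega> - B t \<omega>))))"
proof -
  define F where "F x y = of_real (exp (2 * (x + \<nu> * t))) * U ((a - y) / exp (2 * (x + \<nu> * t)))" for x y
  have c: "continuous_on UNIV (\<lambda>p. F (fst p) (snd p))"
    unfolding F_def by (intro continuous_intros continuous_on_compose2[OF U(1)]) auto
  have le: "norm (F x y) \<le> (C * exp (2 * \<nu> * t)) * exp (2 * x)" for x y
  proof -
    have "norm (F x y) \<le> exp (2 * (x + \<nu> * t)) * C"
      unfolding F_def by (simp add: norm_mult U(2))
    also have "\<dots> = (C * exp (2 * \<nu> * t)) * exp (2 * x)"
      by (simp add: exp_add[symmetric] algebra_simps)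
    finally show ?thesis .
  qed
  have eq: "F (B t \<omega>) (yor_accumulation B \<nu> t \<omega>) = S t \<omega> * U (K t \<omega>)" for \<omega>
    by (simp add: F_def S_def K_def)
  note past = past_functional_times_increment[OF t c le \<phi>, of \<nu>, unfolded eq]
  show "integrable Q (\<lambda>\<omega>. S t \<omega> * U (K t \<omega>))" by (rule past)
  show "has_bochner_integral Q (\<lambda>\<omega>. S t \<omega> * U (K t \<omega>) * of_real (\<phi> (B (t + h) \<omega> - B t \<omega>)))
      (expectation (\<lambda>\<omega>. S t \<omega> * U (K t \<omega>)) * of_real (expectation (\<lambda>\<omega>. \<phi> (B (t + h) \<omega> - B t \<omega>))))"
    using past(2,3) by (simp add: has_bochner_integral_iff)
qed

text \<open>With \<open>n = D + \<nu> h\<close>, where the increment \<open>D\<close> is independent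
  of the past with mean 0 and variance \<open>h\<close>, the Taylor terms average to
  \<open>h (2 \<nu> U1 + 2 U2 - G1)\<close>, which \<open>generator\<close> identifies, plus a term
  in \<open>(\<nu> h)^2\<close>. That term gives \<open>2 \<nu>^2\<close> in the bound; the 3 is 2
  from \<open>accumulation_step\<close> plus 1 from \<open>taylor\<close>.\<close>

lemma one_step:
  assumes t: "0 \<le> t" "0 < h" "h \<le> 1" "t + h \<le> T"
  shows "norm (m (t + h) - m t - h * (z * m t - u t)) \<le> C * (2 * \<nu>\<^sup>2 * exp (c * T) + 3 * moment_bound T) * h * sqrt h"
proof -
  let ?D = "\<lambda>\<omega>. B (t + h) \<omega> - B t \<omega>"
  define n where "n \<omega> = ?D \<omega> + \<nu> * h" for \<omega>
  define X where "X U \<omega> = S t \<omega> * U (K t \<omega>)" for U :: "real \<Rightarrow> complex" and \<omega>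
  have sh: "0 < sqrt h" "sqrt h \<le> 1" "sqrt h * sqrt h = h" using t by auto
  have th: "t < t + h" "0 \<le> t + h" "t \<le> T" using t by auto
  note mom = increment_moments[OF t(1) th(1)]
  have i1: "integrable Q (\<lambda>\<omega>. (1::real))" by simp
  note p0 = past_functional[OF t(1,2) _ _ measurable_const[of 1] i1, folded X_def]
  have m1: "(\<lambda>x::real. x) \<in> borel_measurable borel" by simp
  note p1 = past_functional[OF t(1,2) _ _ m1 mom(1), unfolded mom(2), folded X_def]
  have m2: "(\<lambda>x::real. x\<^sup>2) \<in> borel_measurable borel" by measurable
  note p2 = past_functional[OF t(1,2) _ _ m2 mom(3), unfolded mom(4), folded X_def]
  let ?E = "\<lambda>U. expectation (X U)"
  have hX: "has_bochner_integral Q (X U1) (?E U1)" "has_bochner_integral Q (X U2) (?E U2)" "has_bochner_integral Q (X G1) (?E G1)"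
    using p0(1)[OF cont_U1 U1_le] p0(1)[OF cont_U2 U2_le] p0(1)[OF cont_G1 G1_le] by (auto intro: has_bochner_integral_integrable)
  have h1: "has_bochner_integral Q (\<lambda>\<omega>. X U1 \<omega> * of_real (?D \<omega>)) 0" "has_bochner_integral Q (\<lambda>\<omega>. X U2 \<omega> * of_real (?D \<omega>)) 0"
    using p1(2)[OF cont_U1 U1_le] p1(2)[OF cont_U2 U2_le] by simp_all
  have h2: "has_bochner_integral Q (\<lambda>\<omega>. X U2 \<omega> * of_real ((?D \<omega>)\<^sup>2)) (?E U2 * h)"
    using p2(2)[OF cont_U2 U2_le] by simp
  have hG: "has_bochner_integral Q (X G) (m t)"
    using integrable_SG[OF t(1)] unfolding X_def m_def by (rule has_bochner_integral_integrable)
  have hG': "has_bochner_integral Q (\<lambda>\<omega>. S (t + h) \<omega> * G (K (t + h) \<omega>)) (m (t + h))"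
    using integrable_SG[OF th(2)] unfolding m_def by (rule has_bochner_integral_integrable)
  \<comment> \<open>The increment minus its Taylor polynomial, with \<open>n = D + \<nu> h\<close>
    and its square multiplied out so that each summand is a past functional times a power of
    \<open>D\<close>.\<close>
  define Err where "Err \<omega> = S (t + h) \<omega> * G (K (t + h) \<omega>) - X G \<omega> -
     (2 * (X U1 \<omega> * of_real (?D \<omega>) + of_real (\<nu> * h) * X U1 \<omega>)
      + 2 * (X U2 \<omega> * of_real ((?D \<omega>)\<^sup>2) + of_real (2 * \<nu> * h) * (X U2 \<omega> * of_real (?D \<omega>)) + of_real ((\<nu> * h)\<^sup>2) * X U2 \<omega>)
      - of_real h * X G1 \<omega>)" for \<omega>
  have "has_bochner_integral Q Err (m (t + h) - m t - (2 * (0 + of_real (\<nu> * h) * ?E U1)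
      + 2 * (?E U2 * h + of_real (2 * \<nu> * h) * 0 + of_real ((\<nu> * h)\<^sup>2) * ?E U2) - of_real h * ?E G1))"
    unfolding Err_def
    by (intro has_bochner_integral_add has_bochner_integral_diff has_bochner_integral_mult_right hX h1 h2 hG hG')
  then have hErr: "integrable Q Err" "expectation Err = m (t + h) - m t - (2 * (0 + of_real (\<nu> * h) * ?E U1)
      + 2 * (?E U2 * h + of_real (2 * \<nu> * h) * 0 + of_real ((\<nu> * h)\<^sup>2) * ?E U2) - of_real h * ?E G1)"
    by (auto simp: has_bochner_integral_iff)
  have gen: "of_real (2 * \<nu>) * ?E U1 + 2 * ?E U2 - ?E G1 = z * m t - u t"
  proof -
    have "has_bochner_integral Q (\<lambda>\<omega>. of_real (2 * \<nu>) * X U1 \<omega> + 2 * X U2 \<omega> - X G1 \<omega>) (of_real (2 * \<nu>) * ?E U1 + 2 * ?E U2 - ?E G1)"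
      by (intro has_bochner_integral_add has_bochner_integral_diff has_bochner_integral_mult_right hX)
    moreover have "of_real (2 * \<nu>) * X U1 \<omega> + 2 * X U2 \<omega> - X G1 \<omega> = z * X G \<omega> - of_real (max 0 (yor_accumulation B \<nu> t \<omega> - a))" for \<omega>
    proof -
      have "of_real (2 * \<nu>) * X U1 \<omega> + 2 * X U2 \<omega> - X G1 \<omega> = S t \<omega> * (of_real (2 * \<nu>) * U1 (K t \<omega>) + 2 * U2 (K t \<omega>) - G1 (K t \<omega>))"
        by (simp add: X_def algebra_simps)
      also have "\<dots> = z * X G \<omega> - of_real (S t \<omega> * max 0 (- K t \<omega>))"
        unfolding generator by (simp add: X_def algebra_simps)
      finally show ?thesis unfolding S_times_negative_part_K .
    qed
    moreover have "has_bochner_integral Q (\<lambda>\<omega>. z * X G \<omega> - of_real (max 0 (yor_accumulation B \<nu> t \<omega> - a))) (z * m t - of_real (u t))"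
      unfolding u_def
      by (intro has_bochner_integral_diff has_bochner_integral_mult_right hG has_bochner_integral_of_real
           has_bochner_integral_integrable integrable_payoff t)
    ultimately show ?thesis using has_bochner_integral_eq by auto
  qed
  let ?dA = "\<lambda>\<omega>. \<bar>yor_accumulation B \<nu> (t + h) \<omega> - yor_accumulation B \<nu> t \<omega> - h * S t \<omega>\<bar>"
  let ?M = "\<lambda>\<omega>. S t \<omega> * exp (3 * \<bar>B (t + h) \<omega> + \<nu> * (t + h) - (B t \<omega> + \<nu> * t)\<bar> / sqrt h)"
  have Err_le: "norm (Err \<omega>) \<le> C * ?dA \<omega> + C * h * sqrt h * ?M \<omega>" for \<omega>
  proof -
    define k where "k = K t \<omega>"
    have S': "S (t + h) \<omega> = S t \<omega> * exp (2 * n \<omega>)"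
      by (simp add: S_def n_def exp_add[symmetric] algebra_simps)
    \<comment> \<open>The value \<open>K (t + h)\<close> would take if the accumulation grew by
      exactly \<open>h * S t\<close>. Going from the true value to \<open>?l\<close> uses the
      Lipschitz bound, going from \<open>?l\<close> back to \<open>k\<close> the Taylor
      estimate.\<close>
    let ?l = "(k - h) * exp (- 2 * n \<omega>)"
    have Sk: "S t \<omega> * k = a - yor_accumulation B \<nu> t \<omega>" by (simp add: k_def K_def)
    have Sl: "S (t + h) \<omega> * ?l = a - yor_accumulation B \<nu> t \<omega> - h * S t \<omega>"
    proof -
      have "S (t + h) \<omega> * ?l = S t \<omega> * (k - h) * (exp (2 * n \<omega>) * exp (- 2 * n \<omega>))" by (simp add: S')
      also have "exp (2 * n \<omega>) * exp (- 2 * n \<omega>) = 1" by (simp add: exp_minus)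
      also have "S t \<omega> * (k - h) * 1 = a - yor_accumulation B \<nu> t \<omega> - h * S t \<omega>"
        using Sk by (simp add: right_diff_distrib)
      finally show ?thesis .
    qed
    have "norm (of_real (S (t + h) \<omega>) * (G (K (t + h) \<omega>) - G ?l)) \<le> S (t + h) \<omega> * (C * \<bar>K (t + h) \<omega> - ?l\<bar>)"
      by (simp add: norm_mult mult_left_mono[OF G_lipschitz])
    also have "\<dots> = C * \<bar>S (t + h) \<omega> * K (t + h) \<omega> - S (t + h) \<omega> * ?l\<bar>"
      by (simp add: abs_mult right_diff_distrib[symmetric])
    also have "S (t + h) \<omega> * K (t + h) \<omega> = a - yor_accumulation B \<nu> (t + h) \<omega>" by (simp add: K_def)
    also have "\<bar>a - yor_accumulation B \<nu> (t + h) \<omega> - S (t + h) \<omega> * ?l\<bar> = ?dA \<omega>"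
      unfolding Sl by linarith
    finally have e1: "norm (of_real (S (t + h) \<omega>) * (G (K (t + h) \<omega>) - G ?l)) \<le> C * ?dA \<omega>" .
    let ?tay = "of_real (exp (2 * n \<omega>)) * G ?l - G k - of_real (2 * n \<omega>) * U1 k - of_real (2 * (n \<omega>)\<^sup>2) * U2 k + of_real h * G1 k"
    have "norm (of_real (S t \<omega>) * ?tay) \<le> S t \<omega> * (C * h * sqrt h * exp (3 * \<bar>n \<omega>\<bar> / sqrt h))"
      unfolding norm_mult[of "of_real (S t \<omega>)"] norm_of_real abs_of_nonneg[OF S_pos(2)]
      by (intro mult_left_mono taylor[OF t(2,3)] S_pos(2))
    also have "\<dots> = C * h * sqrt h * ?M \<omega>"
      by (simp add: n_def algebra_simps)
    finally have e2: "norm (of_real (S t \<omega>) * ?tay) \<le> C * h * sqrt h * ?M \<omega>" .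
    have "Err \<omega> = of_real (S (t + h) \<omega>) * (G (K (t + h) \<omega>) - G ?l) + of_real (S t \<omega>) * ?tay"
      unfolding Err_def X_def k_def[symmetric] S' by (simp add: n_def power2_eq_square algebra_simps)
    then show ?thesis using e1 e2 norm_triangle_mono by metis
  qed
  have dA: "integrable Q ?dA" "expectation ?dA \<le> 2 * h * sqrt h * moment_bound T"
    using accumulation_step[OF t(1-3) th(3)] by auto
  have M: "integrable Q ?M" "expectation ?M \<le> moment_bound T"
    using moment[OF t(1) _ _ t(2,3) th(3), of "t + h"] th by auto
  have "norm (expectation Err) \<le> expectation (\<lambda>\<omega>. C * ?dA \<omega> + C * h * sqrt h * ?M \<omega>)"
    by (rule order_trans[OF integral_norm_bound])
      (intro integral_mono integrable_norm hErr Bochner_Integration.integrable_add integrable_mult_right dA M Err_le)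
  also have "\<dots> = C * expectation ?dA + C * h * sqrt h * expectation ?M"
    using dA(1) M(1) by simp
  also have "\<dots> \<le> C * (2 * h * sqrt h * moment_bound T) + C * h * sqrt h * moment_bound T"
    using C_nonneg t by (intro add_mono mult_left_mono dA M mult_nonneg_nonneg) auto
  also have "\<dots> = C * (3 * moment_bound T) * h * sqrt h" by (simp add: algebra_simps)
  finally have b1: "norm (expectation Err) \<le> C * (3 * moment_bound T) * h * sqrt h" .
  have "norm (?E U2) \<le> expectation (\<lambda>\<omega>. C * S t \<omega>)"
  proof (rule order_trans[OF integral_norm_bound], intro integral_mono integrable_norm integrable_mult_right integrable_S t)
    show "integrable Q (X U2)" using hX by (simp add: has_bochner_integral_iff)
    show "norm (X U2 \<omega>) \<le> C * S t \<omega>" for \<omega>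
      using mult_left_mono[OF U2_le[of "K t \<omega>"] S_pos(2)[of t \<omega>]] by (simp add: X_def norm_mult mult.commute)
  qed
  also have "\<dots> = C * expectation (S t)" by simp
  also have "\<dots> \<le> C * exp (c * T)"
    using C_nonneg th by (intro mult_left_mono order_trans[OF expectation_S_le[OF t(1)]]) (auto simp: c_def intro!: mult_left_mono)
  finally have b2: "norm (?E U2) \<le> C * exp (c * T)" .
  have hh: "h * h \<le> h * sqrt h" using sh t mult_right_mono[of "sqrt h" 1 "sqrt h"] by (intro mult_left_mono) auto
  have "norm (2 * of_real ((\<nu> * h)\<^sup>2) * ?E U2) = 2 * \<nu>\<^sup>2 * (h * h) * norm (?E U2)"
  proof -
    have "norm (2 * of_real ((\<nu> * h)\<^sup>2) * ?E U2) = 2 * \<bar>(\<nu> * h)\<^sup>2\<bar> * norm (?E U2)"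
      by (simp only: norm_mult norm_of_real norm_numeral)
    also have "\<bar>(\<nu> * h)\<^sup>2\<bar> = \<nu>\<^sup>2 * (h * h)" by (simp add: power_mult_distrib power2_eq_square)
    finally show ?thesis by simp
  qed
  also have "\<dots> \<le> 2 * \<nu>\<^sup>2 * (h * sqrt h) * (C * exp (c * T))"
    using hh b2 t by (intro mult_mono mult_left_mono) auto
  finally have b3: "norm (2 * of_real ((\<nu> * h)\<^sup>2) * ?E U2) \<le> C * (2 * \<nu>\<^sup>2 * exp (c * T)) * h * sqrt h"
    by (simp add: algebra_simps)
  have "m (t + h) - m t - h * (z * m t - u t) = expectation Err + 2 * of_real ((\<nu> * h)\<^sup>2) * ?E U2"
    unfolding hErr(2) gen[symmetric] by (simp add: algebra_simps)
  then have "norm (m (t + h) - m t - h * (z * m t - u t)) \<le> C * (3 * moment_bound T) * h * sqrt h + C * (2 * \<nu>\<^sup>2 * exp (c * T)) * h * sqrt h"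
    using norm_triangle_mono[OF b1 b3] by simp
  then show ?thesis by (simp add: algebra_simps)
qed

end

lemma norm_exp_minus_affine_le: "norm (exp w - 1 - w) \<le> (norm w)\<^sup>2 * exp (norm w)" for w :: complex
proof -
  have "norm (exp w - (\<Sum>k\<le>1. w ^ k / fact k)) \<le> exp (norm w) * (norm w ^ Suc 1) / fact 1"
    by (rule Taylor_exp_field)
  then show ?thesis by (simp add: mult.commute algebra_simps power2_eq_square)
qed

context yor_resolvent
begin

text \<open>A discrete product rule: the discount factor removes the term \<open>z * m t\<close> of
  \<open>one_step\<close>, and only the payoff survives to first order.\<close>

lemma discounted_step:
  assumes z: "Re z > 0"
  shows "\<exists>L. \<forall>t h. 0 \<le> t \<longrightarrow> 0 < h \<longrightarrow> h \<le> 1 \<longrightarrow> t + h \<le> T \<longrightarrow>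
     norm (exp (- z * of_real (t + h)) * m (t + h) - exp (- z * of_real t) * m t - h *\<^sub>R (- exp (- z * of_real t) * of_real (u t))) \<le> L * h * sqrt h"
proof -
  define L where "L = C * (2 * \<nu>\<^sup>2 * exp (c * T) + 3 * moment_bound T)"
  define Mm where "Mm = C * (1 + T) * exp (c * T)"
  define Mu where "Mu = T * exp (c * T)"
  define L' where "L' = (norm z)\<^sup>2 * exp (norm z) * Mm + norm z * (L + norm z * Mm + Mu) + L"
  have "norm (exp (- z * of_real (t + h)) * m (t + h) - exp (- z * of_real t) * m t - h *\<^sub>R (- exp (- z * of_real t) * of_real (u t))) \<le> L' * h * sqrt h"
    if t: "0 \<le> t" "0 < h" "h \<le> 1" "t + h \<le> T" for t h
  proof -
    have sh: "0 < sqrt h" "sqrt h \<le> 1" "sqrt h * sqrt h = h" using t by auto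
    have hh: "h * h \<le> h * sqrt h" using sh t mult_right_mono[of "sqrt h" 1 "sqrt h"] by (intro mult_left_mono) auto
    have hs: "h * sqrt h \<le> h" using sh t mult_left_mono[of "sqrt h" 1 h] by simp
    have c0: "0 \<le> c" by (simp add: c_def)
    have ex: "exp (c * s) \<le> exp (c * T)" if "s \<le> T" for s
      using that c0 by (simp add: mult_left_mono)
    have mM: "norm (m s) \<le> Mm" if "0 \<le> s" "s \<le> T" for s
      unfolding Mm_def using norm_m_le[OF that(1)] that C_nonneg ex[OF that(2)]
      by (elim order_trans) (intro mult_mono; auto)
    have uM: "\<bar>u s\<bar> \<le> Mu" if "0 \<le> s" "s \<le> T" for s
    proof -
      have "u s \<le> Mu" unfolding Mu_def using u_bounds(2)[OF that(1)] that ex[OF that(2)]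
        by (elim order_trans) (intro mult_mono; auto)
      then show ?thesis using u_bounds(1)[OF that(1)] by simp
    qed
    have os: "norm (m (t + h) - m t - h * (z * m t - u t)) \<le> L * (h * sqrt h)"
      using one_step[OF t] unfolding L_def by (simp only: mult.assoc)
    have L0: "0 \<le> L"
    proof -
      have "0 \<le> L * (h * sqrt h)" using os norm_ge_zero order_trans by blast
      moreover have "0 < h * sqrt h" using t sh by simp
      ultimately show ?thesis by (meson mult_neg_pos not_le)
    qed
    have ths: "0 \<le> t + h" "t \<le> T" using t by auto
    have M0: "0 \<le> Mm" "0 \<le> Mu" using mM[OF t(1) ths(2)] uM[OF t(1) ths(2)] norm_ge_zero order_trans abs_ge_zero by blast+
    have dm: "norm (m (t + h) - m t) \<le> h * (L + norm z * Mm + Mu)"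
    proof -
      have "norm (m (t + h) - m t) \<le> norm (m (t + h) - m t - h * (z * m t - u t)) + norm (h * (z * m t - u t))"
        by (rule order_trans[OF _ norm_triangle_ineq]) simp
      also have "norm (h * (z * m t - u t)) \<le> h * (norm z * Mm + Mu)"
      proof -
        have "norm (z * m t - u t) \<le> norm (z * m t) + norm (of_real (u t) :: complex)" by (rule norm_triangle_ineq4)
        also have "\<dots> \<le> norm z * Mm + Mu"
          using mM[OF t(1) ths(2)] uM[OF t(1) ths(2)] by (simp add: norm_mult add_mono mult_left_mono)
        finally show ?thesis using t by (simp add: norm_mult)
      qed
      also have "norm (m (t + h) - m t - h * (z * m t - u t)) \<le> L * h"
        using os mult_left_mono[OF hs L0] by simp
      finally show ?thesis by (simp add: algebra_simps)
    qed
    define w where "w = - z * of_real h"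
    have nw: "norm w = norm z * h" using t by (simp add: w_def norm_mult)
    have e1: "norm ((exp w - 1 - w) * m (t + h)) \<le> (norm z)\<^sup>2 * exp (norm z) * Mm * (h * h)"
    proof -
      have "norm w \<le> norm z" unfolding nw using t by (simp add: mult_left_le)
      then have "(norm w)\<^sup>2 * exp (norm w) \<le> (norm z * h)\<^sup>2 * exp (norm z)"
        unfolding nw[symmetric] by (intro mult_left_mono) auto
      then have "norm (exp w - 1 - w) \<le> (norm z * h)\<^sup>2 * exp (norm z)"
        using norm_exp_minus_affine_le[of w] by linarith
      then have "norm ((exp w - 1 - w) * m (t + h)) \<le> (norm z * h)\<^sup>2 * exp (norm z) * Mm"
        unfolding norm_mult using mM[OF ths(1) t(4)] by (intro mult_mono) auto
      also have "\<dots> = (norm z)\<^sup>2 * exp (norm z) * Mm * (h * h)" by (simp add: power2_eq_square algebra_simps)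
      finally show ?thesis .
    qed
    have e2: "norm (w * (m (t + h) - m t)) \<le> norm z * (L + norm z * Mm + Mu) * (h * h)"
    proof -
      have "norm (w * (m (t + h) - m t)) \<le> (norm z * h) * (h * (L + norm z * Mm + Mu))"
        unfolding norm_mult nw using dm t by (intro mult_left_mono) auto
      then show ?thesis by (simp add: algebra_simps)
    qed
    \<comment> \<open>With \<open>w = - z h\<close> the discounted increment splits into the second
      order remainder of \<open>exp w\<close>, the product of the two first order increments, and
      the error of \<open>one_step\<close>. The first two are of order \<open>h^2\<close>, hence at
      most of order \<open>h sqrt h\<close>.\<close>
    have "exp (- z * of_real (t + h)) * m (t + h) - exp (- z * of_real t) * m t - h *\<^sub>R (- exp (- z * of_real t) * of_real (u t))
      = exp (- z * of_real t) * ((exp w - 1 - w) * m (t + h) + w * (m (t + h) - m t) + (m (t + h) - m t - h * (z * m t - u t)))"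
      by (simp add: w_def exp_add ring_distribs scaleR_conv_of_real)
        (simp add: exp_diff exp_minus field_simps)
    also have "norm \<dots> \<le> 1 * (norm z ^ 2 * exp (norm z) * Mm * (h * h) + norm z * (L + norm z * Mm + Mu) * (h * h) + L * (h * sqrt h))"
      unfolding norm_mult[of "exp (- z * of_real t)"]
      using z t by (intro mult_mono order_trans[OF norm_triangle_ineq] add_mono e1 e2 os) auto
    also have "\<dots> = (norm z ^ 2 * exp (norm z) * Mm + norm z * (L + norm z * Mm + Mu)) * (h * h) + L * (h * sqrt h)"
      by (simp add: algebra_simps)
    also have "\<dots> \<le> (norm z ^ 2 * exp (norm z) * Mm + norm z * (L + norm z * Mm + Mu)) * (h * sqrt h) + L * (h * sqrt h)"
      using L0 M0 by (intro add_right_mono mult_left_mono[OF hh]) auto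
    also have "\<dots> = L' * h * sqrt h" by (simp add: L'_def algebra_simps)
    finally show ?thesis .
  qed
  then show ?thesis by blast
qed

lemma continuous_on_u: "continuous_on {0..T} u"
proof (rule lipschitz_on_continuous_on, rule lipschitz_onI)
  show "dist (u s) (u t) \<le> exp (c * T) * dist s t" if "s \<in> {0..T}" "t \<in> {0..T}" for s t
  proof -
    have *: "\<bar>u t - u s\<bar> \<le> exp (c * T) * (t - s)" if "0 \<le> s" "s \<le> t" "t \<le> T" for s t
    proof -
      have "exp (c * t) \<le> exp (c * T)" using that by (auto simp: c_def intro!: mult_left_mono)
      then have "(t - s) * exp (c * t) \<le> (t - s) * exp (c * T)" using that by (intro mult_left_mono) auto
      then show ?thesis using u_lipschitz[of s t] that by (simp add: mult.commute)
    qed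
    show ?thesis
      using that *[of s t] *[of t s] by (cases "s \<le> t") (auto simp: dist_real_def abs_minus_commute)
  qed
qed simp

lemma m_0: "m 0 = G a"
proof -
  have "m 0 = expectation (\<lambda>\<omega>. G a)"
    unfolding m_def
  proof (rule integral_cong_AE)
    show "AE \<omega> in Q. of_real (S 0 \<omega>) * G (K 0 \<omega>) = G a"
      using start AE_space by eventually_elim (simp add: S_def K_def yor_accumulation_eq_integral)
    show "(\<lambda>\<omega>. of_real (S 0 \<omega>) * G (K 0 \<omega>)) \<in> borel_measurable Q"
      by (rule borel_measurable_integrable[OF integrable_SG]) simp
  qed simp
  then show ?thesis by (simp add: prob_space)
qed

lemma discounted_identity:
  assumes z: "Re z > 0" and T: "0 < T"
  shows "integral {0..T} (\<lambda>t. exp (- z * of_real t) * of_real (u t)) = G a - exp (- z * of_real T) * m T"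
proof -
  obtain L where L: "\<And>t h. 0 \<le> t \<Longrightarrow> 0 < h \<Longrightarrow> h \<le> 1 \<Longrightarrow> t + h \<le> T \<Longrightarrow>
     norm (exp (- z * of_real (t + h)) * m (t + h) - exp (- z * of_real t) * m t - h *\<^sub>R (- exp (- z * of_real t) * of_real (u t))) \<le> L * h * sqrt h"
    using discounted_step[OF z, of T] by blast
  have "continuous_on {0..T} (\<lambda>t. - exp (- z * of_real t) * of_real (u t))"
    by (intro continuous_intros continuous_on_u)
  from increments_imp_integral[where V = "\<lambda>t. exp (- z * of_real t) * m t", OF T this L]
  show ?thesis by (simp add: m_0 algebra_simps)
qed

text \<open>The boundary term at \<open>T\<close> is at most
  \<open>C (1 + T) exp (- (Re z - c) T)\<close> and disappears; the boundary term at 0 is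
  \<open>m 0 = G a\<close>.\<close>

theorem resolvent:
  assumes z: "Re z > 0" "Re z > 2 * (\<nu> + 1)"
  shows "set_integrable lborel {0..} (\<lambda>x. exp (- z * of_real x) * of_real (u x))"
    and "(LBINT x:{0..}. exp (- z * of_real x) * of_real (u x)) = G a"
proof -
  \<comment> \<open>The margin between the discount rate and the growth rate; both hypotheses on
    \<open>z\<close> enter here, since \<open>c\<close> is a maximum.\<close>
  define e where "e = Re z - c"
  have e: "0 < e" using z by (simp add: e_def c_def)
  let ?g = "\<lambda>x. exp (- z * of_real x) * of_real (u x)"
  have cu: "continuous_on {0..} u"
    unfolding continuous_on_eq_continuous_within
  proof
    fix x :: real assume x: "x \<in> {0..}"
    have "at x within {0..} = at x within {0..x + 1}"
      by (rule at_within_nhd[of _ "{..<x + 1}"]) auto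
    then show "continuous (at x within {0..}) u"
      using continuous_on_u[of "x + 1"] x by (auto simp: continuous_on_eq_continuous_within)
  qed
  show i: "set_integrable lborel {0..} ?g"
    using integrable_polynomial_exp_decay[OF e] unfolding set_integrable_def
  proof (rule Bochner_Integration.integrable_bound)
    have "continuous_on {0..} ?g" by (intro continuous_intros cu)
    then show "(\<lambda>x. indicat_real {0..} x *\<^sub>R ?g x) \<in> borel_measurable lborel"
      using borel_measurable_continuous_on_indicator[of "{0..}" ?g] by simp
    show "AE x in lborel. norm (indicat_real {0..} x *\<^sub>R ?g x) \<le> norm (indicat_real {0..} x *\<^sub>R (x * exp (- e * x)))"
    proof (intro AE_I2)
      fix x :: real
      have "norm (?g x) \<le> x * exp (- e * x)" if "0 \<le> x"
      proof -
        have "norm (?g x) = exp (- Re z * x) * u x"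
          using u_bounds(1)[OF that] by (simp add: norm_mult)
        also have "\<dots> \<le> exp (- Re z * x) * (x * exp (c * x))"
          by (intro mult_left_mono u_bounds that) auto
        also have "\<dots> = x * exp (- e * x)" by (simp add: e_def exp_add[symmetric] algebra_simps)
        finally show ?thesis .
      qed
      then show "norm (indicat_real {0..} x *\<^sub>R ?g x) \<le> norm (indicat_real {0..} x *\<^sub>R (x * exp (- e * x)))"
        by (auto simp: indicator_def)
    qed
  qed
  have l1: "((\<lambda>T. LBINT x:{0..T}. ?g x) \<longlongrightarrow> (LBINT x:{0..}. ?g x)) at_top"
    by (intro tendsto_set_lebesgue_integral_at_top i) auto
  have ev: "eventually (\<lambda>T. (LBINT x:{0..T}. ?g x) = G a - exp (- z * of_real T) * m T) at_top"
    using eventually_gt_at_top[of 0]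
  proof eventually_elim
    case (elim T)
    have "(LBINT x:{0..T}. ?g x) = integral {0..T} ?g"
      by (intro set_borel_integral_eq_integral borel_integrable_atLeastAtMost' continuous_intros continuous_on_u)
    then show ?case using discounted_identity[OF z(1) elim] by simp
  qed
  have "((\<lambda>T. exp (- z * of_real T) * m T) \<longlongrightarrow> 0) at_top"
  proof (rule Lim_null_comparison)
    show "eventually (\<lambda>T. norm (exp (- z * of_real T) * m T) \<le> C * ((1 + T) * exp (- e * T))) at_top"
      using eventually_ge_at_top[of 0]
    proof eventually_elim
      case (elim T)
      have "norm (exp (- z * of_real T) * m T) = exp (- Re z * T) * norm (m T)" by (simp add: norm_mult)
      also have "\<dots> \<le> exp (- Re z * T) * (C * (1 + T) * exp (c * T))"
        by (intro mult_left_mono norm_m_le elim) auto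
      also have "\<dots> = C * ((1 + T) * exp (- e * T))" by (simp add: e_def exp_add[symmetric] algebra_simps)
      finally show ?case .
    qed
    have "((\<lambda>T. (1 + T) * exp (- e * T)) \<longlongrightarrow> 0) at_top" using e by real_asymp
    from tendsto_mult_right_zero[OF this, of C]
    show "((\<lambda>T. C * ((1 + T) * exp (- e * T))) \<longlongrightarrow> 0) at_top" by simp
  qed
  then have "((\<lambda>T. G a - exp (- z * of_real T) * m T) \<longlongrightarrow> G a - 0) at_top" by (intro tendsto_intros)
  with l1 show "(LBINT x:{0..}. ?g x) = G a"
    using tendsto_unique[OF _ l1] tendsto_cong[OF ev] by auto
qed

end

section \<open>A Weyl fractional integral\<close>

lemma has_vector_derivative_within_iff_tendsto:
  fixes f :: "real \<Rightarrow> 'b::real_normed_vector"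
  shows "(f has_vector_derivative D) (at x within S) \<longleftrightarrow> ((\<lambda>y. (f y - f x) /\<^sub>R (y - x)) \<longlongrightarrow> D) (at x within S)"
proof -
  have "(f has_vector_derivative D) (at x within S) \<longleftrightarrow>
      ((\<lambda>y. (1 / norm (y - x)) *\<^sub>R (f y - (f x + (y - x) *\<^sub>R D))) \<longlongrightarrow> 0) (at x within S)"
    unfolding has_vector_derivative_def has_derivative_within using bounded_linear_scaleR_left by blast
  also have "\<dots> \<longleftrightarrow> ((\<lambda>y. norm ((1 / norm (y - x)) *\<^sub>R (f y - (f x + (y - x) *\<^sub>R D)))) \<longlongrightarrow> 0) (at x within S)"
    by (rule tendsto_norm_zero_iff[symmetric])
  also have "\<dots> \<longleftrightarrow> ((\<lambda>y. norm ((f y - f x) /\<^sub>R (y - x) - D)) \<longlongrightarrow> 0) (at x within S)"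
  proof (rule tendsto_cong)
    have "norm ((1 / norm (y - x)) *\<^sub>R (f y - (f x + (y - x) *\<^sub>R D))) = norm ((f y - f x) /\<^sub>R (y - x) - D)" if "y \<noteq> x" for y
    proof -
      have "(f y - f x) /\<^sub>R (y - x) - D = (f y - (f x + (y - x) *\<^sub>R D)) /\<^sub>R (y - x)"
        using that by (simp add: scaleR_diff_right scaleR_add_right diff_diff_add)
      then show ?thesis by (simp add: divide_inverse)
    qed
    then show "\<forall>\<^sub>F y in at x within S. norm ((1 / norm (y - x)) *\<^sub>R (f y - (f x + (y - x) *\<^sub>R D))) = norm ((f y - f x) /\<^sub>R (y - x) - D)"
      by (auto simp: eventually_at_filter)
  qed
  also have "\<dots> \<longleftrightarrow> ((\<lambda>y. (f y - f x) /\<^sub>R (y - x)) \<longlongrightarrow> D) (at x within S)"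
    by (simp add: tendsto_norm_zero_iff LIM_zero_iff)
  finally show ?thesis .
qed

lemma vector_derivative_bound:
  fixes f :: "real \<Rightarrow> 'b::real_normed_vector"
  assumes "convex S" "\<And>x. x \<in> S \<Longrightarrow> (f has_vector_derivative f' x) (at x within S)"
    and "\<And>x. x \<in> S \<Longrightarrow> norm (f' x) \<le> K" "x \<in> S" "y \<in> S"
  shows "norm (f x - f y) \<le> K * \<bar>x - y\<bar>"
proof -
  have "norm (f x - f y) \<le> K * norm (x - y)"
  proof (rule differentiable_bound[OF assms(1), where f' = "\<lambda>x h. h *\<^sub>R f' x"])
    show "(f has_derivative (\<lambda>h. h *\<^sub>R f' x)) (at x within S)" if "x \<in> S" for x
      using assms(2)[OF that] by (simp add: has_vector_derivative_def)
    show "onorm (\<lambda>h. h *\<^sub>R f' x) \<le> K" if "x \<in> S" for x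
      by (rule onorm_le) (use mult_left_mono[OF assms(3)[OF that] abs_ge_zero] in \<open>simp add: mult.commute\<close>)
  qed (use assms in auto)
  then show ?thesis by simp
qed

text \<open>By the mean value inequality the difference quotients inherit the bound \<open>g\<close>
  of the derivative. Dominated convergence then applies along any sequence tending to
  \<open>k\<close>.\<close>

lemma has_vector_derivative_integral_dominated:
  fixes f f' :: "real \<Rightarrow> 'a \<Rightarrow> 'b::{banach, second_countable_topology}"
  assumes S: "convex S" "k \<in> S"
    and f: "\<And>x. x \<in> S \<Longrightarrow> integrable M (f x)"
    and f': "f' k \<in> borel_measurable M"
    and deriv: "\<And>x v. x \<in> S \<Longrightarrow> v \<in> space M \<Longrightarrow> ((\<lambda>x. f x v) has_vector_derivative f' x v) (at x within S)"
    and bound: "\<And>x v. x \<in> S \<Longrightarrow> v \<in> space M \<Longrightarrow> norm (f' x v) \<le> g v" and g: "integrable M g"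
  shows "((\<lambda>x. \<integral>v. f x v \<partial>M) has_vector_derivative (\<integral>v. f' k v \<partial>M)) (at k within S)"
  unfolding has_vector_derivative_within_iff_tendsto tendsto_at_iff_sequentially
proof (intro allI impI)
  fix X :: "nat \<Rightarrow> real" assume X: "\<forall>i. X i \<in> S - {k}" "X \<longlonglongrightarrow> k"
  let ?q = "\<lambda>n v. (f (X n) v - f k v) /\<^sub>R (X n - k)"
  have q: "integrable M (?q n)" for n
    using X S f by (intro integrable_scaleR_right Bochner_Integration.integrable_diff) auto
  have "(\<lambda>n. \<integral>v. ?q n v \<partial>M) \<longlonglongrightarrow> (\<integral>v. f' k v \<partial>M)"
  proof (rule integral_dominated_convergence[OF f' borel_measurable_integrable[OF q] g])
    show "AE v in M. (\<lambda>n. ?q n v) \<longlonglongrightarrow> f' k v"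
      using deriv[OF S(2)] X unfolding has_vector_derivative_within_iff_tendsto tendsto_at_iff_sequentially
      by (auto simp: comp_def)
    show "AE v in M. norm (?q n v) \<le> g v" for n
    proof (intro AE_I2)
      fix v assume v: "v \<in> space M"
      have "norm (f (X n) v - f k v) \<le> g v * \<bar>X n - k\<bar>"
        by (rule vector_derivative_bound[OF S(1), where f' = "\<lambda>x. f' x v"]) (use deriv bound v X S in auto)
      moreover have "0 < \<bar>X n - k\<bar>" using X by auto
      ultimately show "norm (?q n v) \<le> g v"
        by (simp only: norm_scaleR abs_inverse) (simp add: field_simps)
    qed
  qed
  moreover have "(\<integral>v. ?q n v \<partial>M) = ((\<integral>v. f (X n) v \<partial>M) - (\<integral>v. f k v \<partial>M)) /\<^sub>R (X n - k)" for n
    using X S f by (subst integral_scaleR_right, subst Bochner_Integration.integral_diff) auto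
  ultimately show "((\<lambda>y. ((\<integral>v. f y v \<partial>M) - (\<integral>v. f k v \<partial>M)) /\<^sub>R (y - k)) \<circ> X) \<longlonglongrightarrow> (\<integral>v. f' k v \<partial>M)"
    by (simp only: comp_def)
qed

text \<open>The power \<open>r powr s\<close> for \<open>r > 0\<close>, written through the real
  logarithm: the addition law in the exponent holds without side conditions, and no branch of the
  complex logarithm interferes with differentiation.\<close>

definition rpow :: "complex \<Rightarrow> real \<Rightarrow> complex" where
  "rpow s r = exp (s * of_real (ln r))"

lemma rpow_eq_powr: "0 < r \<Longrightarrow> rpow s r = of_real r powr s"
  by (simp add: rpow_def powr_def Ln_of_real)

lemma norm_rpow: "0 < r \<Longrightarrow> norm (rpow s r) = r powr Re s"
  by (simp add: rpow_def powr_def)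

lemma rpow_add: "rpow (s + t) r = rpow s r * rpow t r"
  by (simp add: rpow_def distrib_right exp_add)

lemma rpow_diff_1: "0 < r \<Longrightarrow> rpow (s - 1) r = rpow s r / of_real r"
  by (simp add: rpow_def left_diff_distrib exp_diff exp_of_real)

lemma rpow_plus_1: "0 < r \<Longrightarrow> rpow (s + 1) r = rpow s r * of_real r"
  by (simp add: rpow_def distrib_right exp_add exp_of_real)

lemma has_vector_derivative_rpow:
  assumes "0 < r"
  shows "(rpow s has_vector_derivative s * rpow (s - 1) r) (at r within S)"
proof -
  have "((\<lambda>r. exp (s * of_real (ln r))) has_vector_derivative (s * of_real (1 / r)) * exp (s * of_real (ln r))) (at r within S)"
  proof (rule field_vector_diff_chain_within[where g = exp and f = "\<lambda>r. s * of_real (ln r)", unfolded o_def])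
    have "((\<lambda>r. complex_of_real (ln r)) has_vector_derivative of_real (1 / r)) (at r within S)"
      using assms by (intro has_vector_derivative_of_real)
        (auto intro!: derivative_eq_intros simp: has_real_derivative_iff_has_vector_derivative[symmetric])
    then show "((\<lambda>r. s * of_real (ln r)) has_vector_derivative s * of_real (1 / r)) (at r within S)"
      by (rule has_vector_derivative_mult_right)
  qed (rule DERIV_subset[OF DERIV_exp subset_UNIV])
  then show ?thesis unfolding rpow_diff_1[OF assms] by (simp add: rpow_def[abs_def] field_simps)
qed

lemma continuous_on_rpow [continuous_intros]:
  assumes "continuous_on S f" "\<And>x. x \<in> S \<Longrightarrow> 0 < f x"
  shows "continuous_on S (\<lambda>x. rpow s (f x))"
  unfolding rpow_def by (intro continuous_intros assms) (use assms(2) in force)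

text \<open>The condition on \<open>\<eta>\<close> controls the kernel \<open>v^\<eta>\<close> near
  0, the gap between \<open>\<gamma>\<close> and \<open>\<eta>\<close> gives integrability at
  infinity. Later \<open>\<eta> + 1\<close> and \<open>\<gamma>\<close> become the two parameters of
  Kummer's function.\<close>

locale weyl_integral =
  fixes \<eta> \<gamma> :: complex
  assumes \<eta>: "0 \<le> Re \<eta>" and \<gamma>: "1 < Re \<gamma> - Re \<eta>"
begin

text \<open>The index counts extra factors \<open>1 / r\<close>. Differentiating \<open>w m\<close>
  yields only \<open>w (m + 2)\<close> and \<open>w (Suc m)\<close>, so the family, and with it that
  of the integrals \<open>F m\<close>, is closed under derivatives.\<close>

definition "w m r = of_real (exp (- 1 / (2 * r))) * rpow (- \<gamma> - of_nat m) r"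

definition "F m k = (LBINT v:{0<..}. rpow \<eta> v * w m (v + k))"

definition "F' m k = F (m + 2) k / 2 - (\<gamma> + of_nat m) * F (Suc m) k"

lemma w_Suc: "0 < r \<Longrightarrow> w (Suc m) r = w m r / of_real r"
  using rpow_diff_1[of r "- \<gamma> - of_nat m"] by (simp add: w_def algebra_simps)

lemma w_add: "0 < r \<Longrightarrow> w (m + j) r = w m r / of_real r ^ j"
  by (induction j) (simp_all add: w_Suc)

lemma has_vector_derivative_w:
  assumes "0 < r"
  shows "(w m has_vector_derivative w (m + 2) r / 2 - (\<gamma> + of_nat m) * w (Suc m) r) (at r within S)"
proof -
  have e: "((\<lambda>r. of_real (exp (- 1 / (2 * r))) :: complex) has_vector_derivative of_real (exp (- 1 / (2 * r)) / (2 * r\<^sup>2))) (at r within S)"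
    using assms by (intro has_vector_derivative_of_real)
      (auto intro!: derivative_eq_intros simp: has_real_derivative_iff_has_vector_derivative[symmetric] power2_eq_square)
  have "(w m has_vector_derivative of_real (exp (- 1 / (2 * r))) * ((- \<gamma> - of_nat m) * rpow (- \<gamma> - of_nat m - 1) r) +
      of_real (exp (- 1 / (2 * r)) / (2 * r\<^sup>2)) * rpow (- \<gamma> - of_nat m) r) (at r within S)"
    unfolding w_def[abs_def] by (rule has_vector_derivative_mult[OF e has_vector_derivative_rpow[OF assms]])
  moreover have "of_real (exp (- 1 / (2 * r))) * ((- \<gamma> - of_nat m) * rpow (- \<gamma> - of_nat m - 1) r) +
      of_real (exp (- 1 / (2 * r)) / (2 * r\<^sup>2)) * rpow (- \<gamma> - of_nat m) r = w (m + 2) r / 2 - (\<gamma> + of_nat m) * w (Suc m) r"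
    using assms unfolding w_add[OF assms] w_Suc[OF assms] rpow_diff_1[OF assms]
    by (simp add: w_def field_simps)
  ultimately show ?thesis by simp
qed

lemma continuous_on_w [continuous_intros]:
  assumes "continuous_on S f" "\<And>x. x \<in> S \<Longrightarrow> 0 < f x"
  shows "continuous_on S (\<lambda>x. w m (f x))"
  unfolding w_def using assms(2) by (intro continuous_intros assms) (auto simp: less_imp_neq[symmetric])

text \<open>One dominating function for all \<open>k\<close> and, up to the constant
  \<open>K m\<close>, all \<open>m\<close>; its exponent is below \<open>- 1\<close>.\<close>

definition "D = (\<lambda>v. (1 + v) powr (Re \<eta> - Re \<gamma>))"

lemma integrable_D: "set_integrable lborel {0<..} D"
proof -
  have "(\<lambda>x. x powr (Re \<eta> - Re \<gamma>)) absolutely_integrable_on {1..}"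
    using has_integral_powr_to_inf[of "Re \<eta> - Re \<gamma>" 1] \<gamma>
    by (subst absolutely_integrable_on_iff_nonneg) (auto simp: integrable_on_def)
  then have "integrable lborel (\<lambda>x. indicat_real {1..} x *\<^sub>R x powr (Re \<eta> - Re \<gamma>))"
    unfolding set_integrable_def by (subst (asm) integrable_completion) auto
  from lborel_integrable_real_affine[OF this, of 1 1]
  have "integrable lborel (\<lambda>x. indicat_real {1..} (1 + x) *\<^sub>R (1 + x) powr (Re \<eta> - Re \<gamma>))" by simp
  then have "set_integrable lborel {0..} D"
    unfolding set_integrable_def D_def by (rule Bochner_Integration.integrable_cong[THEN iffD1, rotated 2]) (auto simp: indicator_def)
  then show ?thesis by (rule set_integrable_subset) auto
qed

text \<open>With \<open>p = Re \<gamma> + m\<close> and \<open>x = 1 + 1 / r\<close>, the constant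
  arises from \<open>x powr p \<le> (2 p) powr p * exp (x / 2)\<close>, after the factor
  \<open>exp (1 / (2 r))\<close> contained in \<open>exp (x / 2)\<close> has been cancelled.\<close>

definition "K m = (2 * (Re \<gamma> + real m)) powr (Re \<gamma> + real m) * exp (1/2)"

lemma norm_w: "0 < r \<Longrightarrow> norm (w m r) = exp (- 1 / (2 * r)) * r powr (- Re \<gamma> - real m)"
  by (simp add: w_def norm_mult norm_rpow)

text \<open>Near 0 the factor \<open>exp (- 1 / (2 r))\<close> beats every power of
  \<open>1 / r\<close>, so only the decay at infinity remains. This makes all the integrals regular
  down to \<open>k = 0\<close>.\<close>

lemma norm_w_le:
  assumes "0 < r" shows "norm (w m r) \<le> K m * (1 + r) powr (- Re \<gamma>)"
proof -
  define p where "p = Re \<gamma> + real m"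
  have p: "0 < p" using \<eta> \<gamma> by (simp add: p_def)
  define x where "x = 1 + 1 / r"
  have x: "0 < x" "(1 + r) / r = x" using assms by (auto simp: x_def field_simps add_pos_pos)
  \<comment> \<open>Raising \<open>y \<le> exp y\<close> at \<open>y = x / (2 p)\<close> to the
    power \<open>p\<close> produces the factor \<open>exp (x / 2)\<close>.\<close>
  have "x / (2 * p) \<le> exp (x / (2 * p))" using exp_ge_add_one_self[of "x / (2 * p)"] by linarith
  then have "x \<le> 2 * p * exp (x / (2 * p))" using p by (simp add: field_simps)
  then have "x powr p \<le> (2 * p * exp (x / (2 * p))) powr p" using p x by (intro powr_mono2) auto
  also have "\<dots> = (2 * p) powr p * exp (x / 2)" using p by (simp add: powr_mult exp_powr_real)
  finally have "x powr p * exp (- 1 / (2 * r)) \<le> ((2 * p) powr p * exp (x / 2)) * exp (- 1 / (2 * r))"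
    by (intro mult_right_mono) auto
  also have "\<dots> = K m" by (simp add: K_def p_def x_def mult.assoc exp_add[symmetric] add_divide_distrib)
  finally have xK: "x powr p * exp (- 1 / (2 * r)) \<le> K m" .
  have "norm (w m r) = exp (- 1 / (2 * r)) * r powr (- p)" using assms by (simp add: norm_w p_def)
  also have "r powr (- p) = x powr p * (1 + r) powr (- p)"
    using assms by (simp add: x(2)[symmetric] powr_divide powr_minus field_simps)
  also have "exp (- 1 / (2 * r)) * (x powr p * (1 + r) powr (- p)) = (x powr p * exp (- 1 / (2 * r))) * (1 + r) powr (- p)" by simp
  also have "\<dots> \<le> K m * (1 + r) powr (- p)" by (intro mult_right_mono xK) auto
  also have "\<dots> \<le> K m * (1 + r) powr (- Re \<gamma>)"
    using assms by (intro mult_left_mono powr_mono) (auto simp: p_def K_def)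
  finally show ?thesis .
qed

lemma K_nonneg: "0 \<le> K m" by (simp add: K_def)

lemma norm_integrand_le:
  assumes "0 < v" "0 \<le> k"
  shows "norm (rpow \<eta> v * w m (v + k)) \<le> K m * D v"
proof -
  have "norm (rpow \<eta> v * w m (v + k)) = v powr Re \<eta> * norm (w m (v + k))"
    using assms by (simp add: norm_mult norm_rpow)
  also have "\<dots> \<le> (1 + v) powr Re \<eta> * (K m * (1 + v) powr (- Re \<gamma>))"
  proof (intro mult_mono powr_mono2)
    have "norm (w m (v + k)) \<le> K m * (1 + (v + k)) powr (- Re \<gamma>)" using assms by (intro norm_w_le) auto
    also have "\<dots> \<le> K m * (1 + v) powr (- Re \<gamma>)"
      using assms \<eta> \<gamma> by (intro mult_left_mono powr_mono2' K_nonneg) auto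
    finally show "norm (w m (v + k)) \<le> K m * (1 + v) powr (- Re \<gamma>)" .
  qed (use assms \<eta> in auto)
  also have "\<dots> = K m * D v" by (simp add: D_def powr_diff powr_minus field_simps)
  finally show ?thesis .
qed

text \<open>Since \<open>k \<le> v + k\<close>, the power \<open>k ^ j\<close> is absorbed by the
  \<open>j\<close> extra factors \<open>1 / (v + k)\<close> in \<open>w (m + j)\<close>.\<close>

lemma power_norm_integrand_le:
  assumes "0 < v" "0 \<le> k"
  shows "k ^ j * norm (rpow \<eta> v * w (m + j) (v + k)) \<le> K m * D v"
proof -
  have "k ^ j * norm (rpow \<eta> v * w (m + j) (v + k)) \<le> (v + k) ^ j * norm (rpow \<eta> v * w (m + j) (v + k))"
    using assms by (intro mult_right_mono power_mono) auto
  also have "\<dots> = norm (rpow \<eta> v * w m (v + k))"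
    using assms by (simp add: w_add norm_mult norm_divide norm_power del: of_real_add)
  finally show ?thesis using norm_integrand_le[OF assms, of m] by simp
qed

lemma integrand_measurable:
  assumes "0 \<le> k"
  shows "(\<lambda>v. indicat_real {0<..} v *\<^sub>R (rpow \<eta> v * w m (v + k))) \<in> borel_measurable lborel"
proof -
  have "continuous_on {0<..} (\<lambda>v. rpow \<eta> v * w m (v + k))"
    using assms by (intro continuous_intros) auto
  then show ?thesis using borel_measurable_continuous_on_indicator[of "{0<..}" "\<lambda>v. rpow \<eta> v * w m (v + k)"] by simp
qed

lemma integrand_integrable:
  assumes "0 \<le> k"
  shows "set_integrable lborel {0<..} (\<lambda>v. rpow \<eta> v * w m (v + k))"
  unfolding set_integrable_def
proof (rule Bochner_Integration.integrable_bound)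
  show "integrable lborel (\<lambda>v. K m * (indicat_real {0<..} v *\<^sub>R D v))"
    using integrable_D unfolding set_integrable_def by (rule integrable_mult_right)
  show "AE v in lborel. norm (indicat_real {0<..} v *\<^sub>R (rpow \<eta> v * w m (v + k))) \<le> norm (K m * (indicat_real {0<..} v *\<^sub>R D v))"
    using norm_integrand_le[OF _ assms, of _ m] K_nonneg[of m] by (auto simp: indicator_def abs_mult D_def)
qed (rule integrand_measurable[OF assms])

lemma power_norm_F_le:
  assumes "0 \<le> k"
  shows "k ^ j * norm (F (m + j) k) \<le> K m * (LBINT v:{0<..}. D v)"
proof -
  have i: "set_integrable lborel {0<..} (\<lambda>v. k ^ j * norm (rpow \<eta> v * w (m + j) (v + k)))"
    by (intro set_integrable_mult_right impI set_integrable_norm integrand_integrable assms)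
  have "k ^ j * norm (F (m + j) k) \<le> k ^ j * (LBINT v:{0<..}. norm (rpow \<eta> v * w (m + j) (v + k)))"
    unfolding F_def using assms by (intro mult_left_mono set_integral_norm_bound integrand_integrable) auto
  also have "\<dots> = (LBINT v:{0<..}. k ^ j * norm (rpow \<eta> v * w (m + j) (v + k)))" by simp
  also have "\<dots> \<le> (LBINT v:{0<..}. K m * D v)"
    using integrable_D i by (intro set_integral_mono set_integrable_mult_right impI power_norm_integrand_le assms) auto
  finally show ?thesis by simp
qed

text \<open>Differentiation under the integral with a dominating function independent of
  \<open>k\<close>; the derivative is relative to \<open>{0..}\<close>, hence one-sided at the
  boundary.\<close>

lemma has_vector_derivative_F:
  assumes "0 \<le> k"
  shows "(F m has_vector_derivative F' m k) (at k within {0..})"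
proof -
  define f where "f x v = indicat_real {0<..} v *\<^sub>R (rpow \<eta> v * w m (v + x))" for x v
  define f' where "f' x v = (indicat_real {0<..} v *\<^sub>R (rpow \<eta> v * w (m + 2) (v + x))) / 2 -
      (\<gamma> + of_nat m) * (indicat_real {0<..} v *\<^sub>R (rpow \<eta> v * w (Suc m) (v + x)))" for x v
  define g where "g v = (K (m + 2) / 2 + norm (\<gamma> + of_nat m) * K (Suc m)) * (indicat_real {0<..} v *\<^sub>R D v)" for v
  have "((\<lambda>x. \<integral>v. f x v \<partial>lborel) has_vector_derivative (\<integral>v. f' k v \<partial>lborel)) (at k within {0..})"
  proof (rule has_vector_derivative_integral_dominated[where g = g])
    show "integrable lborel (f x)" if "x \<in> {0..}" for x
      using integrand_integrable[of x m] that unfolding set_integrable_def f_def by auto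
    show "f' k \<in> borel_measurable lborel"
      unfolding f'_def using integrand_measurable[OF assms, of "m + 2"] integrand_measurable[OF assms, of "Suc m"] by measurable
    show "integrable lborel g"
      unfolding g_def using integrable_D unfolding set_integrable_def by (rule integrable_mult_right)
    fix x v :: real assume x: "x \<in> {0..}"
    show "((\<lambda>x. f x v) has_vector_derivative f' x v) (at x within {0..})"
    proof (cases "0 < v")
      case True
      have "((\<lambda>x. w m (v + x)) has_vector_derivative 1 *\<^sub>R (w (m + 2) (v + x) / 2 - (\<gamma> + of_nat m) * w (Suc m) (v + x))) (at x within {0..})"
        using True x by (intro vector_diff_chain_within[of "\<lambda>x. v + x" 1 x "{0..}" "w m", unfolded o_def] has_vector_derivative_w)
           (auto intro!: derivative_eq_intros)
      from has_vector_derivative_mult_right[OF this, of "rpow \<eta> v"] True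
      show ?thesis by (simp add: f_def f'_def algebra_simps)
    qed (simp add: f_def f'_def)
    show "norm (f' x v) \<le> g v"
    proof (cases "0 < v")
      case True
      have "norm (f' x v) \<le> norm (rpow \<eta> v * w (m + 2) (v + x)) / 2 + norm (\<gamma> + of_nat m) * norm (rpow \<eta> v * w (Suc m) (v + x))"
        unfolding f'_def using True by (intro order_trans[OF norm_triangle_ineq4]) (simp add: norm_mult norm_divide)
      also have "\<dots> \<le> (K (m + 2) * D v) / 2 + norm (\<gamma> + of_nat m) * (K (Suc m) * D v)"
        using True x by (intro add_mono divide_right_mono mult_left_mono norm_integrand_le) auto
      also have "\<dots> = g v" using True by (simp add: g_def algebra_simps)
      finally show ?thesis .
    qed (simp add: f'_def g_def)
  qed (use assms in auto)
  moreover have "(\<integral>v. f' k v \<partial>lborel) = F' m k"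
  proof -
    have i: "complex_integrable lborel (\<lambda>v. indicat_real {0<..} v *\<^sub>R (rpow \<eta> v * w j (v + k)))" for j
      using integrand_integrable[OF assms, of j] unfolding set_integrable_def .
    show ?thesis
      unfolding f'_def F'_def F_def set_lebesgue_integral_def
      by (subst Bochner_Integration.integral_diff[OF integrable_divide[OF i] integrable_mult_right[OF i]])
        (simp only: integral_divide_zero integral_mult_right_zero)
  qed
  ultimately show ?thesis by (simp add: f_def F_def[abs_def] set_lebesgue_integral_def)
qed

end

text \<open>The mean value inequality on the interval from \<open>- |s|\<close> to
  \<open>|s|\<close>. The factor \<open>1 / (j + 1)\<close> that integration would give is
  dropped.\<close>

lemma vector_derivative_power_bound:
  fixes f :: "real \<Rightarrow> 'b::real_normed_vector"
  assumes f: "\<And>s. (f has_vector_derivative f' s) (at s)" "f 0 = 0"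
    and bd: "\<And>s. \<bar>s\<bar> \<le> a \<Longrightarrow> norm (f' s) \<le> M * \<bar>s\<bar> ^ j" and M: "0 \<le> M" and s: "\<bar>s\<bar> \<le> a"
  shows "norm (f s) \<le> M * \<bar>s\<bar> ^ Suc j"
proof -
  have "norm (f s - f 0) \<le> (M * \<bar>s\<bar> ^ j) * \<bar>s - 0\<bar>"
  proof (rule vector_derivative_bound[where S = "{- \<bar>s\<bar>..\<bar>s\<bar>}" and f' = f'])
    fix x assume x: "x \<in> {- \<bar>s\<bar>..\<bar>s\<bar>}"
    then have "\<bar>x\<bar> \<le> \<bar>s\<bar>" by auto
    then have "M * \<bar>x\<bar> ^ j \<le> M * \<bar>s\<bar> ^ j" using M by (intro mult_left_mono power_mono) auto
    then show "norm (f' x) \<le> M * \<bar>s\<bar> ^ j" using bd[of x] \<open>\<bar>x\<bar> \<le> \<bar>s\<bar>\<close> s by linarith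
    show "(f has_vector_derivative f' x) (at x within {- \<bar>s\<bar>..\<bar>s\<bar>})"
      using f(1) by (rule has_vector_derivative_at_within)
  qed auto
  then show ?thesis using f(2) by (simp add: mult.assoc mult.left_commute mult.commute)
qed

text \<open>The preceding bound is applied three times, each time to a remainder that vanishes at 0
  and has the previous remainder as its derivative.\<close>

lemma taylor_order_3_bound:
  fixes f0 f1 f2 f3 :: "real \<Rightarrow> complex"
  assumes "\<And>s. (f0 has_vector_derivative f1 s) (at s)" "\<And>s. (f1 has_vector_derivative f2 s) (at s)"
    "\<And>s. (f2 has_vector_derivative f3 s) (at s)"
    and bd: "\<And>s. \<bar>s\<bar> \<le> \<bar>n\<bar> \<Longrightarrow> norm (f3 s) \<le> M"
  shows "norm (f0 n - f0 0 - of_real n * f1 0 - of_real (n\<^sup>2) / 2 * f2 0) \<le> M * \<bar>n\<bar> ^ 3"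
proof -
  have M: "0 \<le> M" using order_trans[OF norm_ge_zero bd[of 0]] by simp
  have s2: "norm (f2 s - f2 0) \<le> M * \<bar>s\<bar> ^ Suc 0" if "\<bar>s\<bar> \<le> \<bar>n\<bar>" for s
    by (rule vector_derivative_power_bound[where f' = f3, OF _ _ _ M that])
       (use bd in \<open>auto intro!: derivative_eq_intros assms(3)\<close>)
  have s1: "norm (f1 s - f1 0 - of_real s * f2 0) \<le> M * \<bar>s\<bar> ^ Suc (Suc 0)" if "\<bar>s\<bar> \<le> \<bar>n\<bar>" for s
  proof (rule vector_derivative_power_bound[where f' = "\<lambda>s. f2 s - f2 0", OF _ _ s2 M that])
    show "((\<lambda>s. f1 s - f1 0 - of_real s * f2 0) has_vector_derivative f2 s - f2 0) (at s)" for s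
      by (auto intro!: derivative_eq_intros assms(2))
  qed auto
  have "norm (f0 n - f0 0 - of_real n * f1 0 - of_real (n\<^sup>2) / 2 * f2 0) \<le> M * \<bar>n\<bar> ^ Suc (Suc (Suc 0))"
  proof (rule vector_derivative_power_bound[where f' = "\<lambda>s. f1 s - f1 0 - of_real s * f2 0", OF _ _ s1 M order_refl])
    show "((\<lambda>s. f0 s - f0 0 - of_real s * f1 0 - of_real (s\<^sup>2) / 2 * f2 0) has_vector_derivative f1 s - f1 0 - of_real s * f2 0) (at s)" for s
    proof -
      have "((\<lambda>s. complex_of_real (s\<^sup>2 / 2)) has_vector_derivative of_real s) (at s)"
        by (intro has_vector_derivative_of_real)
          (auto intro!: derivative_eq_intros simp: has_real_derivative_iff_has_vector_derivative[symmetric])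
      from has_vector_derivative_mult_left[OF this, of "f2 0"]
      have "((\<lambda>s. of_real (s\<^sup>2) / 2 * f2 0) has_vector_derivative of_real s * f2 0) (at s)" by simp
      moreover have "((\<lambda>s. f0 s - f0 0 - of_real s * f1 0) has_vector_derivative f1 s - f1 0) (at s)"
        by (auto intro!: derivative_eq_intros assms(1))
      ultimately show ?thesis using has_vector_derivative_diff by blast
    qed
  qed auto
  then show ?thesis by (simp add: numeral_3_eq_3)
qed

lemma has_vector_derivative_at_split:
  fixes f :: "real \<Rightarrow> 'b::real_normed_vector"
  assumes "(f has_vector_derivative D) (at x within {x..})" "(f has_vector_derivative D) (at x within {..x})"
  shows "(f has_vector_derivative D) (at x)"
proof -
  have "at x = sup (at x within {x..}) (at x within {..x})"
    by (subst at_within_union[symmetric]) (rule arg_cong[where f = "at_within x"], auto)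
  then show ?thesis
    using assms unfolding has_vector_derivative_within_iff_tendsto by (simp add: filterlim_sup)
qed

section \<open>The differential equation of the Weyl integral\<close>

context weyl_integral
begin

definition "F'' k = F' 2 k / 2 - \<gamma> * F' 1 k"

definition "F''' k = (F' 4 k / 2 - (\<gamma> + 2) * F' 3 k) / 2 - \<gamma> * (F' 3 k / 2 - (\<gamma> + 1) * F' 2 k)"

text \<open>Both boundary values vanish: \<open>v * D v\<close> is at most \<open>v\<close> near 0,
  and at infinity it decays because the exponent of \<open>D\<close> stays negative after adding
  1.\<close>

lemma integral_derivative_eq_0:
  fixes P q :: "real \<Rightarrow> complex"
  assumes deriv: "\<And>v. 0 < v \<Longrightarrow> (P has_vector_derivative q v) (at v)"
    and cont: "continuous_on {0<..} q" and int: "set_integrable lborel {0<..} q"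
    and bd: "\<And>v. 0 < v \<Longrightarrow> norm (P v) \<le> M * (v * D v)"
  shows "(LBINT v:{0<..}. q v) = 0"
proof -
  have "(LBINT v=0..\<infinity>. q v) = 0 - 0"
  proof (rule interval_integral_FTC_integrable[where F = P])
    fix v :: real assume "0 < ereal v"
    then show "(P has_vector_derivative q v) (at v)" "isCont q v"
      using deriv cont by (auto simp: continuous_on_eq_continuous_at)
  next
    show "set_integrable lborel (einterval 0 \<infinity>) q" using int by (simp add: zero_ereal_def)
  next
    have D1: "D v \<le> 1" if "0 < v" for v
      using that \<gamma> powr_mono[of "Re \<eta> - Re \<gamma>" 0 "1 + v"] by (simp add: D_def)
    have M0: "0 \<le> M"
    proof -
      have "0 \<le> M * (1 * D 1)" using order_trans[OF norm_ge_zero bd[of 1]] by simp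
      moreover have "0 < D 1" by (simp add: D_def)
      ultimately show ?thesis by (simp add: zero_le_mult_iff)
    qed
    have "(P \<longlongrightarrow> 0) (at_right 0)"
    proof (rule Lim_null_comparison)
      show "\<forall>\<^sub>F v in at_right 0. norm (P v) \<le> M * v"
        using eventually_at_right_less[of 0]
      proof eventually_elim
        case (elim v)
        have "M * (v * D v) \<le> M * (v * 1)" using elim D1[OF elim] M0 by (intro mult_left_mono) auto
        then show ?case using bd[OF elim] by simp
      qed
      show "((\<lambda>v. M * v) \<longlongrightarrow> 0) (at_right 0)" by (rule tendsto_eq_intros refl tendsto_ident_at | simp)+
    qed
    then show "((P \<circ> real_of_ereal) \<longlongrightarrow> 0) (at_right 0)"
      by (simp add: zero_ereal_def ereal_tendsto_simps)
    have "(P \<longlongrightarrow> 0) at_top"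
    proof (rule Lim_null_comparison)
      show "\<forall>\<^sub>F v in at_top. norm (P v) \<le> M * (1 + v) powr (Re \<eta> - Re \<gamma> + 1)"
        using eventually_gt_at_top[of 0]
      proof eventually_elim
        case (elim v)
        have "M * (v * D v) \<le> M * ((1 + v) * D v)" using elim M0 by (intro mult_left_mono mult_right_mono) (auto simp: D_def)
        also have "(1 + v) * D v = (1 + v) powr (Re \<eta> - Re \<gamma> + 1)" using elim by (simp add: D_def powr_add)
        finally show ?case using bd[OF elim] by linarith
      qed
      have "((\<lambda>v. (1 + v) powr (Re \<eta> - Re \<gamma> + 1)) \<longlongrightarrow> 0) at_top"
        using \<gamma> by (intro tendsto_neg_powr filterlim_tendsto_add_at_top[OF tendsto_const filterlim_ident]) auto
      then show "((\<lambda>v. M * (1 + v) powr (Re \<eta> - Re \<gamma> + 1)) \<longlongrightarrow> 0) at_top"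
        by (rule tendsto_mult_right_zero)
    qed
    then show "((P \<circ> real_of_ereal) \<longlongrightarrow> 0) (at_left \<infinity>)"
      by (simp add: ereal_tendsto_simps)
  qed simp
  then show ?thesis by (simp add: interval_lebesgue_integral_0_infty)
qed

text \<open>Under the integral sign the left-hand side is an exact derivative in \<open>v\<close>.
  With \<open>4 \<eta> - 2 \<gamma> = 2 (\<nu> + 1)\<close> and
  \<open>2 \<eta> (\<gamma> - 1 - \<eta>) = z - 2 (\<nu> + 1)\<close> this is the equation for
  \<open>G\<close> on \<open>k \<ge> 0\<close>, where the payoff term is 0.\<close>

lemma ode:
  assumes k: "0 \<le> k"
  shows "2 * of_real (k\<^sup>2) * F'' k - ((4 * \<eta> - 2 * \<gamma>) * of_real k + 1) * F' 0 k - 2 * \<eta> * (\<gamma> - 1 - \<eta>) * F 0 k = 0"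
proof -
  define c where "c = 4 * \<eta> - 2 * \<gamma>"
  let ?k = "complex_of_real k"
  define g where "g j v = rpow \<eta> v * w j (v + k)" for j v
  define q where "q v = 2 * ?k\<^sup>2 * ((g 4 v / 2 - (\<gamma> + 2) * g 3 v) / 2 - \<gamma> * (g 3 v / 2 - (\<gamma> + 1) * g 2 v))
     - (c * ?k + 1) * (g 2 v / 2 - \<gamma> * g 1 v) - 2 * \<eta> * (\<gamma> - 1 - \<eta>) * g 0 v" for v
  \<comment> \<open>The primitive of \<open>q\<close>. In terms of the derivative \<open>w'\<close>
    of \<open>w 0\<close>, its bracket is \<open>2 \<eta> w 0 - w 1 - 2 k w'\<close>, evaluated at
    \<open>v + k\<close>.\<close>
  define P where "P v = rpow (\<eta> + 1) v * (2 * \<eta> * w 0 (v + k) + (2 * ?k * \<gamma> - 1) * w 1 (v + k) - ?k * w 2 (v + k))" for v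
  have hF: "has_bochner_integral lborel (\<lambda>v. indicat_real {0<..} v *\<^sub>R g j v) (F j k)" for j
    using integrand_integrable[OF k, of j] unfolding F_def g_def set_lebesgue_integral_def set_integrable_def
    by (rule has_bochner_integral_integrable)
  have hq: "has_bochner_integral lborel (\<lambda>v. indicat_real {0<..} v *\<^sub>R q v)
     (2 * ?k\<^sup>2 * ((F 4 k / 2 - (\<gamma> + 2) * F 3 k) / 2 - \<gamma> * (F 3 k / 2 - (\<gamma> + 1) * F 2 k))
     - (c * ?k + 1) * (F 2 k / 2 - \<gamma> * F 1 k) - 2 * \<eta> * (\<gamma> - 1 - \<eta>) * F 0 k)" (is "has_bochner_integral _ _ ?I")
  proof -
    let ?h = "\<lambda>j v. indicat_real {0<..} v *\<^sub>R g j v"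
    have "(\<lambda>v. indicat_real {0<..} v *\<^sub>R q v) = (\<lambda>v. 2 * ?k\<^sup>2 * ((?h 4 v / 2 - (\<gamma> + 2) * ?h 3 v) / 2 - \<gamma> * (?h 3 v / 2 - (\<gamma> + 1) * ?h 2 v))
     - (c * ?k + 1) * (?h 2 v / 2 - \<gamma> * ?h 1 v) - 2 * \<eta> * (\<gamma> - 1 - \<eta>) * ?h 0 v)"
      by (auto simp: q_def indicator_def fun_eq_iff)
    then show ?thesis
      by (simp only:) (intro has_bochner_integral_diff has_bochner_integral_mult_right has_bochner_integral_divide_zero hF)
  qed
  have qi: "set_integrable lborel {0<..} q" "(LBINT v:{0<..}. q v) = ?I"
    using hq unfolding set_integrable_def set_lebesgue_integral_def by (auto simp: has_bochner_integral_iff)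
  have "(LBINT v:{0<..}. q v) = 0"
  proof (rule integral_derivative_eq_0[where P = P])
    fix v :: real assume v: "0 < v"
    let ?r = "complex_of_real (v + k)" and ?v = "complex_of_real v"
    have vk: "0 < v + k" using v k by simp
    then have r: "?r \<noteq> 0" by (metis of_real_eq_0_iff less_irrefl)
    have dw: "((\<lambda>v. w m (v + k)) has_vector_derivative w (m + 2) (v + k) / 2 - (\<gamma> + of_nat m) * w (Suc m) (v + k)) (at v)" for m
    proof -
      have "((\<lambda>v. v + k) has_vector_derivative 1) (at v)" by (auto intro!: derivative_eq_intros)
      from vector_diff_chain_at[OF this has_vector_derivative_w[OF vk, of m UNIV]] show ?thesis by (simp add: o_def)
    qed
    have "(P has_vector_derivative rpow (\<eta> + 1) v * (2 * \<eta> * (w (0 + 2) (v + k) / 2 - (\<gamma> + of_nat 0) * w (Suc 0) (v + k))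
        + (2 * ?k * \<gamma> - 1) * (w (1 + 2) (v + k) / 2 - (\<gamma> + of_nat 1) * w (Suc 1) (v + k))
        - ?k * (w (2 + 2) (v + k) / 2 - (\<gamma> + of_nat 2) * w (Suc 2) (v + k)))
        + (\<eta> + 1) * rpow (\<eta> + 1 - 1) v * (2 * \<eta> * w 0 (v + k) + (2 * ?k * \<gamma> - 1) * w 1 (v + k) - ?k * w 2 (v + k))) (at v)" (is "(_ has_vector_derivative ?d) _")
      unfolding P_def
      by (intro has_vector_derivative_mult has_vector_derivative_diff has_vector_derivative_add has_vector_derivative_mult_right dw has_vector_derivative_rpow v)
    moreover have "?d = q v"
    proof -
      define W where "W = w 0 (v + k)"
      have ww: "w j (v + k) = W / ?r ^ j" for j
        using w_add[OF vk, of 0 j] by (simp add: W_def)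
      \<comment> \<open>After the common factor \<open>rpow \<eta> v * W\<close> is taken out, the
        claim is a rational identity in \<open>r = v + k\<close>; the power gained by
        \<open>rpow (\<eta> + 1) v\<close> appears as \<open>v = r - k\<close>.\<close>
      have id: "(r - k') * (2 * e * (1 / r ^ 2 / 2 - g * (1 / r)) + (2 * k' * g - 1) * (1 / r ^ 3 / 2 - (g + 1) * (1 / r ^ 2)) - k' * (1 / r ^ 4 / 2 - (g + 2) * (1 / r ^ 3)))
          + (e + 1) * (2 * e + (2 * k' * g - 1) * (1 / r) - k' * (1 / r ^ 2))
        = 2 * k'\<^sup>2 * ((1 / r ^ 4 / 2 - (g + 2) * (1 / r ^ 3)) / 2 - g * (1 / r ^ 3 / 2 - (g + 1) * (1 / r ^ 2)))
          - ((4 * e - 2 * g) * k' + 1) * (1 / r ^ 2 / 2 - g * (1 / r)) - 2 * e * (g - 1 - e)"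
        if "r \<noteq> 0" for r k' e g :: complex
        using that by (simp add: field_simps eval_nat_numeral)
      have "?d = rpow \<eta> v * W * ((?r - ?k) * (2 * \<eta> * (1 / ?r ^ 2 / 2 - \<gamma> * (1 / ?r)) + (2 * ?k * \<gamma> - 1) * (1 / ?r ^ 3 / 2 - (\<gamma> + 1) * (1 / ?r ^ 2)) - ?k * (1 / ?r ^ 4 / 2 - (\<gamma> + 2) * (1 / ?r ^ 3)))
          + (\<eta> + 1) * (2 * \<eta> + (2 * ?k * \<gamma> - 1) * (1 / ?r) - ?k * (1 / ?r ^ 2)))"
        unfolding rpow_plus_1[OF v] ww
        by (simp add: algebra_simps add_divide_distrib diff_divide_distrib eval_nat_numeral)
      also have "\<dots> = q v"
        unfolding id[OF r] q_def g_def ww c_def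
        by (simp add: algebra_simps add_divide_distrib diff_divide_distrib)
      finally show ?thesis .
    qed
    ultimately show "(P has_vector_derivative q v) (at v)" by simp
  next
    show "continuous_on {0<..} q"
      unfolding q_def g_def using k by (intro continuous_intros) auto
    show "set_integrable lborel {0<..} q" by (rule qi)
  next
    define M where "M = 2 * norm \<eta> * K 0 + norm (2 * ?k * \<gamma> - 1) * K 1 + k * K 2"
    show "norm (P v) \<le> M * (v * D v)" if v: "0 < v" for v
    proof -
      have 1: "norm (rpow (\<eta> + 1) v * w m (v + k)) \<le> K m * (v * D v)" for m
      proof -
        have "norm (rpow (\<eta> + 1) v * w m (v + k)) = v * norm (rpow \<eta> v * w m (v + k))"
          unfolding rpow_plus_1[OF v] using v by (simp add: norm_mult)
        also have "\<dots> \<le> v * (K m * D v)" using v by (intro mult_left_mono norm_integrand_le k) auto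
        finally show ?thesis by (simp add: mult.left_commute)
      qed
      have "P v = 2 * \<eta> * (rpow (\<eta> + 1) v * w 0 (v + k)) + (2 * ?k * \<gamma> - 1) * (rpow (\<eta> + 1) v * w 1 (v + k)) - ?k * (rpow (\<eta> + 1) v * w 2 (v + k))"
        by (simp add: P_def algebra_simps)
      also have "norm \<dots> \<le> norm (2 * \<eta>) * (K 0 * (v * D v)) + norm (2 * ?k * \<gamma> - 1) * (K 1 * (v * D v)) + norm ?k * (K 2 * (v * D v))"
        by (intro order_trans[OF norm_triangle_ineq4] add_mono order_trans[OF norm_triangle_ineq])
           (simp_all only: norm_mult[of "2 * \<eta>"] norm_mult[of "2 * ?k * \<gamma> - 1"] norm_mult[of ?k], (intro mult_left_mono 1 norm_ge_zero)+)
      also have "\<dots> = M * (v * D v)" using k by (simp add: M_def norm_mult algebra_simps)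
      finally show ?thesis .
    qed
  qed
  then have "?I = 0" using qi(2) by simp
  then show ?thesis by (simp add: F''_def F'_def c_def eval_nat_numeral)
qed

end

section \<open>Decay and regularity of the derivatives\<close>

context weyl_integral
begin

definition power_bounded :: "nat \<Rightarrow> (real \<Rightarrow> complex) \<Rightarrow> bool" where
  "power_bounded j f \<longleftrightarrow> (\<exists>M. \<forall>k\<ge>0. k ^ j * norm (f k) \<le> M)"

lemma power_bounded_F: "j \<le> m \<Longrightarrow> power_bounded j (F m)"
  using power_norm_F_le[of _ j "m - j"] by (auto simp: power_bounded_def)

lemma power_bounded_add:
  assumes "power_bounded j f" "power_bounded j g" shows "power_bounded j (\<lambda>k. f k + g k)"
proof -
  obtain M N where "\<And>k. 0 \<le> k \<Longrightarrow> k ^ j * norm (f k) \<le> M" "\<And>k. 0 \<le> k \<Longrightarrow> k ^ j * norm (g k) \<le> N"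
    using assms by (auto simp: power_bounded_def)
  moreover have "k ^ j * norm (f k + g k) \<le> k ^ j * norm (f k) + k ^ j * norm (g k)" if "0 \<le> k" for k
    using that by (simp add: distrib_left[symmetric] mult_left_mono norm_triangle_ineq)
  ultimately have "k ^ j * norm (f k + g k) \<le> M + N" if "0 \<le> k" for k using that by (meson add_mono order_trans)
  then show ?thesis by (auto simp: power_bounded_def)
qed

lemma power_bounded_mult:
  assumes "power_bounded j f" shows "power_bounded j (\<lambda>k. c * f k)"
proof -
  obtain M where M: "\<And>k. 0 \<le> k \<Longrightarrow> k ^ j * norm (f k) \<le> M"
    using assms by (auto simp: power_bounded_def)
  have "k ^ j * norm (c * f k) \<le> norm c * M" if "0 \<le> k" for k
    using mult_left_mono[OF M[OF that], of "norm c"] by (simp add: norm_mult algebra_simps)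
  then show ?thesis by (auto simp: power_bounded_def)
qed

lemma power_bounded_diff:
  assumes "power_bounded j f" "power_bounded j g" shows "power_bounded j (\<lambda>k. f k - g k)"
  using power_bounded_add[OF assms(1) power_bounded_mult[OF assms(2), of "-1"]] by simp

lemma power_bounded_divide: "power_bounded j f \<Longrightarrow> power_bounded j (\<lambda>k. f k / c)"
  using power_bounded_mult[of j f "1 / c"] by simp

text \<open>Each differentiation gains one order of decay, because it raises the index of every
  \<open>F m\<close> by at least 1. This makes \<open>k F'\<close>, \<open>k^2 F''\<close> and
  \<open>k^3 F'''\<close> bounded, as \<open>U1\<close>, \<open>U2\<close> and \<open>U3\<close>
  require.\<close>

lemma power_bounded_derivatives:
  shows power_bounded_F': "j \<le> Suc m \<Longrightarrow> power_bounded j (F' m)"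
    and power_bounded_F'': "j \<le> 2 \<Longrightarrow> power_bounded j F''"
    and power_bounded_F''': "j \<le> 3 \<Longrightarrow> power_bounded j F'''"
proof -
  show *: "power_bounded j (F' m)" if "j \<le> Suc m" for j m
    unfolding F'_def using that by (intro power_bounded_diff power_bounded_divide power_bounded_mult power_bounded_F) auto
  show "power_bounded j F''" if "j \<le> 2"
    unfolding F''_def using that by (intro power_bounded_diff power_bounded_divide power_bounded_mult *) auto
  show "power_bounded j F'''" if "j \<le> 3"
    unfolding F'''_def using that by (intro power_bounded_diff power_bounded_divide power_bounded_mult *) auto
qed

lemma has_vector_derivative_F':
  assumes "0 \<le> k" shows "(F' 0 has_vector_derivative F'' k) (at k within {0..})"
proof -
  have "F' 0 = (\<lambda>k. F 2 k / 2 - \<gamma> * F 1 k)" by (simp add: F'_def fun_eq_iff numeral_2_eq_2)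
  then show ?thesis unfolding F''_def
    by (simp only:) (intro has_vector_derivative_diff has_vector_derivative_divide has_vector_derivative_mult_right has_vector_derivative_F assms)
qed

lemma has_vector_derivative_F'':
  assumes "0 \<le> k" shows "(F'' has_vector_derivative F''' k) (at k within {0..})"
proof -
  have "F'' = (\<lambda>k. (F 4 k / 2 - (\<gamma> + 2) * F 3 k) / 2 - \<gamma> * (F 3 k / 2 - (\<gamma> + 1) * F 2 k))"
    by (simp add: F''_def F'_def fun_eq_iff eval_nat_numeral)
  then show ?thesis unfolding F'''_def
    by (simp only:) (intro has_vector_derivative_diff has_vector_derivative_divide has_vector_derivative_mult_right has_vector_derivative_F assms)
qed

lemma continuous_on_F:
  "continuous_on {0..} (F m)" "continuous_on {0..} (F' m)" "continuous_on {0..} F''"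
proof -
  have *: "continuous_on {0..} (F m)" for m
    by (rule continuous_on_vector_derivative[OF has_vector_derivative_F]) simp
  then show "continuous_on {0..} (F m)" .
  show **: "continuous_on {0..} (F' m)" for m unfolding F'_def by (intro continuous_intros *) auto
  show "continuous_on {0..} F''" unfolding F''_def by (intro continuous_intros **) auto
qed

end

section \<open>The candidate solution on the whole line\<close>

locale weyl_resolvent = weyl_integral +
  fixes A :: complex
begin

text \<open>
  For \<open>k < 0\<close> the function is continued linearly; there it is the payoff of an option that
  is certain to be exercised.
\<close>

definition "G k = A * F 0 (max 0 k) + of_real (min 0 k) * (A * F' 0 0)"
definition "G1 k = A * F' 0 (max 0 k)"
definition "U1 k = G k - of_real k * G1 k"
definition "U2 k = U1 k + of_real ((max 0 k)\<^sup>2) * (A * F'' (max 0 k))"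
text \<open>\<open>8 U3 k\<close> is the third derivative at \<open>n = 0\<close> of
  \<open>n \<mapsto> exp (2 n) G (k exp (- 2 n))\<close>; it controls the Taylor remainder.\<close>

definition "U3 k = U1 k - of_real ((max 0 k) ^ 3) * (A * F''' (max 0 k))"

text \<open>For negative \<open>k\<close> the function \<open>G\<close> is affine with slope
  \<open>G1\<close>, so \<open>G - k G1\<close> is its intercept. Hence \<open>U1\<close>,
  \<open>U2\<close> and \<open>U3\<close> are constant there.\<close>

lemma U1_eq: "U1 k = A * F 0 (max 0 k) - of_real (max 0 k) * (A * F' 0 (max 0 k))"
  by (cases "0 \<le> k") (simp_all add: U1_def G_def G1_def)

lemma max0_continuous: "continuous_on UNIV (\<lambda>k. f (max 0 k))" if "continuous_on {0..} f" for f :: "real \<Rightarrow> complex"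
  using that by (rule continuous_on_compose2) (auto intro!: continuous_intros)

lemma continuous_G1: "continuous_on UNIV G1"
  unfolding G1_def by (intro continuous_intros max0_continuous continuous_on_F)

lemma continuous_G: "continuous_on UNIV G"
  unfolding G_def by (intro continuous_intros max0_continuous continuous_on_F)

lemma continuous_U1: "continuous_on UNIV U1"
  unfolding U1_def by (intro continuous_intros continuous_G continuous_G1)

lemma continuous_U2: "continuous_on UNIV U2"
  unfolding U2_def by (intro continuous_intros continuous_U1 max0_continuous continuous_on_F)

text \<open>The slope of the affine branch is the right derivative at 0, so the two pieces join with
  matching first derivatives.\<close>

lemma has_vector_derivative_G: "(G has_vector_derivative G1 k) (at k)"
proof (rule has_vector_derivative_at_split)
  have right: "(G has_vector_derivative G1 x) (at x within {0..})" if "0 \<le> x" for x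
  proof (rule has_vector_derivative_transform)
    show "((\<lambda>k. A * F 0 k) has_vector_derivative G1 x) (at x within {0..})"
      using has_vector_derivative_mult_right[OF has_vector_derivative_F[OF that], of A] that by (simp add: G1_def)
  qed (use that in \<open>auto simp: G_def\<close>)
  have left: "(G has_vector_derivative G1 x) (at x within {..0})" if "x \<le> 0" for x
  proof (rule has_vector_derivative_transform)
    show "((\<lambda>k. A * F 0 0 + of_real k * (A * F' 0 0)) has_vector_derivative G1 x) (at x within {..0})"
      using that by (auto intro!: derivative_eq_intros simp: G1_def)
  qed (use that in \<open>auto simp: G_def\<close>)
  have two: "(G has_vector_derivative G1 k) (at k)" if "k \<noteq> 0"
  proof (cases "0 < k")
    case True
    then have "at k within {0..} = at k" by (intro at_within_interior) (simp add: interior_real_atLeast)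
    then show ?thesis using right[of k] True by simp
  next
    case False
    then have "at k within {..0} = at k" using that by (intro at_within_interior) (simp add: interior_real_atMost)
    then show ?thesis using left[of k] False by simp
  qed
  show "(G has_vector_derivative G1 k) (at k within {k..})"
    using right[of k] two by (cases "k = 0") (auto intro: has_vector_derivative_at_within)
  show "(G has_vector_derivative G1 k) (at k within {..k})"
    using left[of k] two by (cases "k = 0") (auto intro: has_vector_derivative_at_within)
qed

lemma has_vector_derivative_scaled:
  fixes U :: "real \<Rightarrow> complex"
  assumes "(U has_vector_derivative U') (at (k * exp (- 2 * s)))"
  shows "((\<lambda>s. of_real (exp (2 * s)) * U (k * exp (- 2 * s))) has_vector_derivative
    of_real (2 * exp (2 * s)) * (U (k * exp (- 2 * s)) - of_real (k * exp (- 2 * s)) * U')) (at s)"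
proof -
  have 1: "((\<lambda>s. k * exp (- 2 * s)) has_vector_derivative - 2 * k * exp (- 2 * s)) (at s)"
    by (auto intro!: derivative_eq_intros simp: has_real_derivative_iff_has_vector_derivative[symmetric])
  have 2: "((\<lambda>s. complex_of_real (exp (2 * s))) has_vector_derivative of_real (2 * exp (2 * s))) (at s)"
    by (intro has_vector_derivative_of_real) (auto intro!: derivative_eq_intros simp: has_real_derivative_iff_has_vector_derivative[symmetric])
  from has_vector_derivative_mult[OF 2 vector_diff_chain_at[OF 1 assms]]
  show ?thesis by (simp add: o_def scaleR_conv_of_real algebra_simps)
qed

lemma deriv_UNIV_of_pos:
  fixes f :: "real \<Rightarrow> complex"
  assumes "0 < k" "(f has_vector_derivative d) (at k within {0..})" shows "(f has_vector_derivative d) (at k)"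
proof -
  have "at k within {0..} = at k" using assms(1) by (intro at_within_interior) (simp add: interior_real_atLeast)
  then show ?thesis using assms(2) by simp
qed

lemma U1_deriv_pos:
  assumes "0 < k" shows "(U1 has_vector_derivative - of_real k * (A * F'' k)) (at k)"
proof -
  have "((\<lambda>k. A * F 0 k - of_real k * (A * F' 0 k)) has_vector_derivative - of_real k * (A * F'' k)) (at k)"
    using deriv_UNIV_of_pos[OF assms has_vector_derivative_F[of k 0]] deriv_UNIV_of_pos[OF assms has_vector_derivative_F'[of k]] assms
    by (auto intro!: derivative_eq_intros has_vector_derivative_mult_right)
  then show ?thesis
    by (rule has_vector_derivative_transform_within_open[of _ _ _ "{0<..}"]) (use assms in \<open>auto simp: U1_eq\<close>)
qed

lemma U2_deriv_pos:
  assumes "0 < k" shows "(U2 has_vector_derivative of_real k * (A * F'' k) + of_real (k\<^sup>2) * (A * F''' k)) (at k)"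
proof -
  have sq: "((\<lambda>k. complex_of_real (k\<^sup>2)) has_vector_derivative of_real (2 * k)) (at k)"
    by (intro has_vector_derivative_of_real) (auto intro!: derivative_eq_intros simp: has_real_derivative_iff_has_vector_derivative[symmetric])
  have "((\<lambda>k. U1 k + of_real (k\<^sup>2) * (A * F'' k)) has_vector_derivative - of_real k * (A * F'' k) +
      (of_real (k\<^sup>2) * (A * F''' k) + of_real (2 * k) * (A * F'' k))) (at k)"
    using deriv_UNIV_of_pos[OF assms has_vector_derivative_F''[of k]] assms
    by (intro has_vector_derivative_add has_vector_derivative_mult[OF sq] has_vector_derivative_mult_right U1_deriv_pos) auto
  then have "(U2 has_vector_derivative - of_real k * (A * F'' k) +
      (of_real (k\<^sup>2) * (A * F''' k) + of_real (2 * k) * (A * F'' k))) (at k)"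
    by (rule has_vector_derivative_transform_within_open[of _ _ _ "{0<..}"]) (use assms in \<open>auto simp: U2_def\<close>)
  then show ?thesis by (simp add: algebra_simps)
qed

text \<open>Multiplication by \<open>exp (- 2 s)\<close> keeps the sign of \<open>k\<close>, so the
  curve never passes through the point where the second derivative of \<open>G\<close> may jump. For
  \<open>k > 0\<close> the formulas on the half-line apply; otherwise \<open>U1\<close>,
  \<open>U2\<close> and \<open>U3\<close> are constant.\<close>

lemma scaled_chain:
  "((\<lambda>s. of_real (exp (2 * s)) * G (k * exp (- 2 * s))) has_vector_derivative of_real (2 * exp (2 * s)) * U1 (k * exp (- 2 * s))) (at s)"
  "((\<lambda>s. of_real (exp (2 * s)) * U1 (k * exp (- 2 * s))) has_vector_derivative of_real (2 * exp (2 * s)) * U2 (k * exp (- 2 * s))) (at s)"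
  "((\<lambda>s. of_real (exp (2 * s)) * U2 (k * exp (- 2 * s))) has_vector_derivative of_real (2 * exp (2 * s)) * U3 (k * exp (- 2 * s))) (at s)"
proof -
  show "((\<lambda>s. of_real (exp (2 * s)) * G (k * exp (- 2 * s))) has_vector_derivative of_real (2 * exp (2 * s)) * U1 (k * exp (- 2 * s))) (at s)"
    unfolding U1_def by (rule has_vector_derivative_scaled[OF has_vector_derivative_G])
  let ?l = "k * exp (- 2 * s)"
  have e2: "((\<lambda>s. of_real (exp (2 * s)) * c) has_vector_derivative of_real (2 * exp (2 * s)) * c) (at s)" for c :: complex
    using has_vector_derivative_scaled[of "\<lambda>_. c" 0 k s] by simp
  show "((\<lambda>s. of_real (exp (2 * s)) * U1 (k * exp (- 2 * s))) has_vector_derivative of_real (2 * exp (2 * s)) * U2 (k * exp (- 2 * s))) (at s)"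
  proof (cases "0 < k")
    case True
    then have l: "0 < ?l" by simp
    have "U1 ?l - of_real ?l * (- of_real ?l * (A * F'' ?l)) = U2 ?l"
      using l by (simp add: U2_def power2_eq_square max_def)
    then show ?thesis using has_vector_derivative_scaled[OF U1_deriv_pos[OF l]] by (simp only:)
  next
    case False
    then have "U1 (k * exp (- 2 * s)) = A * F 0 0" "U2 (k * exp (- 2 * s)) = A * F 0 0" for s
      by (simp_all add: U1_eq U2_def max_absorb1 mult_nonpos_nonneg)
    then show ?thesis using e2 by simp
  qed
  show "((\<lambda>s. of_real (exp (2 * s)) * U2 (k * exp (- 2 * s))) has_vector_derivative of_real (2 * exp (2 * s)) * U3 (k * exp (- 2 * s))) (at s)"
  proof (cases "0 < k")
    case True
    then have l: "0 < ?l" by simp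
    have "U2 ?l - of_real ?l * (of_real ?l * (A * F'' ?l) + of_real (?l\<^sup>2) * (A * F''' ?l)) = U3 ?l"
    proof -
      have m: "max 0 ?l = ?l" using l by simp
      show ?thesis unfolding U2_def U3_def m by (simp add: power2_eq_square power3_eq_cube algebra_simps)
    qed
    then show ?thesis using has_vector_derivative_scaled[OF U2_deriv_pos[OF l]] by (simp only:)
  next
    case False
    then have "U2 (k * exp (- 2 * s)) = A * F 0 0" "U3 (k * exp (- 2 * s)) = A * F 0 0" for s
      by (simp_all add: U1_eq U2_def U3_def max_absorb1 mult_nonpos_nonneg)
    then show ?thesis using e2 by simp
  qed
qed

end

section \<open>The Taylor estimate and the verification of the resolvent equation\<close>

context weyl_resolvent
begin

text \<open>Truncation at 0 is 1-Lipschitz, so the bound on the half-line extends across the point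
  0.\<close>

lemma G1_lipschitz:
  assumes M: "\<And>k. 0 \<le> k \<Longrightarrow> norm (A * F'' k) \<le> M"
  shows "norm (G1 x - G1 y) \<le> M * \<bar>x - y\<bar>"
proof -
  have "norm (A * F' 0 (max 0 x) - A * F' 0 (max 0 y)) \<le> M * \<bar>max 0 x - max 0 y\<bar>"
    by (rule vector_derivative_bound[of "{0..}", where f' = "\<lambda>k. A * F'' k"])
      (auto intro!: has_vector_derivative_mult_right has_vector_derivative_F' M)
  also have "\<dots> \<le> M * \<bar>x - y\<bar>"
    using order_trans[OF norm_ge_zero M[of 0]] by (intro mult_left_mono) auto
  finally show ?thesis by (simp add: G1_def)
qed

text \<open>The derivative of \<open>s \<mapsto> G1 (k exp s)\<close> is \<open>l F'' l\<close>, up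
  to the factor \<open>A\<close>, with \<open>l = k exp s\<close>; a bound on this product is
  uniform even for large \<open>k\<close>.\<close>

lemma G1_scale_bound:
  assumes M: "\<And>k. 0 \<le> k \<Longrightarrow> k * norm (A * F'' k) \<le> M"
  shows "norm (G1 k - G1 (k * exp s)) \<le> M * \<bar>s\<bar>"
proof (cases "0 < k")
  case True
  have "norm (G1 (k * exp 0) - G1 (k * exp s)) \<le> M * \<bar>0 - s\<bar>"
  proof (rule vector_derivative_bound[of UNIV])
    fix x
    have l: "0 < k * exp x" using True by simp
    have "((\<lambda>k. A * F' 0 k) has_vector_derivative A * F'' (k * exp x)) (at (k * exp x))"
      using l by (intro has_vector_derivative_mult_right deriv_UNIV_of_pos[OF l] has_vector_derivative_F') simp
    then have "(G1 has_vector_derivative A * F'' (k * exp x)) (at (k * exp x))"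
      by (rule has_vector_derivative_transform_within_open[of _ _ _ "{0<..}"]) (use l in \<open>auto simp: G1_def\<close>)
    moreover have "((\<lambda>s. k * exp s) has_vector_derivative k * exp x) (at x)"
      by (auto intro!: derivative_eq_intros simp: has_real_derivative_iff_has_vector_derivative[symmetric])
    ultimately show "((\<lambda>s. G1 (k * exp s)) has_vector_derivative (k * exp x) *\<^sub>R (A * F'' (k * exp x))) (at x)"
      using vector_diff_chain_at by (fastforce simp: o_def)
    show "norm ((k * exp x) *\<^sub>R (A * F'' (k * exp x))) \<le> M"
      using M[of "k * exp x"] l by simp
  qed auto
  then show ?thesis by simp
next
  case False
  then have "G1 k = G1 (k * exp s)" by (simp add: G1_def max_absorb1 mult_nonpos_nonneg)
  moreover have "0 \<le> M" using M[of 0] by simp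
  ultimately show ?thesis by simp
qed

text \<open>The move from \<open>k\<close> to \<open>(k - h) exp (- 2 n)\<close> is split into the
  scaling to \<open>p = k exp (- 2 n)\<close>, expanded to third order (\<open>T3\<close>), and the
  shift by \<open>d = h exp (- 2 n)\<close>, expanded to first order (\<open>T1\<close>);
  \<open>T2\<close> replaces the slope at \<open>p\<close> by the slope at \<open>k\<close>. Since
  \<open>216 = 8 * 27\<close>, the 8 stems from the third derivative \<open>8 U3\<close> and the 27
  from \<open>x^3 \<le> 27 exp x\<close>.\<close>

lemma taylor_G:
  assumes M4: "\<And>k. 0 \<le> k \<Longrightarrow> norm (A * F'' k) \<le> M4" and M5: "\<And>k. 0 \<le> k \<Longrightarrow> k * norm (A * F'' k) \<le> M5"
    and M: "\<And>k. norm (U3 k) \<le> M" and h: "0 < h" "h \<le> 1"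
  shows "norm (of_real (exp (2 * n)) * G ((k - h) * exp (- 2 * n)) - G k - of_real (2 * n) * U1 k - of_real (2 * n\<^sup>2) * U2 k + of_real h * G1 k)
    \<le> (M4 + 2 * M5 + 216 * M) * h * sqrt h * exp (3 * \<bar>n\<bar> / sqrt h)"
proof -
  have sh: "0 < sqrt h" "sqrt h \<le> 1" "sqrt h * sqrt h = h" using h by auto
  have M0: "0 \<le> M4" "0 \<le> M5" "0 \<le> M"
    using order_trans[OF norm_ge_zero M4[of 0]] M5[of 0] order_trans[OF norm_ge_zero M] by auto
  define x where "x = \<bar>n\<bar> / sqrt h"
  have x: "0 \<le> x" "\<bar>n\<bar> = sqrt h * x" using sh by (auto simp: x_def)
  have nx: "\<bar>n\<bar> \<le> x" unfolding x(2) using sh x(1) mult_right_mono[of "sqrt h" 1 x] by simp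
  have E: "exp (3 * \<bar>n\<bar> / sqrt h) = exp (3 * x)" by (simp add: x_def)
  define p where "p = k * exp (- 2 * n)"
  define d where "d = h * exp (- 2 * n)"
  have d: "0 < d" "exp (2 * n) * d = h" using h by (auto simp: d_def exp_minus)
  \<comment> \<open>This shift may cross 0. Subtracting the tangent at \<open>p\<close> leaves the
    derivative \<open>G1 x - G1 p\<close>, for which Lipschitz continuity of \<open>G1\<close>
    suffices.\<close>
  have t1: "norm (G (p - d) - G p + of_real d * G1 p) \<le> M4 * (d * d)"
  proof -
    have "norm ((G (p - d) - of_real (p - d) * G1 p) - (G p - of_real p * G1 p)) \<le> (M4 * d) * \<bar>(p - d) - p\<bar>"
    proof (rule vector_derivative_bound[of "{p - d..p}", where f' = "\<lambda>x. G1 x - G1 p"])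
      show "((\<lambda>x. G x - of_real x * G1 p) has_vector_derivative G1 x - G1 p) (at x within {p - d..p})" for x
        by (rule has_vector_derivative_at_within) (auto intro!: derivative_eq_intros has_vector_derivative_G)
      show "norm (G1 x - G1 p) \<le> M4 * d" if "x \<in> {p - d..p}" for x
        using G1_lipschitz[OF M4, of x p] that mult_left_mono[of "\<bar>x - p\<bar>" d M4] M0 by auto
    qed (use d in auto)
    then show ?thesis using d by (simp add: algebra_simps)
  qed
  have T1: "norm (of_real (exp (2 * n)) * (G (p - d) - G p + of_real d * G1 p)) \<le> M4 * (h * sqrt h * exp (3 * x))"
  proof -
    have "norm (of_real (exp (2 * n)) * (G (p - d) - G p + of_real d * G1 p)) \<le> exp (2 * n) * (M4 * (d * d))"
      unfolding norm_mult norm_of_real abs_exp_cancel by (intro mult_left_mono t1) auto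
    also have "\<dots> = M4 * (h * h * exp (- 2 * n))"
    proof -
      have "exp (2 * n) * (M4 * (d * d)) = M4 * (exp (2 * n) * d) * d" by simp
      then show ?thesis unfolding d(2) by (simp add: d_def)
    qed
    also have "\<dots> \<le> M4 * (h * sqrt h * exp (3 * x))"
    proof (intro mult_left_mono mult_mono M0)
      have "sqrt h * sqrt h \<le> sqrt h * 1" using sh by (intro mult_left_mono) auto
      then show "h \<le> sqrt h" using sh by simp
      show "exp (- 2 * n) \<le> exp (3 * x)" using nx x(1) by simp
    qed (use h in auto)
    finally show ?thesis .
  qed
  have T2: "norm (of_real h * (G1 k - G1 p)) \<le> 2 * M5 * (h * sqrt h * exp (3 * x))"
  proof -
    have "norm (of_real h * (G1 k - G1 p)) \<le> h * (M5 * \<bar>- 2 * n\<bar>)"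
      unfolding norm_mult norm_of_real p_def using h by (intro mult_mono G1_scale_bound M5) auto
    also have "\<bar>- 2 * n\<bar> = 2 * (sqrt h * x)" unfolding x(2)[symmetric] by (simp add: abs_mult)
    also have "h * (M5 * (2 * (sqrt h * x))) = 2 * M5 * (h * sqrt h * x)" by simp
    also have "\<dots> \<le> 2 * M5 * (h * sqrt h * exp (3 * x))"
    proof (intro mult_left_mono)
      show "x \<le> exp (3 * x)" using exp_ge_add_one_self[of "3 * x"] x by linarith
    qed (use h M0 in auto)
    finally show ?thesis .
  qed
  have T3: "norm (of_real (exp (2 * n)) * G p - G k - of_real (2 * n) * U1 k - of_real (2 * n\<^sup>2) * U2 k) \<le> 216 * M * (h * sqrt h * exp (3 * x))"
  proof -
    let ?f = "\<lambda>U s. of_real (exp (2 * s)) * U (k * exp (- 2 * s)) :: complex"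
    have "norm (?f G n - ?f G 0 - of_real n * (2 * ?f U1 0) - of_real (n\<^sup>2) / 2 * (4 * ?f U2 0)) \<le> (8 * exp (2 * \<bar>n\<bar>) * M) * \<bar>n\<bar> ^ 3"
    proof (rule taylor_order_3_bound[where ?f3.0 = "\<lambda>s. 8 * ?f U3 s" and ?f0.0 = "?f G" and ?f1.0 = "\<lambda>s. 2 * ?f U1 s" and ?f2.0 = "\<lambda>s. 4 * ?f U2 s"])
      show "(?f G has_vector_derivative 2 * ?f U1 s) (at s)" for s
        using scaled_chain(1)[of k s] by (simp add: mult.assoc)
      show "((\<lambda>s. 2 * ?f U1 s) has_vector_derivative 4 * ?f U2 s) (at s)" for s
        using has_vector_derivative_mult_right[OF scaled_chain(2)[of k s], of 2] by (simp add: mult.assoc)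
      show "((\<lambda>s. 4 * ?f U2 s) has_vector_derivative 8 * ?f U3 s) (at s)" for s
        using has_vector_derivative_mult_right[OF scaled_chain(3)[of k s], of 4] by (simp add: mult.assoc)
      show "norm (8 * ?f U3 s) \<le> 8 * exp (2 * \<bar>n\<bar>) * M" if "\<bar>s\<bar> \<le> \<bar>n\<bar>" for s
      proof -
        have "norm (8 * ?f U3 s) = 8 * (exp (2 * s) * norm (U3 (k * exp (- 2 * s))))" by (simp add: norm_mult)
        also have "\<dots> \<le> 8 * (exp (2 * \<bar>n\<bar>) * M)" using that by (intro mult_left_mono mult_mono M) auto
        finally show ?thesis by simp
      qed
    qed
    moreover have "?f G n - ?f G 0 - of_real n * (2 * ?f U1 0) - of_real (n\<^sup>2) / 2 * (4 * ?f U2 0)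
      = of_real (exp (2 * n)) * G p - G k - of_real (2 * n) * U1 k - of_real (2 * n\<^sup>2) * U2 k"
      by (simp add: p_def)
    ultimately have "norm (of_real (exp (2 * n)) * G p - G k - of_real (2 * n) * U1 k - of_real (2 * n\<^sup>2) * U2 k) \<le> 8 * M * (exp (2 * \<bar>n\<bar>) * \<bar>n\<bar> ^ 3)"
      by (simp only:) (simp add: algebra_simps)
    also have "\<dots> \<le> 8 * M * (exp (2 * x) * (h * sqrt h * (27 * exp x)))"
    proof (intro mult_left_mono mult_mono)
      \<comment> \<open>The cube of this inequality gives \<open>x^3 \<le> 27 exp x\<close>;
        together with \<open>exp (2 |n|) \<le> exp (2 x)\<close> it leads to the exponent
        \<open>3 x\<close>.\<close>
      have "x / 3 \<le> exp (x / 3)" using exp_ge_add_one_self[of "x / 3"] by linarith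
      then have "(x / 3) ^ 3 \<le> exp (x / 3) ^ 3" using x by (intro power_mono) auto
      also have "exp (x / 3) ^ 3 = exp x" by (simp add: exp_of_nat_mult[symmetric])
      finally have "x ^ 3 \<le> 27 * exp x" by (simp add: power_divide)
      then have "(h * sqrt h) * x ^ 3 \<le> (h * sqrt h) * (27 * exp x)" using h by (intro mult_left_mono) auto
      moreover have "\<bar>n\<bar> ^ 3 = (sqrt h * sqrt h) * sqrt h * x ^ 3" unfolding x(2) by (simp add: power3_eq_cube)
      ultimately show "\<bar>n\<bar> ^ 3 \<le> h * sqrt h * (27 * exp x)" unfolding sh(3) by simp
    qed (use nx M0 h in auto)
    also have "\<dots> = 216 * M * (h * sqrt h * (exp (2 * x) * exp x))" by simp
    also have "exp (2 * x) * exp x = exp (3 * x)" by (simp add: exp_add[symmetric])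
    finally show ?thesis .
  qed
  have dd: "of_real (exp (2 * n)) * (complex_of_real d * G1 p) = of_real h * G1 p"
    unfolding d(2)[symmetric] by simp
  have "(k - h) * exp (- 2 * n) = p - d" by (simp add: p_def d_def left_diff_distrib)
  then have "of_real (exp (2 * n)) * G ((k - h) * exp (- 2 * n)) - G k - of_real (2 * n) * U1 k - of_real (2 * n\<^sup>2) * U2 k + of_real h * G1 k
    = of_real (exp (2 * n)) * (G (p - d) - G p + of_real d * G1 p) + of_real h * (G1 k - G1 p)
      + (of_real (exp (2 * n)) * G p - G k - of_real (2 * n) * U1 k - of_real (2 * n\<^sup>2) * U2 k)"
    by (simp only: distrib_left right_diff_distrib dd) simp
  also have "norm \<dots> \<le> M4 * (h * sqrt h * exp (3 * x)) + 2 * M5 * (h * sqrt h * exp (3 * x)) + 216 * M * (h * sqrt h * exp (3 * x))"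
    by (intro order_trans[OF norm_triangle_ineq] add_mono T1 T2 T3)
  also have "\<dots> = (M4 + 2 * M5 + 216 * M) * h * sqrt h * exp (3 * \<bar>n\<bar> / sqrt h)"
    unfolding E by (simp add: algebra_simps)
  finally show ?thesis .
qed

text \<open>The assumptions on \<open>\<eta>\<close> and \<open>\<gamma>\<close> match the
  coefficients of \<open>ode\<close> with the resolvent equation for positive \<open>k\<close>; the
  normalization of \<open>A\<close> makes the affine branch satisfy it for negative
  \<open>k\<close>.\<close>

lemma yor_resolvent_G:
  fixes \<nu> a :: real and z :: complex
  assumes "standard_brownian_motion Q B" "0 < a"
    and c: "of_real (2 * (\<nu> + 1)) = 4 * \<eta> - 2 * \<gamma>"
    and z: "z = of_real (2 * (\<nu> + 1)) + 2 * \<eta> * (\<gamma> - 1 - \<eta>)"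
    and A: "A * F 0 0 * (z * (z - of_real (2 * (\<nu> + 1)))) = 1"
  shows "\<exists>C. yor_resolvent Q B \<nu> z C a G G1 U1 U2"
proof -
  have ex: "\<exists>M. \<forall>k\<ge>0. k ^ j * norm (A * f k) \<le> M" if "power_bounded j f" for j f
    using power_bounded_mult[OF that, of A] by (simp add: power_bounded_def)
  obtain M1 where M1: "\<And>k. 0 \<le> k \<Longrightarrow> norm (A * F 0 k) \<le> M1"
    using ex[OF power_bounded_F[of 0 0]] by auto
  obtain M2 where M2: "\<And>k. 0 \<le> k \<Longrightarrow> norm (A * F' 0 k) \<le> M2"
    using ex[OF power_bounded_F'[of 0 0]] by auto
  obtain M3 where M3: "\<And>k. 0 \<le> k \<Longrightarrow> k * norm (A * F' 0 k) \<le> M3"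
    using ex[OF power_bounded_F'[of 1 0]] by auto
  obtain M4 where M4: "\<And>k. 0 \<le> k \<Longrightarrow> norm (A * F'' k) \<le> M4"
    using ex[OF power_bounded_F''[of 0]] by auto
  obtain M5 where M5: "\<And>k. 0 \<le> k \<Longrightarrow> k * norm (A * F'' k) \<le> M5"
    using ex[OF power_bounded_F''[of 1]] by auto
  obtain M6 where M6: "\<And>k. 0 \<le> k \<Longrightarrow> k\<^sup>2 * norm (A * F'' k) \<le> M6"
    using ex[OF power_bounded_F''[of 2]] by auto
  obtain M7 where M7: "\<And>k. 0 \<le> k \<Longrightarrow> k ^ 3 * norm (A * F''' k) \<le> M7"
    using ex[OF power_bounded_F'''[of 3]] by auto
  have nn: "0 \<le> M1" "0 \<le> M2" "0 \<le> M3" "0 \<le> M4" "0 \<le> M5" "0 \<le> M6" "0 \<le> M7"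
    using order_trans[OF norm_ge_zero M1[of 0]] order_trans[OF norm_ge_zero M2[of 0]] M3[of 0]
      order_trans[OF norm_ge_zero M4[of 0]] M5[of 0] M6[of 0] M7[of 0] by auto
  have G1b: "norm (G1 k) \<le> M2" for k by (simp add: G1_def M2)
  have U1b: "norm (U1 k) \<le> M1 + M3" for k
    unfolding U1_eq by (rule order_trans[OF norm_triangle_ineq4], intro add_mono)
      (simp_all add: M1 norm_mult[of "of_real _"] M3)
  have U2b: "norm (U2 k) \<le> M1 + M3 + M6" for k
    unfolding U2_def by (rule order_trans[OF norm_triangle_ineq], intro add_mono U1b)
      (simp only: norm_mult[of "of_real _"] norm_of_real abs_power2, rule M6, simp)
  have U3b: "norm (U3 k) \<le> M1 + M3 + M7" for k
  proof -
    have "\<bar>max 0 k ^ 3\<bar> = max 0 k ^ 3" by simp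
    then show ?thesis unfolding U3_def by (intro order_trans[OF norm_triangle_ineq4] add_mono U1b)
      (simp only: norm_mult[of "of_real _"] norm_of_real, rule M7, simp)
  qed
  define C where "C = 216 * (M1 + M2 + M3 + M4 + M5 + M6 + M7)"
  have C: "M2 \<le> C" "M1 + M2 \<le> C" "M1 + M3 \<le> C" "M1 + M3 + M6 \<le> C" "M4 + 2 * M5 + 216 * (M1 + M3 + M7) \<le> C"
    using nn by (auto simp: C_def)
  \<comment> \<open>At \<open>k = 0\<close> the equation loses its second order term and ties the
    slope to the value. With the choice of \<open>A\<close> this gives the slope
    \<open>- 1 / z\<close>, which is what balances the source \<open>max 0 (- k)\<close>.\<close>
  have c0: "F' 0 0 = - (z - of_real (2 * (\<nu> + 1))) * F 0 0"
  proof -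
    have "z - of_real (2 * (\<nu> + 1)) = 2 * \<eta> * (\<gamma> - 1 - \<eta>)" using z by simp
    moreover have "- F' 0 0 - 2 * \<eta> * (\<gamma> - 1 - \<eta>) * F 0 0 = 0" using ode[of 0] by simp
    ultimately show ?thesis by algebra
  qed
  have zG1: "z * (A * F' 0 0) = - 1"
    unfolding c0 using A by (simp add: algebra_simps)
  interpret standard_brownian_motion Q B by (rule assms(1))
  have "yor_resolvent Q B \<nu> z C a G G1 U1 U2"
  \<comment> \<open>The goals treated separately are linear growth (5), the Lipschitz bound (6), the
    generator equation (10) and the Taylor bound (11); the others are immediate from the bounds
    collected above.\<close>
  proof (unfold_locales, goal_cases)
    case 5
    fix k
    have "norm (G k) \<le> norm (A * F 0 (max 0 k)) + norm (of_real (min 0 k) * (A * F' 0 0))"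
      unfolding G_def by (rule norm_triangle_ineq)
    also have "\<dots> \<le> M1 + max 0 (- k) * M2"
    proof (intro add_mono M1)
      have "norm (of_real (min 0 k) * (A * F' 0 0)) = max 0 (- k) * norm (A * F' 0 0)"
        unfolding norm_mult[of "of_real _"] by (auto simp: min_def max_def)
      also have "\<dots> \<le> max 0 (- k) * M2" by (intro mult_left_mono M2) auto
      finally show "norm (of_real (min 0 k) * (A * F' 0 0)) \<le> max 0 (- k) * M2" .
    qed simp
    also have "\<dots> \<le> C + max 0 (- k) * C" using nn by (intro add_mono mult_left_mono) (auto simp: C_def)
    finally show "norm (G k) \<le> C * (1 + max 0 (- k))" by (simp add: algebra_simps)
  next
    case 6
    fix k l
    have "norm (G k - G l) \<le> M2 * \<bar>k - l\<bar>"
      by (rule vector_derivative_bound[of UNIV]) (use has_vector_derivative_G G1b in auto)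
    also have "\<dots> \<le> C * \<bar>k - l\<bar>" using C by (intro mult_right_mono) auto
    finally show "norm (G k - G l) \<le> C * \<bar>k - l\<bar>" .
  next
    case 10
    fix k
    show "of_real (2 * \<nu>) * U1 k + 2 * U2 k - G1 k = z * G k - of_real (max 0 (- k))"
    proof (cases "0 \<le> k")
      case True
      have "of_real (2 * \<nu>) * U1 k + 2 * U2 k - G1 k - z * G k =
          A * (2 * of_real (k\<^sup>2) * F'' k - (of_real (2 * (\<nu> + 1)) * of_real k + 1) * F' 0 k - (z - of_real (2 * (\<nu> + 1))) * F 0 k)"
        using True by (simp add: U2_def U1_def G_def G1_def algebra_simps)
      also have "z - of_real (2 * (\<nu> + 1)) = 2 * \<eta> * (\<gamma> - 1 - \<eta>)" using z by simp
      also have "A * (2 * of_real (k\<^sup>2) * F'' k - (of_real (2 * (\<nu> + 1)) * of_real k + 1) * F' 0 k - 2 * \<eta> * (\<gamma> - 1 - \<eta>) * F 0 k) = 0"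
        unfolding c using ode[OF True] by simp
      finally show ?thesis using True by simp
    next
      case False
      then have U: "U1 k = A * F 0 0" "U2 k = A * F 0 0" "G1 k = A * F' 0 0" "G k = A * F 0 0 + of_real k * (A * F' 0 0)"
        by (simp_all add: U1_eq U2_def G1_def G_def max_def min_def)
      have "z * G k = z * (A * F 0 0) - of_real k"
        unfolding U(4) using zG1 by (simp add: distrib_left mult.left_commute[of z])
      moreover have "A * F' 0 0 = - (z - of_real (2 * (\<nu> + 1))) * (A * F 0 0)" unfolding c0 by simp
      ultimately show ?thesis using False unfolding U(1-3) by (simp add: algebra_simps)
    qed
  next
    case 11
    fix k n h :: real assume "0 < h" "h \<le> 1"
    have "norm (of_real (exp (2 * n)) * G ((k - h) * exp (- 2 * n)) - G k - of_real (2 * n) * U1 k - of_real (2 * n\<^sup>2) * U2 k + of_real h * G1 k)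
        \<le> (M4 + 2 * M5 + 216 * (M1 + M3 + M7)) * h * sqrt h * exp (3 * \<bar>n\<bar> / sqrt h)"
      by (rule taylor_G) fact+
    also have "\<dots> \<le> C * h * sqrt h * exp (3 * \<bar>n\<bar> / sqrt h)"
      using C \<open>0 < h\<close> by (intro mult_right_mono) auto
    finally show "norm (of_real (exp (2 * n)) * G ((k - h) * exp (- 2 * n)) - G k - of_real (2 * n) * U1 k - of_real (2 * n\<^sup>2) * U2 k + of_real h * G1 k)
        \<le> C * h * sqrt h * exp (3 * \<bar>n\<bar> / sqrt h)" .
  qed (use continuous_G continuous_G1 continuous_U1 continuous_U2 assms(2) G1b U1b U2b C in \<open>auto intro: order_trans\<close>)
  then show ?thesis by blast
qed

end

section \<open>Kummer's function\<close>

lemma Gamma_integral: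
  assumes s: "0 < Re s"
  shows "set_integrable lborel {0<..} (\<lambda>t. rpow (s - 1) t * of_real (exp (- t)))"
    and "(LBINT t:{0<..}. rpow (s - 1) t * of_real (exp (- t))) = Gamma s"
proof -
  have eq: "complex_of_real t powr (s - 1) / of_real (exp t) = rpow (s - 1) t * of_real (exp (- t))" if "t \<in> {0<..}" for t
    using that by (simp add: rpow_eq_powr exp_minus divide_inverse)
  have "(\<lambda>t. rpow (s - 1) t * of_real (exp (- t))) absolutely_integrable_on {0<..}"
    using absolutely_integrable_Gamma_integral'[OF s]
    by (subst (asm) set_integrable_cong[OF refl refl eq]) auto
  moreover have "(\<lambda>t. indicat_real {0<..} t *\<^sub>R (rpow (s - 1) t * of_real (exp (- t)))) \<in> borel_measurable lborel"
  proof -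
    have "continuous_on {0<..} (\<lambda>t. rpow (s - 1) t * of_real (exp (- t)))" by (intro continuous_intros) auto
    then show ?thesis
      using borel_measurable_continuous_on_indicator[of "{0<..}" "\<lambda>t. rpow (s - 1) t * of_real (exp (- t))"] by simp
  qed
  ultimately show i: "set_integrable lborel {0<..} (\<lambda>t. rpow (s - 1) t * of_real (exp (- t)))"
    unfolding set_integrable_def by (subst (asm) integrable_completion) auto
  have "((\<lambda>t. rpow (s - 1) t * of_real (exp (- t))) has_integral Gamma s) {0<..}"
    by (rule has_integral_eq[OF eq Gamma_integral_complex'[OF s]])
  then show "(LBINT t:{0<..}. rpow (s - 1) t * of_real (exp (- t))) = Gamma s"
    using set_borel_integral_eq_integral(2)[OF i] by (simp add: integral_unique)
qed

lemma Gamma_nonzero_if_Re_pos: "0 < Re s \<Longrightarrow> Gamma s \<noteq> 0"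
  by (auto simp: Gamma_eq_zero_iff elim!: nonpos_Ints_cases)

lemma rpow_mult: "0 < x \<Longrightarrow> 0 < y \<Longrightarrow> rpow s (x * y) = rpow s x * rpow s y"
  by (simp add: rpow_def ln_mult distrib_left exp_add)

lemma rpow_minus: "rpow (- s) x = 1 / rpow s x"
  by (simp add: rpow_def exp_minus divide_inverse)

lemma rpow_nonzero [simp]: "rpow s x \<noteq> 0"
  by (simp add: rpow_def)

lemma Gamma_integral_scaled:
  assumes s: "0 < Re s" and c: "0 < c"
  shows "set_integrable lborel {0<..} (\<lambda>t. rpow (s - 1) t * of_real (exp (- t * c)))"
    and "(LBINT t:{0<..}. rpow (s - 1) t * of_real (exp (- t * c))) = Gamma s * rpow (- s) c"
proof -
  let ?f = "\<lambda>t. indicat_real {0<..} t *\<^sub>R (rpow (s - 1) t * of_real (exp (- t)))"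
  have eq: "?f (0 + c * t) = rpow (s - 1) c * (indicat_real {0<..} t *\<^sub>R (rpow (s - 1) t * of_real (exp (- t * c))))" for t
    using c by (auto simp: indicator_def rpow_mult zero_less_mult_iff mult.commute)
  have "integrable lborel (\<lambda>t. ?f (0 + c * t))"
    using Gamma_integral(1)[OF s] c unfolding set_integrable_def by (intro lborel_integrable_real_affine) auto
  then have "integrable lborel (\<lambda>t. rpow (s - 1) c * (indicat_real {0<..} t *\<^sub>R (rpow (s - 1) t * of_real (exp (- t * c)))))"
    unfolding eq .
  from integrable_mult_right[OF this, of "1 / rpow (s - 1) c"]
  show "set_integrable lborel {0<..} (\<lambda>t. rpow (s - 1) t * of_real (exp (- t * c)))"
    unfolding set_integrable_def by simp
  have "Gamma s = (\<integral>t. ?f t \<partial>lborel)" using Gamma_integral(2)[OF s] by (simp add: set_lebesgue_integral_def)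
  also have "\<dots> = \<bar>c\<bar> *\<^sub>R (\<integral>t. ?f (0 + c * t) \<partial>lborel)" using c by (intro lborel_integral_real_affine) auto
  also have "\<dots> = of_real c * rpow (s - 1) c * (LBINT t:{0<..}. rpow (s - 1) t * of_real (exp (- t * c)))"
    unfolding eq using c by (simp add: set_lebesgue_integral_def scaleR_conv_of_real)
  also have "of_real c * rpow (s - 1) c = rpow s c" using c by (simp add: rpow_diff_1)
  finally show "(LBINT t:{0<..}. rpow (s - 1) t * of_real (exp (- t * c))) = Gamma s * rpow (- s) c"
    by (simp add: rpow_minus)
qed

lemma norm_rpow_eq_rpow: "0 < t \<Longrightarrow> of_real (norm (rpow s t)) = rpow (of_real (Re s)) t"
  by (simp add: rpow_def flip: exp_of_real)

lemma measurable_rpow [measurable]: "rpow s \<in> borel_measurable borel"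
  unfolding rpow_def by measurable

section \<open>Expansion of the Weyl integral into Kummer's series\<close>

context weyl_integral
begin

text \<open>The integrals \<open>J n k\<close> are Beta integrals: substituting
  \<open>v / (v + k)\<close> gives \<open>k^-(\<gamma> - 1 - \<eta>)\<close> times the Beta function
  at \<open>\<eta> + 1 + n\<close> and \<open>\<gamma> - 1 - \<eta>\<close>. The proof uses only
  their recursion in \<open>n\<close> and the value for \<open>n = 0\<close>.\<close>

definition "j n k v = rpow (\<eta> + of_nat n) v * rpow (- \<gamma> - of_nat n) (v + k)"

definition "J n k = (LBINT v:{0<..}. j n k v)"

lemma rpow_add_nat: "0 < r \<Longrightarrow> rpow (s + of_nat n) r = rpow s r * of_real r ^ n"
proof (induction n)
  case (Suc n)
  then show ?case using rpow_plus_1[of r "s + of_nat n"] by (simp add: add.commute add.left_commute mult.assoc mult.commute)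
qed simp

lemma j_eq:
  assumes "0 < v" "0 < k"
  shows "j n k v = rpow \<eta> v * rpow (- \<gamma>) (v + k) * of_real ((v / (v + k)) ^ n)"
proof -
  have "rpow (- \<gamma>) (v + k) = rpow (- \<gamma> - of_nat n) (v + k) * of_real (v + k) ^ n"
    using rpow_add_nat[of "v + k" "- \<gamma> - of_nat n" n] assms by simp
  moreover have "complex_of_real (v + k) \<noteq> 0"
    using assms by (metis add_pos_pos less_irrefl of_real_eq_0_iff)
  ultimately show ?thesis
    using assms by (simp add: j_def rpow_add_nat power_divide del: of_real_add)
qed

lemma j_0_eq: "0 < v \<Longrightarrow> 0 < k \<Longrightarrow> j 0 k v = rpow \<eta> v * w 0 (v + k) * of_real (exp (1 / (2 * (v + k))))"
  by (simp add: j_def w_def exp_minus)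

lemma norm_j_le:
  assumes "0 < v" "0 < k"
  shows "norm (j n k v) \<le> norm (j 0 k v)" "norm (j 0 k v) \<le> K 0 * exp (1 / (2 * k)) * D v"
proof -
  have "(v / (v + k)) ^ n \<le> 1" using assms by (intro power_le_one) auto
  moreover have "norm (j n k v) = norm (rpow \<eta> v * rpow (- \<gamma>) (v + k)) * (v / (v + k)) ^ n" for n
    unfolding j_eq[OF assms] norm_mult[of "rpow \<eta> v * rpow (- \<gamma>) (v + k)"] norm_of_real
    using assms by (simp add: abs_of_nonneg)
  ultimately show "norm (j n k v) \<le> norm (j 0 k v)"
    by (simp add: mult_left_le del: norm_mult)
  have "norm (j 0 k v) = norm (rpow \<eta> v * w 0 (v + k)) * exp (1 / (2 * (v + k)))"
    unfolding j_0_eq[OF assms] norm_mult[of "rpow \<eta> v * w 0 (v + k)"] by simp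
  also have "\<dots> \<le> (K 0 * D v) * exp (1 / (2 * k))"
    using assms by (intro mult_mono norm_integrand_le) (auto simp: K_def D_def divide_simps)
  finally show "norm (j 0 k v) \<le> K 0 * exp (1 / (2 * k)) * D v" by (simp only: mult_ac)
qed

lemma j_measurable: "0 < k \<Longrightarrow> (\<lambda>v. indicat_real {0<..} v *\<^sub>R j n k v) \<in> borel_measurable lborel"
  unfolding j_def by measurable

lemma integrable_j:
  assumes "0 < k" shows "set_integrable lborel {0<..} (j n k)"
  unfolding set_integrable_def
proof (rule Bochner_Integration.integrable_bound)
  show "integrable lborel (\<lambda>v. (K 0 * exp (1 / (2 * k))) * (indicat_real {0<..} v *\<^sub>R D v))"
    using integrable_D unfolding set_integrable_def by (rule integrable_mult_right)
  show "AE v in lborel. norm (indicat_real {0<..} v *\<^sub>R j n k v) \<le> norm ((K 0 * exp (1 / (2 * k))) * (indicat_real {0<..} v *\<^sub>R D v))"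
  proof (intro AE_I2)
    fix v :: real
    have "0 \<le> K 0 * exp (1 / (2 * k)) * D v" by (simp add: K_def D_def)
    then show "norm (indicat_real {0<..} v *\<^sub>R j n k v) \<le> norm ((K 0 * exp (1 / (2 * k))) * (indicat_real {0<..} v *\<^sub>R D v))"
      using norm_j_le(1)[OF _ assms, of v n] norm_j_le(2)[OF _ assms, of v] by (cases "0 < v") auto
  qed
qed (rule j_measurable[OF assms])

text \<open>Integrating the derivative of \<open>v^(\<eta> + n + 1) (v + k)^(- \<gamma> - n)\<close>
  gives 0. The resulting ratio of consecutive integrals is the ratio of consecutive Pochhammer
  quotients.\<close>

lemma J_Suc:
  assumes k: "0 < k"
  shows "(\<eta> + 1 + of_nat n) * J n k = (\<gamma> + of_nat n) * J (Suc n) k"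
proof -
  define P where "P v = rpow (\<eta> + of_nat n + 1) v * rpow (- \<gamma> - of_nat n) (v + k)" for v
  define q where "q v = (\<eta> + 1 + of_nat n) * j n k v - (\<gamma> + of_nat n) * j (Suc n) k v" for v
  have "(LBINT v:{0<..}. q v) = 0"
  proof (rule integral_derivative_eq_0[where P = P])
    fix v :: real assume v: "0 < v"
    have "((\<lambda>v. v + k) has_vector_derivative 1) (at v)" by (auto intro!: derivative_eq_intros)
    from vector_diff_chain_at[OF this has_vector_derivative_rpow[of "v + k" "- \<gamma> - of_nat n" UNIV]] v k
    have "((\<lambda>v. rpow (- \<gamma> - of_nat n) (v + k)) has_vector_derivative (- \<gamma> - of_nat n) * rpow (- \<gamma> - of_nat n - 1) (v + k)) (at v)"
      by (simp add: o_def)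
    from has_vector_derivative_mult[OF has_vector_derivative_rpow[OF v, of "\<eta> + of_nat n + 1"] this]
    show "(P has_vector_derivative q v) (at v)"
      by (simp add: P_def[abs_def] q_def j_def algebra_simps)
    have "norm (P v) = v * norm (j n k v)"
      using v unfolding P_def rpow_plus_1[OF v] by (simp add: j_def norm_mult)
    also have "\<dots> \<le> v * (K 0 * exp (1 / (2 * k)) * D v)"
      using v norm_j_le(1)[OF v k, of n] norm_j_le(2)[OF v k] by (intro mult_left_mono) auto
    finally show "norm (P v) \<le> (K 0 * exp (1 / (2 * k))) * (v * D v)" by (simp add: algebra_simps)
  next
    show "continuous_on {0<..} q"
      unfolding q_def j_def using k by (intro continuous_intros) auto
    show "set_integrable lborel {0<..} q"
      unfolding q_def by (intro set_integral_diff set_integrable_mult_right impI integrable_j k)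
  qed
  moreover have "(LBINT v:{0<..}. q v) = (\<eta> + 1 + of_nat n) * J n k - (\<gamma> + of_nat n) * J (Suc n) k"
    unfolding q_def J_def
    by (subst set_integral_diff(2)) (auto intro!: set_integrable_mult_right integrable_j k)
  ultimately show ?thesis by simp
qed

lemma J_eq_pochhammer:
  assumes k: "0 < k"
  shows "J n k = pochhammer (\<eta> + 1) n / pochhammer \<gamma> n * J 0 k"
proof (induction n)
  case (Suc n)
  have "0 < Re (\<gamma> + of_nat n)" using \<eta> \<gamma> by simp
  then have "\<gamma> + of_nat n \<noteq> 0" by (metis less_irrefl zero_complex.sel(1))
  then have "J (Suc n) k = (\<eta> + 1 + of_nat n) / (\<gamma> + of_nat n) * J n k"
    using J_Suc[OF k, of n] by (simp add: field_simps)
  then show ?case unfolding Suc by (simp add: pochhammer_Suc mult_ac)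
qed simp

text \<open>With \<open>q = 1 / (2 k)\<close> one has
  \<open>q - 1 / (2 (v + k)) = q v / (v + k)\<close>. As \<open>v / (v + k) \<le> 1\<close>, the
  exponential series in this quantity is dominated by the series of \<open>exp q\<close> times
  \<open>|j 0 k v|\<close>, which permits termwise integration.\<close>

lemma F_eq_series:
  assumes k: "0 < k"
  shows "(\<lambda>n. of_real ((1 / (2 * k)) ^ n / fact n) * J n k) sums (of_real (exp (1 / (2 * k))) * F 0 k)"
proof -
  define q where "q = 1 / (2 * k)"
  have q: "0 < q" using k by (simp add: q_def)
  define f where "f n v = indicat_real {0<..} v *\<^sub>R (of_real (q ^ n / fact n) * j n k v)" for n v
  have f_eq: "f n = (\<lambda>v. of_real (q ^ n / fact n) * (indicat_real {0<..} v *\<^sub>R j n k v))" for n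
    by (simp add: f_def fun_eq_iff)
  have fi: "integrable lborel (f n)" for n
    using integrable_j[OF k, of n] unfolding f_eq set_integrable_def by (rule integrable_mult_right)
  have fn: "norm (f n v) \<le> q ^ n / fact n * norm (indicat_real {0<..} v *\<^sub>R j 0 k v)" for n v
    using norm_j_le(1)[OF _ k, of v n] q by (auto simp: f_def indicator_def norm_mult norm_divide norm_power intro!: divide_right_mono mult_left_mono)
  have se: "summable (\<lambda>n. q ^ n / fact n * c)" for c
    by (intro summable_mult2) (use summable_exp[of q] in \<open>simp add: divide_inverse mult.commute\<close>)
  have s1: "AE v in lborel. summable (\<lambda>n. norm (f n v))"
    by (intro AE_I2 summable_comparison_test'[OF se, of 0]) (use fn in auto)
  have s2: "summable (\<lambda>n. \<integral>v. norm (f n v) \<partial>lborel)"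
  proof (rule summable_comparison_test'[OF se, of 0])
    fix n
    have "(\<integral>v. norm (f n v) \<partial>lborel) \<le> (\<integral>v. q ^ n / fact n * norm (indicat_real {0<..} v *\<^sub>R j 0 k v) \<partial>lborel)"
      using integrable_j[OF k, of 0] fi by (intro integral_mono fn integrable_mult_right integrable_norm) (auto simp: set_integrable_def)
    then show "norm (\<integral>v. norm (f n v) \<partial>lborel) \<le> q ^ n / fact n * (\<integral>v. norm (indicat_real {0<..} v *\<^sub>R j 0 k v) \<partial>lborel)"
      by (simp add: integral_nonneg_AE)
  qed
  have "(\<lambda>n. \<integral>v. f n v \<partial>lborel) sums (\<integral>v. (\<Sum>n. f n v) \<partial>lborel)"
    by (rule sums_integral[OF fi s1 s2])
  moreover have "(\<integral>v. f n v \<partial>lborel) = of_real (q ^ n / fact n) * J n k" for n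
    unfolding J_def set_lebesgue_integral_def f_eq by (rule integral_mult_right_zero)
  moreover have "(\<Sum>n. f n v) = of_real (exp q) * (indicat_real {0<..} v *\<^sub>R (rpow \<eta> v * w 0 (v + k)))" for v
  proof (cases "0 < v")
    case True
    define x where "x = q * (v / (v + k))"
    have "f n v = rpow \<eta> v * rpow (- \<gamma>) (v + k) * of_real (x ^ n / fact n)" for n
      using True by (simp add: f_def j_eq[OF True k] x_def power_mult_distrib power_divide mult_ac)
    moreover have "(\<lambda>n. x ^ n / fact n) sums exp x"
      using exp_converges[of x] by (simp add: divide_inverse mult.commute)
    then have "(\<lambda>n. rpow \<eta> v * rpow (- \<gamma>) (v + k) * of_real (x ^ n / fact n)) sums (rpow \<eta> v * rpow (- \<gamma>) (v + k) * of_real (exp x))"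
      by (intro sums_mult sums_of_real)
    ultimately have "(\<Sum>n. f n v) = rpow \<eta> v * rpow (- \<gamma>) (v + k) * of_real (exp x)"
      by (simp add: sums_iff)
    moreover have "x = q + (- 1 / (2 * (v + k)))" using True k by (simp add: x_def q_def field_simps)
    then have "exp x = exp q * exp (- 1 / (2 * (v + k)))" by (simp only: exp_add)
    ultimately show ?thesis using True by (simp add: w_def)
  qed (simp add: f_def)
  ultimately show ?thesis
    unfolding F_def set_lebesgue_integral_def q_def[symmetric] by (simp only: integral_mult_right_zero)
qed

lemma F_eq_kummer:
  assumes k: "0 < k" and J0: "J 0 k \<noteq> 0"
  shows "F 0 k = of_real (exp (- 1 / (2 * k))) * J 0 k * kummer_Phi (\<eta> + 1) \<gamma> (of_real (1 / (2 * k)))"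
proof -
  have "(\<lambda>n. J 0 k * (pochhammer (\<eta> + 1) n / pochhammer \<gamma> n * (of_real (1 / (2 * k)) ^ n / fact n))) sums (of_real (exp (1 / (2 * k))) * F 0 k)"
  proof (rule sums_cong[THEN iffD1, OF _ F_eq_series[OF k]])
    fix n
    show "of_real ((1 / (2 * k)) ^ n / fact n) * J n k = J 0 k * (pochhammer (\<eta> + 1) n / pochhammer \<gamma> n * (of_real (1 / (2 * k)) ^ n / fact n))"
      by (subst J_eq_pochhammer[OF k, of n]) (simp add: mult_ac)
  qed
  then have "(\<lambda>n. pochhammer (\<eta> + 1) n / pochhammer \<gamma> n * (of_real (1 / (2 * k)) ^ n / fact n)) sums (of_real (exp (1 / (2 * k))) * F 0 k / J 0 k)"
    by (rule sums_mult_D[OF _ J0])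
  then have "kummer_Phi (\<eta> + 1) \<gamma> (of_real (1 / (2 * k))) = of_real (exp (1 / (2 * k))) * F 0 k / J 0 k"
    unfolding kummer_Phi_def by (rule sums_unique[symmetric])
  then show ?thesis using J0 by (simp add: exp_minus of_real_inverse)
qed

end

section \<open>Evaluation of the constants by Gamma integrals\<close>

context weyl_integral
begin

text \<open>The factor \<open>(v + k)^(- \<gamma>)\<close> is written as a Gamma integral over
  \<open>t\<close>. After exchanging the order of integration, the \<open>v\<close>-integral gives
  \<open>Gamma (\<eta> + 1) t^(- \<eta> - 1)\<close>, and a Gamma integral with parameter
  \<open>\<gamma> - 1 - \<eta>\<close> remains.\<close>

lemma J_0_eq_Gamma:
  assumes k: "0 < k"
  shows "J 0 k = Gamma (\<eta> + 1) * Gamma (\<gamma> - 1 - \<eta>) / Gamma \<gamma> * rpow (- (\<gamma> - 1 - \<eta>)) k"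
proof -
  define f where "f v t = indicat_real {0<..} v *\<^sub>R (indicat_real {0<..} t *\<^sub>R (rpow \<eta> v * (rpow (\<gamma> - 1) t * of_real (exp (- t * (v + k))))))" for v t :: real
  have \<gamma>0: "0 < Re \<gamma>" using \<eta> \<gamma> by simp
  have f1: "integrable lborel (f v)" "(\<integral>t. f v t \<partial>lborel) = Gamma \<gamma> * (indicat_real {0<..} v *\<^sub>R j 0 k v)" for v
  proof -
    have "integrable lborel (f v) \<and> (\<integral>t. f v t \<partial>lborel) = Gamma \<gamma> * (indicat_real {0<..} v *\<^sub>R j 0 k v)"
    proof (cases "0 < v")
      case True
      have e: "f v = (\<lambda>t. rpow \<eta> v * (indicat_real {0<..} t *\<^sub>R (rpow (\<gamma> - 1) t * of_real (exp (- t * (v + k))))))"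
        using True by (simp add: f_def fun_eq_iff)
      have vk: "0 < v + k" using True k by simp
      note g = Gamma_integral_scaled[OF \<gamma>0 vk, unfolded set_integrable_def set_lebesgue_integral_def]
      show ?thesis unfolding e integral_mult_right_zero g(2)
        by (rule conjI[OF integrable_mult_right[OF g(1)]]) (use True in \<open>simp add: j_def\<close>)
    qed (simp add: f_def[abs_def])
    then show "integrable lborel (f v)" "(\<integral>t. f v t \<partial>lborel) = Gamma \<gamma> * (indicat_real {0<..} v *\<^sub>R j 0 k v)" by auto
  qed
  have f2: "(\<integral>v. f v t \<partial>lborel) = Gamma (\<eta> + 1) * (indicat_real {0<..} t *\<^sub>R (rpow (\<gamma> - 1 - \<eta> - 1) t * of_real (exp (- t * k))))" for t
  proof (cases "0 < t")
    case True
    have e: "f v t = (rpow (\<gamma> - 1) t * of_real (exp (- t * k))) * (indicat_real {0<..} v *\<^sub>R (rpow (\<eta> + 1 - 1) v * of_real (exp (- v * t))))" for v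
      using True by (simp add: f_def algebra_simps exp_add[symmetric] flip: of_real_mult)
    have \<eta>1: "0 < Re (\<eta> + 1)" using \<eta> by simp
    note g = Gamma_integral_scaled[OF \<eta>1 True, unfolded set_lebesgue_integral_def]
    have "rpow (\<gamma> - 1 - \<eta> - 1) t = rpow (\<gamma> - 1) t * rpow (- (\<eta> + 1)) t"
      by (simp add: rpow_add[symmetric] algebra_simps)
    then show ?thesis unfolding e integral_mult_right_zero g(2) using True by (simp del: of_real_exp)
  qed (simp add: f_def)
  have fm: "case_prod f \<in> borel_measurable (lborel \<Otimes>\<^sub>M lborel)"
    unfolding f_def by measurable
  \<comment> \<open>Absolute values replace \<open>\<gamma>\<close> by its real part, so the inner
    integral is again a Gamma integral; this reduces absolute integrability for Fubini to that of
    \<open>j 0 k\<close>.\<close>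
  have norm_f: "(\<integral>t. norm (f v t) \<partial>lborel) = norm (Gamma (of_real (Re \<gamma>)) :: complex) * norm (indicat_real {0<..} v *\<^sub>R j 0 k v)" for v
  proof (cases "0 < v")
    case True
    then have vk: "0 < v + k" using k by simp
    have \<gamma>r: "0 < Re (of_real (Re \<gamma>) :: complex)" using \<gamma>0 by simp
    have nn: "complex_of_real (norm (f v t)) = of_real (norm (rpow \<eta> v)) * (indicat_real {0<..} t *\<^sub>R (rpow (of_real (Re \<gamma>) - 1) t * of_real (exp (- t * (v + k)))))" for t
      using True norm_rpow_eq_rpow[of t "\<gamma> - 1"] by (auto simp: f_def indicator_def norm_mult simp del: of_real_exp)
    have "complex_of_real (\<integral>t. norm (f v t) \<partial>lborel) = (\<integral>t. complex_of_real (norm (f v t)) \<partial>lborel)"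
      by (rule integral_complex_of_real[symmetric])
    also have "\<dots> = of_real (norm (rpow \<eta> v)) * (Gamma (of_real (Re \<gamma>)) * rpow (- of_real (Re \<gamma>)) (v + k))"
      unfolding nn integral_mult_right_zero
      using Gamma_integral_scaled(2)[OF \<gamma>r vk] by (simp add: set_lebesgue_integral_def del: of_real_exp)
    finally have "norm (complex_of_real (\<integral>t. norm (f v t) \<partial>lborel)) = norm (rpow \<eta> v) * (norm (Gamma (of_real (Re \<gamma>)) :: complex) * norm (rpow (- of_real (Re \<gamma>)) (v + k)))"
      by (simp only: norm_mult norm_of_real abs_norm_cancel)
    moreover have "norm (rpow (- of_real (Re \<gamma>)) (v + k)) = norm (rpow (- \<gamma>) (v + k))"
      using vk by (simp add: norm_rpow)
    moreover have "norm (complex_of_real (\<integral>t. norm (f v t) \<partial>lborel)) = (\<integral>t. norm (f v t) \<partial>lborel)"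
      by (simp add: integral_nonneg_AE)
    ultimately show ?thesis using True by (simp add: j_def norm_mult)
  qed (simp add: f_def)
  have int: "integrable (lborel \<Otimes>\<^sub>M lborel) (case_prod f)"
  proof (rule lborel_pair.Fubini_integrable[OF fm])
    show "integrable lborel (\<lambda>v. \<integral>t. norm (case (v, t) of (v, t) \<Rightarrow> f v t) \<partial>lborel)"
      unfolding prod.case norm_f using integrable_j[OF k, of 0]
      by (intro integrable_mult_right integrable_norm) (simp add: set_integrable_def)
    show "AE v in lborel. integrable lborel (\<lambda>t. case (v, t) of (v, t) \<Rightarrow> f v t)"
      using f1(1) by auto
  qed
  have \<alpha>: "0 < Re (\<gamma> - 1 - \<eta>)" using \<gamma> by simp
  have "Gamma \<gamma> * J 0 k = (\<integral>v. (\<integral>t. f v t \<partial>lborel) \<partial>lborel)"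
    unfolding f1(2) integral_mult_right_zero by (simp add: J_def set_lebesgue_integral_def)
  also have "\<dots> = (\<integral>t. (\<integral>v. f v t \<partial>lborel) \<partial>lborel)"
    by (rule lborel_pair.Fubini_integral[OF int, symmetric])
  also have "\<dots> = Gamma (\<eta> + 1) * (Gamma (\<gamma> - 1 - \<eta>) * rpow (- (\<gamma> - 1 - \<eta>)) k)"
    unfolding f2 integral_mult_right_zero
    using Gamma_integral_scaled(2)[OF \<alpha> k] by (simp only: set_lebesgue_integral_def)
  moreover have "Gamma \<gamma> \<noteq> 0" using \<gamma>0 by (rule Gamma_nonzero_if_Re_pos)
  ultimately show ?thesis by (simp add: field_simps)
qed

text \<open>At \<open>k = 0\<close> the kernel and the weight merge into
  \<open>v^(- \<alpha> - 1) exp (- 1 / (2 v))\<close> with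
  \<open>\<alpha> = \<gamma> - 1 - \<eta>\<close>, and \<open>v = 1 / (2 t)\<close> turns this into
  a Gamma integral.\<close>

lemma F_0_0: "F 0 0 = rpow (\<gamma> - 1 - \<eta>) 2 * Gamma (\<gamma> - 1 - \<eta>)"
proof -
  define \<alpha> where "\<alpha> = \<gamma> - 1 - \<eta>"
  have \<alpha>: "0 < Re \<alpha>" using \<gamma> by (simp add: \<alpha>_def)
  define f where "f v = rpow \<eta> v * w 0 (v + 0)" for v
  have f_eq: "f v = rpow (- \<alpha> - 1) v * of_real (exp (- 1 / (2 * v)))" for v
    by (simp add: f_def w_def \<alpha>_def mult_ac flip: rpow_add)
  define h where "h t = rpow \<alpha> 2 * (rpow (\<alpha> - 1) t * of_real (exp (- t)))" for t
  have hi: "set_integrable lborel {0<..} h" "(LBINT t:{0<..}. h t) = rpow \<alpha> 2 * Gamma \<alpha>"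
    using Gamma_integral[OF \<alpha>] unfolding h_def by auto
  \<comment> \<open>The variable \<open>x = - t\<close> runs over the negative half-line so that
    \<open>x \<mapsto> - 1 / (2 x)\<close> is increasing, as the substitution rule needs; the
    reflection is undone by \<open>hm\<close>.\<close>
  have subst: "(1 / (2 * x\<^sup>2)) *\<^sub>R f (- 1 / (2 * x)) = h (- x)" if "x < 0" for x
  proof -
    define y where "y = - x"
    have y: "0 < y" using that by (simp add: y_def)
    have r: "rpow (- \<alpha> - 1) (1 / (2 * y)) = rpow \<alpha> 2 * rpow \<alpha> y * (2 * of_real y)"
    proof -
      have "rpow (- \<alpha> - 1) (1 / (2 * y)) = rpow (\<alpha> + 1) (2 * y)"
        using y by (simp add: rpow_def ln_div ln_mult algebra_simps)
      also have "\<dots> = rpow (\<alpha> + 1) 2 * rpow (\<alpha> + 1) y" using y by (simp add: rpow_mult)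
      finally show ?thesis using y by (simp add: rpow_plus_1)
    qed
    have "- 1 / (2 * x) = 1 / (2 * y)" "- x = y" "x\<^sup>2 = y\<^sup>2" by (simp_all add: y_def)
    then show ?thesis
      using y by (simp add: f_eq h_def r rpow_diff_1 scaleR_conv_of_real power2_eq_square)
  qed
  have reflect: "(\<lambda>x. indicat_real {..<0} x *\<^sub>R h (- x)) = (\<lambda>x. (\<lambda>t. indicat_real {0<..} t *\<^sub>R h t) (0 + (-1) * x))"
    by (auto simp: fun_eq_iff indicator_def)
  have hmi: "set_integrable lborel {..<0} (\<lambda>x. h (- x))"
    unfolding set_integrable_def reflect
    by (rule lborel_integrable_real_affine[OF hi(1)[unfolded set_integrable_def]]) simp
  have hm: "(LBINT x:{..<0}. h (- x)) = (LBINT t:{0<..}. h t)"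
    unfolding set_lebesgue_integral_def reflect
    using lborel_integral_real_affine[of "-1" "\<lambda>t. indicat_real {0<..} t *\<^sub>R h t" 0] by simp
  have e1: "einterval (- \<infinity>) 0 = {..<0}" and e2: "einterval 0 \<infinity> = {0<..}"
    by (auto simp: einterval_def zero_ereal_def)
  have "(LBINT v=0..\<infinity>. f v) = (LBINT x=-\<infinity>..0. (1 / (2 * x\<^sup>2)) *\<^sub>R f (- 1 / (2 * x)))"
  proof (rule interval_integral_substitution_integrable[where g = "\<lambda>x. - 1 / (2 * x)" and g' = "\<lambda>x. 1 / (2 * x\<^sup>2)"])
    fix x :: real assume "ereal x < 0"
    then have x: "x < 0" by simp
    then show "DERIV (\<lambda>x. - 1 / (2 * x)) x :> 1 / (2 * x\<^sup>2)"
      by (auto intro!: derivative_eq_intros simp: power2_eq_square)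
    have "continuous_on {0<..} f" unfolding f_def by (intro continuous_intros) auto
    then show "isCont f (- 1 / (2 * x))" using x by (simp add: continuous_on_eq_continuous_at field_simps)
    show "isCont (\<lambda>x. 1 / (2 * x\<^sup>2)) x" using x by (intro continuous_intros) auto
  next
    have "((\<lambda>x. - 1 / (2 * x)) \<longlongrightarrow> 0) (at_bot :: real filter)" by real_asymp
    then show "((ereal \<circ> (\<lambda>x. - 1 / (2 * x)) \<circ> real_of_ereal) \<longlongrightarrow> 0) (at_right (- \<infinity>))"
      by (simp add: ereal_tendsto_simps zero_ereal_def comp_assoc)
    have "filterlim (\<lambda>x. - 1 / (2 * x)) at_top (at_left (0 :: real))" by real_asymp
    then show "((ereal \<circ> (\<lambda>x. - 1 / (2 * x)) \<circ> real_of_ereal) \<longlongrightarrow> \<infinity>) (at_left 0)"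
      by (simp add: zero_ereal_def at_left_ereal filterlim_filtermap tendsto_PInfty_eq_at_top comp_def)
    show "set_integrable lborel (einterval (- \<infinity>) 0) (\<lambda>x. (1 / (2 * x\<^sup>2)) *\<^sub>R f (- 1 / (2 * x)))"
      unfolding e1 by (subst set_integrable_cong[OF refl refl subst]) (auto intro: hmi)
    show "set_integrable lborel (einterval 0 \<infinity>) f"
      unfolding e2 f_def by (rule integrand_integrable) simp
  qed auto
  also have "\<dots> = (LBINT x:{..<0}. (1 / (2 * x\<^sup>2)) *\<^sub>R f (- 1 / (2 * x)))"
    by (simp add: interval_lebesgue_integral_def e1)
  also have "\<dots> = (LBINT x:{..<0}. h (- x))"
    by (intro set_lebesgue_integral_cong allI impI subst) auto
  also have "\<dots> = rpow \<alpha> 2 * Gamma \<alpha>" unfolding hm hi(2) ..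
  finally show ?thesis
    unfolding interval_lebesgue_integral_0_infty by (simp add: F_def f_def[abs_def] \<alpha>_def)
qed

text \<open>In the quotient by \<open>F 0 0\<close> the factor
  \<open>Gamma (\<gamma> - 1 - \<eta>)\<close> cancels, and the power of 2 in \<open>F 0 0\<close>
  joins the power of \<open>k\<close> to form a power of \<open>2 k\<close>.\<close>

lemma F_ratio:
  assumes k: "0 < k"
  shows "F 0 0 \<noteq> 0"
    and "F 0 k = F 0 0 * (Gamma (\<eta> + 1) / Gamma \<gamma> * kummer_Phi (\<eta> + 1) \<gamma> (of_real (1 / (2 * k)))
        * (of_real (2 * k) powr (- (\<gamma> - 1 - \<eta>)) / of_real (exp (1 / (2 * k)))))"
proof -
  have nz: "Gamma (\<gamma> - 1 - \<eta>) \<noteq> 0" "Gamma (\<eta> + 1) \<noteq> 0" "Gamma \<gamma> \<noteq> 0"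
    using \<eta> \<gamma> by (auto intro!: Gamma_nonzero_if_Re_pos)
  then show "F 0 0 \<noteq> 0" by (simp add: F_0_0)
  have J0: "J 0 k \<noteq> 0" using nz by (simp add: J_0_eq_Gamma[OF k])
  have "of_real (2 * k) powr (- (\<gamma> - 1 - \<eta>)) = rpow (- (\<gamma> - 1 - \<eta>)) 2 * rpow (- (\<gamma> - 1 - \<eta>)) k"
    using k rpow_mult[of 2 k] rpow_eq_powr[of "2 * k"] by simp
  also have "rpow (- (\<gamma> - 1 - \<eta>)) 2 = 1 / rpow (\<gamma> - 1 - \<eta>) 2" by (rule rpow_minus)
  finally have p: "of_real (2 * k) powr (- (\<gamma> - 1 - \<eta>)) = rpow (- (\<gamma> - 1 - \<eta>)) k / rpow (\<gamma> - 1 - \<eta>) 2" by simp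
  show "F 0 k = F 0 0 * (Gamma (\<eta> + 1) / Gamma \<gamma> * kummer_Phi (\<eta> + 1) \<gamma> (of_real (1 / (2 * k)))
        * (of_real (2 * k) powr (- (\<gamma> - 1 - \<eta>)) / of_real (exp (1 / (2 * k)))))"
    unfolding p F_eq_kummer[OF k J0] J_0_eq_Gamma[OF k] F_0_0
    by (simp add: exp_minus field_simps)
qed

end

section \<open>The Laplace transform\<close>

lemma Re_csqrt_gt:
  assumes "c\<^sup>2 < Re w" shows "\<bar>c\<bar> < Re (csqrt w)"
proof -
  have "Re w = (Re (csqrt w))\<^sup>2 - (Im (csqrt w))\<^sup>2"
    by (subst power2_csqrt[symmetric]) (simp add: power2_eq_square)
  then have "c\<^sup>2 < (Re (csqrt w))\<^sup>2" using assms zero_le_power2[of "Im (csqrt w)"] by linarith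
  then show ?thesis using Re_csqrt[of w] by (metis abs_le_square_iff abs_of_nonneg linorder_not_le)
qed

theorem mainTheorem2:
  fixes Q :: "'a measure" and B :: "real \<Rightarrow> 'a \<Rightarrow> real"
    and \<sigma> varpi \<nu> a :: real and z :: complex
  assumes "standard_brownian_motion Q B"
    and "\<sigma> > 0"
    and "\<nu> = 2 * varpi / \<sigma>\<^sup>2 - 1"
    and "a > 0"
    and "Re z > 0"
    and "\<nu> \<ge> 0 \<Longrightarrow> Re z > 2 * (\<nu> + 1)"
    and "\<nu> < 0 \<Longrightarrow> Re z > 4"
  shows "(\<forall>x\<ge>0. integrable Q (\<lambda>\<omega>. max 0 (yor_accumulation B \<nu> x \<omega> - a))) \<and>
    set_integrable lborel {0..}
      (\<lambda>x. exp (- z * of_real x) *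
        of_real (prob_space.expectation Q (\<lambda>\<omega>. max 0 (yor_accumulation B \<nu> x \<omega> - a)))) \<and>
    (LBINT x:{0..}. exp (- z * of_real x) *
        of_real (prob_space.expectation Q (\<lambda>\<omega>. max 0 (yor_accumulation B \<nu> x \<omega> - a))))
      = yor_D \<nu> a z / (z * (z - 2 * (of_real \<nu> + 1)))"
proof -
  have z: "Re z > 0" "Re z > 2 * (\<nu> + 1)"
    using assms(5-7) by (cases "\<nu> \<ge> 0"; simp)+
  define \<mu> where "\<mu> = yor_mu \<nu> z"
  \<comment> \<open>Here \<open>\<gamma> - 1 - \<eta> = (\<mu> - \<nu> - 2) / 2\<close> is the
    exponent of the decaying power at infinity; together with
    \<open>4 \<eta> - 2 \<gamma> = 2 (\<nu> + 1)\<close> this determines both parameters.\<close>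
  define \<eta> where "\<eta> = (\<mu> + of_real \<nu> + 2) / 2"
  define \<gamma> where "\<gamma> = \<mu> + 1"
  have \<mu>2: "\<mu>\<^sup>2 = 2 * z + (of_real \<nu>)\<^sup>2" by (simp add: \<mu>_def yor_mu_def)
  have "(\<nu> + 2)\<^sup>2 < Re (2 * z + (of_real \<nu>)\<^sup>2)" using z by (simp add: power2_eq_square algebra_simps)
  \<comment> \<open>The two signs of this bound give the two conditions of
    \<open>weyl_integral\<close>: \<open>- Re \<mu> < \<nu> + 2\<close> makes
    \<open>Re \<eta>\<close> positive, and \<open>\<nu> + 2 < Re \<mu>\<close> makes
    \<open>Re \<gamma> - Re \<eta>\<close> exceed 1.\<close>
  then have \<mu>: "\<bar>\<nu> + 2\<bar> < Re \<mu>" unfolding \<mu>_def yor_mu_def by (rule Re_csqrt_gt)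
  have c: "of_real (2 * (\<nu> + 1)) = 4 * \<eta> - 2 * \<gamma>" by (simp add: \<eta>_def \<gamma>_def algebra_simps)
  have z_eq: "z = of_real (2 * (\<nu> + 1)) + 2 * \<eta> * (\<gamma> - 1 - \<eta>)"
  proof -
    have "2 * (2 * \<eta> * (\<gamma> - 1 - \<eta>)) = \<mu>\<^sup>2 - (of_real \<nu> + 2)\<^sup>2"
      by (simp add: \<eta>_def \<gamma>_def field_simps power2_eq_square)
    also have "\<dots> = 2 * (z - of_real (2 * (\<nu> + 1)))" unfolding \<mu>2 by (simp add: power2_eq_square algebra_simps)
    finally show ?thesis by algebra
  qed
  interpret W: weyl_integral \<eta> \<gamma>
    by unfold_locales (use \<mu> in \<open>auto simp: \<eta>_def \<gamma>_def\<close>)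
  have "Re (z - of_real (2 * (\<nu> + 1))) > 0" using z by simp
  then have nz: "z \<noteq> 0" "z - of_real (2 * (\<nu> + 1)) \<noteq> 0" using z by (metis less_irrefl zero_complex.sel(1))+
  \<comment> \<open>This normalizes \<open>W.G 0\<close> to
    \<open>1 / (z (z - 2 (\<nu> + 1)))\<close>, the Laplace transform of the mean accumulation, that
    is, the value at strike 0.\<close>
  define A where "A = 1 / (z * (z - of_real (2 * (\<nu> + 1))) * W.F 0 0)"
  interpret W: weyl_resolvent \<eta> \<gamma> A by unfold_locales
  have A: "A * W.F 0 0 * (z * (z - of_real (2 * (\<nu> + 1)))) = 1"
    using nz W.F_ratio(1)[OF assms(4)] by (simp add: A_def)
  from W.yor_resolvent_G[OF assms(1,4) c z_eq A] obtain C
    where "yor_resolvent Q B \<nu> z C a W.G W.G1 W.U1 W.U2" by blast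
  then interpret R: yor_resolvent Q B \<nu> z C a W.G W.G1 W.U1 W.U2 .
  have exps: "(of_real \<nu> + 4 + \<mu>) / 2 = \<eta> + 1" "(of_real \<nu> + 2 - \<mu>) / 2 = - (\<gamma> - 1 - \<eta>)"
    by (simp_all add: \<eta>_def \<gamma>_def field_simps)
  have "W.G a = A * W.F 0 a" using assms(4) by (simp add: W.G_def)
  also have "\<dots> = A * W.F 0 0 * yor_D \<nu> a z"
    unfolding W.F_ratio(2)[OF assms(4)] yor_D_def \<mu>_def[symmetric] exps by (simp add: \<gamma>_def)
  also have "A * W.F 0 0 = 1 / (z * (z - 2 * (of_real \<nu> + 1)))"
    using A nz by (simp add: eq_divide_eq)
  finally have "W.G a = yor_D \<nu> a z / (z * (z - 2 * (of_real \<nu> + 1)))" by simp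
  then show ?thesis
    using R.integrable_payoff R.resolvent[OF z] unfolding R.u_def by simp
qed

end
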